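(* Let $A$ be an $n$-qubit system and $B$ an $m$-qubit system. For any Clifford unitary $U$ on $\mathcal{H}_A\otimes\mathcal{H}_B$ with induced channel $\mathcal{U}(\rho)=U\rho U^\dagger$, one has $$\gamma_{\mathrm{LOCC}^\star(A;B)}(\mathcal{U})=\gamma_{\mathrm{LOCC}(A;B)}(\mathcal{U})=\gamma_{\mathrm{SEP}(AA';BB')}(J_{\mathcal{U}}),$$ where $J_{\mathcal U}$ is the Choi state of $\mathcal U$ and $A',B'$ are the reference copies of $A,B$.
   Context: A unitary is Clifford if conjugation by it maps the $(n+m)$-qubit Pauli group (tensor products of $\mathbb 1,X,Y,Z$ with phases $i^c$) to itself. The Choi state is $J_{\mathcal U}=(\mathrm{id}_{A'B'}\otimes\mathcal U)(|\Psi\rangle\langle\Psi|_{A'B'AB})$ with $|\Psi\rangle$ the (normalized) maximally entangled state between $AB$ and its copy $A'B'$ in a fixed product basis. $\mathrm{HP}(A\to B)$ is the real vector space of Hermitian-preserving linear maps from operators on $\mathcal H_A$ to operators on $\mathcal H_B$; Hermitian operators are identified with Hermitian-preserving maps with one-dimensional input. Quasiprobability extent: for a set $S$ and an element $\mathcal E$ of this real vector space, $\gamma_S(\mathcal{E})=\inf\{\sum_{i=1}^k|a_i| : k\ge 1,\ \mathcal{E}=\sum_{i=1}^k a_i\mathcal{F}_i,\ \mathcal{F}_i\in S,\ a_i\in\mathbb{R}\}$ ($=\infty$ if no decomposition exists). $\mathrm{SEP}(X;Y)$ is the set of separable states, i.e. finite convex combinations of product states $\rho_X\otimes\sigma_Y$.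 A quantum instrument from $A$ to $B$ is a countable family $(\mathcal{E}_i)_i$ of non-zero completely positive maps whose sum is trace-preserving. LOCC instruments from $AB$ to $AB$ (local operations and classical communication, unboundedly many rounds) are defined in the standard sense: a one-way local instrument w.r.t. one party is an instrument in which that party applies an arbitrary local instrument and, conditioned on its outcome, the other party applies a CPTP map; an instrument is LOCC-linked to $(\mathcal{I}_j)_j$ if it is a coarse-graining (merging of outcomes) of $(\mathcal{J}_{j'|j}\circ\mathcal{I}_j)_{j,j'}$ where for each $j$, $(\mathcal{J}_{j'|j})_{j'}$ is a one-way local instrument w.r.t. some party (possibly depending on $j$); one-round LOCC instruments are coarse-grainings of one-way local instruments, $r$-round ones are those LOCC-linked to an $(r-1)$-round one; an instrument $\mathcal I$ is LOCC if there is a sequence $\mathcal{I}_1,\mathcal{I}_2,\dots$ with $\mathcal{I}_n$ an $n$-round LOCC instrument that is LOCC-linked to $\mathcal{I}_{n-1}$, such that suitable coarse-grainings of $\mathcal{I}_n$ converge to $\mathcal{I}$. (Intermediate systems may have arbitrary finite dimension.) Then $\mathrm{LOCC}(A;B)=\{\sum_i\mathcal E_i\}$ and $\mathrm{LOCC}^\star(A;B)=\{\sum_i\beta_i\mathcal{E}_i:\beta_i\in[-1,1]\}$, where $(\mathcal E_i)_i$ ranges over all LOCC instruments from $AB$ to $AB$. *)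

theory Defs
  imports
    "HOL-Analysis.Infinite_Sum"
    "HOL-Library.Extended_Real"
    "Jordan_Normal_Form.Schur_Decomposition"
begin

section \<open>Operators on tensor products\<close>

text \<open>
  The Hilbert space of a system of dimension \<open>d\<close> is \<open>\<complex>\<^sup>d\<close> with its standard basis.  The basis vector
  \<open>|i\<rangle> \<otimes> |j\<rangle>\<close> of \<open>\<complex>\<^sup>a \<otimes> \<complex>\<^sup>b\<close> is the basis vector number \<open>i * b + j\<close> of \<open>\<complex>\<^bsup>a * b\<^esup>\<close>; this makes the
  tensor product (strictly) associative.
\<close>

definition kron :: "complex mat \<Rightarrow> complex mat \<Rightarrow> complex mat" (infixr \<open>\<otimes>\<^sub>k\<close> 71) where
  "X \<otimes>\<^sub>k Y = mat (dim_row X * dim_row Y) (dim_col X * dim_col Y)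
     (\<lambda>(r, c). X $$ (r div dim_row Y, c div dim_col Y) * Y $$ (r mod dim_row Y, c mod dim_col Y))"

definition mtrace :: "complex mat \<Rightarrow> complex" where
  "mtrace X = (\<Sum>i<dim_row X. X $$ (i, i))"

definition ketbra :: "complex vec \<Rightarrow> complex vec \<Rightarrow> complex mat" where
  "ketbra v w = mat (dim_vec v) (dim_vec w) (\<lambda>(r, c). v $ r * cnj (w $ c))"

definition mat_unit :: "nat \<Rightarrow> nat \<Rightarrow> nat \<Rightarrow> complex mat" where
  "mat_unit d i j = ketbra (unit_vec d i) (unit_vec d j)"

text \<open>On \<^typ>\<open>complex\<close>, \<open>0 \<le> z\<close> means that \<open>z\<close> is real and nonnegative.\<close>

definition psd :: "nat \<Rightarrow> complex mat \<Rightarrow> bool" where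
  "psd d X \<longleftrightarrow> X \<in> carrier_mat d d \<and> (\<forall>v \<in> carrier_vec d. 0 \<le> (X *\<^sub>v v) \<bullet>c v)"

definition states :: "nat \<Rightarrow> complex mat set" where
  "states d = {\<rho>. psd d \<rho> \<and> mtrace \<rho> = 1}"

definition unitary_mat :: "nat \<Rightarrow> complex mat \<Rightarrow> bool" where
  "unitary_mat d U \<longleftrightarrow> U \<in> carrier_mat d d \<and> mat_adjoint U * U = 1\<^sub>m d \<and> U * mat_adjoint U = 1\<^sub>m d"


section \<open>Linear maps, channels and instruments\<close>

text \<open>
  Maps from operators on \<open>\<complex>\<^sup>d\<close> to operators on \<open>\<complex>\<^bsup>d'\<^esup>\<close> are functions on matrices of which only the
  restriction to \<^term>\<open>carrier_mat d d\<close> matters.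
\<close>

type_synonym superop = "complex mat \<Rightarrow> complex mat"

definition linear_superop :: "nat \<Rightarrow> nat \<Rightarrow> superop \<Rightarrow> bool" where
  "linear_superop d d' E \<longleftrightarrow>
     (\<forall>X \<in> carrier_mat d d. E X \<in> carrier_mat d' d') \<and>
     (\<forall>X \<in> carrier_mat d d. \<forall>Y \<in> carrier_mat d d. E (X + Y) = E X + E Y) \<and>
     (\<forall>z. \<forall>X \<in> carrier_mat d d. E (z \<cdot>\<^sub>m X) = z \<cdot>\<^sub>m E X)"

text \<open>
  The tensor product of \<open>E\<close> (from dimension \<open>a\<close> to \<open>a'\<close>) and \<open>F\<close> (from \<open>b\<close> to \<open>b'\<close>), i.e. the linear map
  with \<open>|i\<rangle>\<langle>j| \<otimes> |k\<rangle>\<langle>l| \<mapsto> E(|i\<rangle>\<langle>j|) \<otimes> F(|k\<rangle>\<langle>l|)\<close>.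
\<close>

definition tensor_superop :: "nat \<Rightarrow> nat \<Rightarrow> nat \<Rightarrow> nat \<Rightarrow> superop \<Rightarrow> superop \<Rightarrow> superop" where
  "tensor_superop a b a' b' E F X = mat (a' * b') (a' * b') (\<lambda>rc.
     \<Sum>i<a. \<Sum>j<a. \<Sum>k<b. \<Sum>l<b.
       X $$ (i * b + k, j * b + l) * (E (mat_unit a i j) \<otimes>\<^sub>k F (mat_unit b k l)) $$ rc)"

definition completely_positive :: "nat \<Rightarrow> nat \<Rightarrow> superop \<Rightarrow> bool" where
  "completely_positive d d' E \<longleftrightarrow> linear_superop d d' E \<and>
     (\<forall>k. \<forall>X. psd (k * d) X \<longrightarrow> psd (k * d') (tensor_superop k d k d' (\<lambda>Y. Y) E X))"

definition trace_preserving :: "nat \<Rightarrow> superop \<Rightarrow> bool" where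
  "trace_preserving d E \<longleftrightarrow> (\<forall>X \<in> carrier_mat d d. mtrace (E X) = mtrace X)"

definition cptp :: "nat \<Rightarrow> nat \<Rightarrow> superop \<Rightarrow> bool" where
  "cptp d d' E \<longleftrightarrow> completely_positive d d' E \<and> trace_preserving d E"

text \<open>
  \<open>superop_sum d d' I E F\<close>: the (possibly infinite) sum of the \<open>E i\<close>, \<open>i \<in> I\<close>, exists and equals \<open>F\<close>.
\<close>

definition superop_sum :: "nat \<Rightarrow> nat \<Rightarrow> 'i set \<Rightarrow> ('i \<Rightarrow> superop) \<Rightarrow> superop \<Rightarrow> bool" where
  "superop_sum d d' I E F \<longleftrightarrow> (\<forall>X \<in> carrier_mat d d. F X \<in> carrier_mat d' d' \<and>
     (\<forall>r<d'. \<forall>c<d'. ((\<lambda>i. E i X $$ (r, c)) has_sum F X $$ (r, c)) I))"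

text \<open>Countable families are indexed by arbitrary (finite or infinite) sets of natural numbers.\<close>

definition instrument :: "nat \<Rightarrow> nat \<Rightarrow> nat set \<Rightarrow> (nat \<Rightarrow> superop) \<Rightarrow> bool" where
  "instrument d d' I E \<longleftrightarrow>
     (\<forall>i \<in> I. completely_positive d d' (E i) \<and> (\<exists>X \<in> carrier_mat d d. E i X \<noteq> 0\<^sub>m d' d')) \<and>
     (\<exists>F. superop_sum d d' I E F \<and> trace_preserving d F)"

text \<open>
  \<open>(G k)\<^bsub>k\<in>K\<^esub>\<close> arises from \<open>(E i)\<^bsub>i\<in>I\<^esub>\<close> by merging outcomes: the outcome \<open>i\<close> is relabelled \<open>f i\<close>.
\<close>

definition coarse_graining ::
  "nat \<Rightarrow> nat \<Rightarrow> 'i set \<Rightarrow> ('i \<Rightarrow> superop) \<Rightarrow> nat set \<Rightarrow> (nat \<Rightarrow> superop) \<Rightarrow> bool" where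
  "coarse_graining d d' I E K G \<longleftrightarrow>
     (\<exists>f. f ` I = K \<and> (\<forall>k \<in> K. superop_sum d d' {i \<in> I. f i = k} E (G k)))"


section \<open>LOCC\<close>

text \<open>
  In the following the first party's system changes from dimension \<open>a\<close> to \<open>a'\<close> and the second
  party's system from \<open>b\<close> to \<open>b'\<close>.
\<close>

definition one_way_local_fst ::
  "nat \<Rightarrow> nat \<Rightarrow> nat \<Rightarrow> nat \<Rightarrow> nat set \<Rightarrow> (nat \<Rightarrow> superop) \<Rightarrow> bool" where
  "one_way_local_fst a b a' b' I F \<longleftrightarrow> (\<exists>E T. instrument a a' I E \<and> (\<forall>i \<in> I. cptp b b' (T i)) \<and>
     (\<forall>i \<in> I. \<forall>X \<in> carrier_mat (a * b) (a * b). F i X = tensor_superop a b a' b' (E i) (T i) X))"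

definition one_way_local_snd ::
  "nat \<Rightarrow> nat \<Rightarrow> nat \<Rightarrow> nat \<Rightarrow> nat set \<Rightarrow> (nat \<Rightarrow> superop) \<Rightarrow> bool" where
  "one_way_local_snd a b a' b' I F \<longleftrightarrow> (\<exists>E T. instrument b b' I E \<and> (\<forall>i \<in> I. cptp a a' (T i)) \<and>
     (\<forall>i \<in> I. \<forall>X \<in> carrier_mat (a * b) (a * b). F i X = tensor_superop a b a' b' (T i) (E i) X))"

definition one_way_local ::
  "nat \<Rightarrow> nat \<Rightarrow> nat \<Rightarrow> nat \<Rightarrow> nat set \<Rightarrow> (nat \<Rightarrow> superop) \<Rightarrow> bool" where
  "one_way_local a b a' b' I F \<longleftrightarrow> one_way_local_fst a b a' b' I F \<or> one_way_local_snd a b a' b' I F"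

text \<open>
  \<open>locc_linked a b c d a' b' K G I E\<close>: the instrument \<open>(G k)\<^bsub>k\<in>K\<^esub>\<close> from dimensions \<open>(a, b)\<close> to \<open>(a', b')\<close>
  is LOCC-linked to \<open>(E j)\<^bsub>j\<in>I\<^esub>\<close>, which goes from \<open>(a, b)\<close> to \<open>(c, d)\<close>.  Composites \<open>J j j' \<circ> E j\<close> may vanish,
  but \<open>(G k)\<^bsub>k\<in>K\<^esub>\<close> being an instrument, such outcomes have to be merged with others.
\<close>

definition locc_linked ::
  "nat \<Rightarrow> nat \<Rightarrow> nat \<Rightarrow> nat \<Rightarrow> nat \<Rightarrow> nat \<Rightarrow>
   nat set \<Rightarrow> (nat \<Rightarrow> superop) \<Rightarrow> nat set \<Rightarrow> (nat \<Rightarrow> superop) \<Rightarrow> bool" where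
  "locc_linked a b c d a' b' K G I E \<longleftrightarrow> instrument (a * b) (a' * b') K G \<and>
     (\<exists>L J. (\<forall>j \<in> I. one_way_local c d a' b' (L j) (J j)) \<and>
       coarse_graining (a * b) (a' * b') (SIGMA j:I. L j) (\<lambda>(j, j'). J j j' \<circ> E j) K G)"

inductive locc_rounds ::
  "nat \<Rightarrow> nat \<Rightarrow> nat \<Rightarrow> nat \<Rightarrow> nat \<Rightarrow> nat set \<Rightarrow> (nat \<Rightarrow> superop) \<Rightarrow> bool" for a b where
  one: "one_way_local a b a' b' I E \<Longrightarrow> instrument (a * b) (a' * b') K G \<Longrightarrow>
     coarse_graining (a * b) (a' * b') I E K G \<Longrightarrow> locc_rounds a b a' b' 1 K G"
| link: "locc_rounds a b c d r I E \<Longrightarrow> locc_linked a b c d a' b' K G I E \<Longrightarrow>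
     locc_rounds a b a' b' (Suc r) K G"

text \<open>
  Distance of outcome-indexed families of maps, where families are extended by zero maps outside
  their index sets.  The map \<open>\<Sum>\<^sub>k E\<^sub>k \<otimes> |k\<rangle>\<langle>k|\<close> belonging to an instrument is measured in the
  \<open>\<ell>\<^sub>1\<close>-norm of its matrix entries.  As the dimensions \<open>d\<close>, \<open>d'\<close> are finite, this is equivalent,
  with constants depending only on \<open>d\<close> and \<open>d'\<close>, to the diamond norm of that map, for any number
  of outcomes.
\<close>

definition superop_norm :: "nat \<Rightarrow> nat \<Rightarrow> superop \<Rightarrow> real" where
  "superop_norm d d' E = (\<Sum>i<d. \<Sum>j<d. \<Sum>r<d'. \<Sum>c<d'. cmod (E (mat_unit d i j) $$ (r, c)))"

definition zero_ext :: "nat \<Rightarrow> nat set \<Rightarrow> (nat \<Rightarrow> superop) \<Rightarrow> nat \<Rightarrow> superop" where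
  "zero_ext d' I E k = (if k \<in> I then E k else (\<lambda>X. 0\<^sub>m d' d'))"

definition family_dist_less ::
  "nat \<Rightarrow> nat \<Rightarrow> nat set \<Rightarrow> (nat \<Rightarrow> superop) \<Rightarrow> nat set \<Rightarrow> (nat \<Rightarrow> superop) \<Rightarrow> real \<Rightarrow> bool" where
  "family_dist_less d d' I E K G \<epsilon> \<longleftrightarrow> (\<exists>s<\<epsilon>.
     ((\<lambda>k. superop_norm d d' (\<lambda>X. zero_ext d' I E k X - zero_ext d' K G k X)) has_sum s) (I \<union> K))"

text \<open>
  In the definition of LOCC instruments, \<open>(K n, G n)\<close> is the instrument after \<open>n + 1\<close> rounds.  Its output
  dimensions \<open>c n\<close>, \<open>d n\<close> are arbitrary (so that parties can keep local ancillas), but have to be those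
  of the limit for all sufficiently large \<open>n\<close>, as otherwise its coarse-grainings \<open>(K' n, G' n)\<close> cannot be
  compared to the limit.
\<close>

definition locc_instrument :: "nat \<Rightarrow> nat \<Rightarrow> nat set \<Rightarrow> (nat \<Rightarrow> superop) \<Rightarrow> bool" where
  "locc_instrument a b I E \<longleftrightarrow> instrument (a * b) (a * b) I E \<and>
     (\<exists>c d K G K' G'.
        (\<forall>n. locc_rounds a b (c n) (d n) (Suc n) (K n) (G n)) \<and>
        (\<forall>n. locc_linked a b (c n) (d n) (c (Suc n)) (d (Suc n))
               (K (Suc n)) (G (Suc n)) (K n) (G n)) \<and>
        (\<forall>n. instrument (a * b) (c n * d n) (K' n) (G' n) \<and>
             coarse_graining (a * b) (c n * d n) (K n) (G n) (K' n) (G' n)) \<and>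
        (\<forall>\<epsilon>>0. \<forall>\<^sub>F n in sequentially. c n = a \<and> d n = b \<and>
           family_dist_less (a * b) (a * b) (K' n) (G' n) I E \<epsilon>))"

definition LOCC :: "nat \<Rightarrow> nat \<Rightarrow> superop set" where
  "LOCC a b = {F. \<exists>I E. locc_instrument a b I E \<and> superop_sum (a * b) (a * b) I E F}"

definition LOCC_star :: "nat \<Rightarrow> nat \<Rightarrow> superop set" where
  "LOCC_star a b = {F. \<exists>I E \<beta>. locc_instrument a b I E \<and> (\<forall>i \<in> I. \<beta> i \<in> {-1..1::real}) \<and>
     superop_sum (a * b) (a * b) I (\<lambda>i X. complex_of_real (\<beta> i) \<cdot>\<^sub>m E i X) F}"


section \<open>Quasiprobability extent and separable states\<close>

definition qp_extent :: "nat \<Rightarrow> nat \<Rightarrow> superop set \<Rightarrow> superop \<Rightarrow> ereal" where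
  "qp_extent d d' S E = Inf {ereal (\<Sum>i<k. \<bar>a i\<bar>) | (k::nat) (a :: nat \<Rightarrow> real) F.
     k \<ge> 1 \<and> (\<forall>i<k. F i \<in> S) \<and>
     superop_sum d d' {..<k} (\<lambda>i X. complex_of_real (a i) \<cdot>\<^sub>m F i X) E}"

text \<open>The identification of operators with maps whose input system is one-dimensional.\<close>

definition op_superop :: "complex mat \<Rightarrow> superop" where
  "op_superop \<rho> = (\<lambda>X. X $$ (0, 0) \<cdot>\<^sub>m \<rho>)"

definition qp_extent_op :: "nat \<Rightarrow> complex mat set \<Rightarrow> complex mat \<Rightarrow> ereal" where
  "qp_extent_op d S \<rho> = qp_extent 1 d (op_superop ` S) (op_superop \<rho>)"

text \<open>Separable states with respect to the tensor decomposition \<open>\<complex>\<^sup>x \<otimes> \<complex>\<^sup>y\<close>.\<close>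

definition SEP :: "nat \<Rightarrow> nat \<Rightarrow> complex mat set" where
  "SEP x y = {mat (x * y) (x * y) (\<lambda>rc. \<Sum>i<k. complex_of_real (p i) * (\<rho> i \<otimes>\<^sub>k \<sigma> i) $$ rc) |
     (k::nat) (p :: nat \<Rightarrow> real) \<rho> \<sigma>.
     (\<forall>i<k. 0 \<le> p i \<and> \<rho> i \<in> states x \<and> \<sigma> i \<in> states y) \<and> (\<Sum>i<k. p i) = 1}"

text \<open>The unitary from \<open>\<complex>\<^sup>p \<otimes> \<complex>\<^sup>q\<close> to \<open>\<complex>\<^sup>q \<otimes> \<complex>\<^sup>p\<close> with \<open>|i\<rangle> \<otimes> |j\<rangle> \<mapsto> |j\<rangle> \<otimes> |i\<rangle>\<close>.\<close>

definition swap_mat :: "nat \<Rightarrow> nat \<Rightarrow> complex mat" where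
  "swap_mat p q = mat (q * p) (p * q)
     (\<lambda>(r, c). if r div p = c mod q \<and> r mod p = c div q then 1 else 0)"

text \<open>
  For systems \<open>A\<close>, \<open>B\<close> of dimensions \<open>a\<close>, \<open>b\<close> with copies \<open>A'\<close>, \<open>B'\<close>: the states on \<open>A' \<otimes> B' \<otimes> A \<otimes> B\<close>
  (in this order of the factors) which are separable with respect to \<open>AA'\<close> and \<open>BB'\<close>.  They are
  obtained from those on \<open>(A' \<otimes> A) \<otimes> (B' \<otimes> B)\<close> by exchanging the two middle factors.
\<close>

definition SEP_ref :: "nat \<Rightarrow> nat \<Rightarrow> complex mat set" where
  "SEP_ref a b = (let W = 1\<^sub>m a \<otimes>\<^sub>k swap_mat a b \<otimes>\<^sub>k 1\<^sub>m b in
     (\<lambda>\<rho>. W * \<rho> * mat_adjoint W) ` SEP (a * a) (b * b))"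

definition unitary_channel :: "complex mat \<Rightarrow> superop" where
  "unitary_channel U = (\<lambda>X. U * X * mat_adjoint U)"

definition max_entangled :: "nat \<Rightarrow> complex vec" where
  "max_entangled d =
     vec (d * d) (\<lambda>k. if k div d = k mod d then complex_of_real (1 / sqrt (real d)) else 0)"

text \<open>The reference copy is the first tensor factor, the system acted upon by \<open>E\<close> the second one.\<close>

definition choi_state :: "nat \<Rightarrow> nat \<Rightarrow> superop \<Rightarrow> complex mat" where
  "choi_state d d' E =
     tensor_superop d d d d' (\<lambda>X. X) E (ketbra (max_entangled d) (max_entangled d))"


section \<open>Clifford unitaries\<close>

datatype pauli = PI | PX | PY | PZ

fun pauli_mat :: "pauli \<Rightarrow> complex mat" where
  "pauli_mat PI = mat_of_rows_list 2 [[1, 0], [0, 1]]"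
| "pauli_mat PX = mat_of_rows_list 2 [[0, 1], [1, 0]]"
| "pauli_mat PY = mat_of_rows_list 2 [[0, - \<i>], [\<i>, 0]]"
| "pauli_mat PZ = mat_of_rows_list 2 [[1, 0], [0, - 1]]"

definition pauli_string :: "pauli list \<Rightarrow> complex mat" where
  "pauli_string ps = foldr (\<lambda>p X. pauli_mat p \<otimes>\<^sub>k X) ps (1\<^sub>m 1)"

definition pauli_group :: "nat \<Rightarrow> complex mat set" where
  "pauli_group N = {\<i> ^ c \<cdot>\<^sub>m pauli_string ps | (c::nat) ps. length ps = N}"

definition clifford :: "nat \<Rightarrow> complex mat \<Rightarrow> bool" where
  "clifford N U \<longleftrightarrow> unitary_mat (2 ^ N) U \<and>
     (\<forall>P \<in> pauli_group N. U * P * mat_adjoint U \<in> pauli_group N)"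

end

theory Submission
  imports Defs
begin

text \<open>
  The Choi operator of an LOCC map is a limit of finite sums of product operators, since every round
  is a tensor product of completely positive maps and composition preserves this form.  So a
  decomposition of the channel into maps from \<open>LOCC\<^sup>\<star>\<close> yields an approximate signed decomposition of
  the Choi state into product states at the same cost.  The error is Hermitian and small, hence by
  polarization it is a signed combination of product states at small cost.

  Conversely, a separable decomposition of the Choi state gives LOCC maps by gate teleportation: both
  parties perform Bell measurements on the input and their shares of the resource state.  As \<open>U\<close> is
  Clifford, the correction \<open>U (P \<otimes> Q) U\<^sup>\<dagger>\<close> is a product of Pauli operators and thus local.  The
  teleported map depends linearly on the resource, and the resource \<open>J\<close> teleports \<open>U\<close> itself.
\<close>

section \<open>Positive semidefinite matrices as Gram matrices\<close>

text \<open>The obstacle is that the extent admits only finite combinations of genuine separable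
  states, whereas LOCC instruments are limits and may merge infinitely many outcomes. Approximants
  have to be repaired at small cost, so costs must be controlled through limits. They are measured
  by the trace of the unnormalised Choi operator: for combinations with nonnegative weights it
  equals the total cost, and over the outcomes of an instrument it sums to the input dimension
  \<open>D\<close>. Coefficients in [-1,1] cannot raise that total, which is why passing from LOCC
  to LOCC-star gains nothing, and the factor \<open>D\<close> cancels against the normalisation of
  the Choi state. In the other direction, a resource that is a product across the cut can be
  prepared by the two parties separately, so that preparation and Bell measurement form one local
  instrument and no ancilla appears. The map teleported by such a resource is in general unrelated
  to \<open>U\<close>; only the signed sum of all of them is \<open>U\<close>, because for the Choi
  state of \<open>U\<close> every outcome gives the same corrected map.\<close>

lemma prod_index_less:
  assumes "i < a" "k < b" shows "i * b + k < a * (b::nat)"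
proof -
  have "i * b + k < Suc i * b" using assms(2) by simp
  also have "\<dots> \<le> a * b" using assms(1) by (intro mult_le_mono1) simp
  finally show ?thesis .
qed

lemma sum_lessThan_mult:
  "(\<Sum>I<a*b. g (I div b) (I mod b)) = (\<Sum>i<a. \<Sum>k<b. g i (k::nat))"
proof -
  have "(\<Sum>i<a. \<Sum>k<b. g i k) = (\<Sum>p\<in>{..<a}\<times>{..<b}. g (fst p) (snd p))"
    by (simp add: sum.cartesian_product case_prod_beta)
  also have "\<dots> = (\<Sum>I<a*b. g (I div b) (I mod b))"
    by (rule sum.reindex_bij_witness[of _ "\<lambda>I. (I div b, I mod b)" "\<lambda>(i, k). i * b + k"])
       (auto simp: less_mult_imp_div_less prod_index_less intro!: mod_less_divisor gr0I)
  finally show ?thesis by simp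
qed

lemma sum_prod_index:
  "(\<Sum>I<a*b. g I) = (\<Sum>i<a. \<Sum>k<b. g (i * b + k :: nat))"
  using sum_lessThan_mult[of "\<lambda>i k. g (i * b + k)" b a] by (simp add: div_mult_mod_eq)

lemma sum_swap3: "(\<Sum>p\<in>A. \<Sum>q\<in>B. \<Sum>x\<in>C. f p q x) = (\<Sum>x\<in>C. \<Sum>p\<in>A. \<Sum>q\<in>B. f p q x)"
proof -
  have "(\<Sum>p\<in>A. \<Sum>q\<in>B. \<Sum>x\<in>C. f p q x) = (\<Sum>p\<in>A. \<Sum>x\<in>C. \<Sum>q\<in>B. f p q x)"
    by (intro sum.cong refl sum.swap)
  also have "\<dots> = (\<Sum>x\<in>C. \<Sum>p\<in>A. \<Sum>q\<in>B. f p q x)" by (rule sum.swap)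
  finally show ?thesis .
qed

lemma sum_swap4:
  "(\<Sum>p\<in>A. \<Sum>q\<in>B. \<Sum>x\<in>C. \<Sum>y\<in>E. f p q x y) = (\<Sum>x\<in>C. \<Sum>y\<in>E. \<Sum>p\<in>A. \<Sum>q\<in>B. f p q x y)"
  unfolding sum_swap3[where C = C] by (intro sum.cong refl sum_swap3)

lemma div_mod_prod_index [simp]:
  "k < b \<Longrightarrow> (i * b + k) div b = i" "k < b \<Longrightarrow> (i * b + k) mod b = (k::nat)"
  by auto

lemma div_mod_less:
  "I < a * b \<Longrightarrow> I div b < (a::nat)" "I < a * b \<Longrightarrow> I mod b < (b::nat)"
  by (auto simp: less_mult_imp_div_less intro!: mod_less_divisor gr0I)

text \<open>Positivity is phrased for index functions, so that the induction on the dimension in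
  \<open>psd_fun_Gram\<close> can pass to a leading block without resizing a matrix.\<close>

definition psd_fun :: "nat \<Rightarrow> (nat \<Rightarrow> nat \<Rightarrow> complex) \<Rightarrow> bool" where
  "psd_fun d X \<longleftrightarrow> (\<forall>v. 0 \<le> (\<Sum>r<d. \<Sum>c<d. cnj (v r) * X r c * v c))"

lemma sum_delta2:
  fixes X :: "nat \<Rightarrow> nat \<Rightarrow> 'a::comm_ring_1"
  assumes "i < d" "j < d'"
  shows "(\<Sum>r<d. \<Sum>c<d'. X r c * (if r = i \<and> c = j then 1 else 0)) = X i j"
proof -
  have "X r c * (if r = i \<and> c = j then 1 else 0) = (if r = i then if c = j then X r c else 0 else 0)" for r c
    by simp
  moreover have "(\<Sum>c<d'. if r = i then if c = j then X r c else 0 else 0) = (if r = i then X r j else 0)" for r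
    using assms(2) by simp
  ultimately show ?thesis using assms(1) by simp
qed

text \<open>The quadratic form is evaluated at the vector with entry 1 at \<open>r\<close> and
  \<open>z\<close> at \<open>c\<close>. Suitable values of \<open>z\<close> give Hermiticity and the
  vanishing of a row below a zero diagonal entry.\<close>

lemma psd_fun_two_coords:
  assumes "psd_fun d X" "r < d" "c < d" "r \<noteq> c"
  shows "0 \<le> X r r + z * X r c + cnj z * X c r + cnj z * z * X c c"
proof -
  define v where "v k = (if k = r then 1 else if k = c then z else 0)" for k
  have sumv: "(\<Sum>k<d. f k * v k) = f r + z * f c" for f :: "nat \<Rightarrow> complex"
  proof -
    have "(\<Sum>k<d. f k * v k) = (\<Sum>k<d. (if k = r then f k else 0) + (if k = c then f k * z else 0))"
      using assms(4) by (intro sum.cong) (auto simp: v_def)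
    then show ?thesis using assms by (simp add: sum.distrib)
  qed
  have sumv': "(\<Sum>k<d. cnj (v k) * f k) = f r + cnj z * f c" for f :: "nat \<Rightarrow> complex"
    using arg_cong[OF sumv[of "\<lambda>k. cnj (f k)"], of cnj] by (simp add: mult.commute)
  have "(\<Sum>r<d. \<Sum>c<d. cnj (v r) * X r c * v c) = (\<Sum>k<d. cnj (v k) * (X k r + z * X k c))"
    by (simp add: sumv mult.assoc flip: sum_distrib_left)
  also have "\<dots> = X r r + z * X r c + cnj z * X c r + cnj z * z * X c c"
    unfolding sumv' by (simp add: algebra_simps)
  finally have eq: "(\<Sum>r<d. \<Sum>c<d. cnj (v r) * X r c * v c) =
      X r r + z * X r c + cnj z * X c r + cnj z * z * X c c" .
  show ?thesis
    using assms(1)[unfolded psd_fun_def, THEN spec, of v] unfolding eq .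
qed

lemma psd_fun_diag:
  assumes "psd_fun d X" "r < d"
  shows "0 \<le> X r r"
proof -
  have "(\<Sum>k<d. \<Sum>c<d. cnj (if k = r then 1 else 0) * X k c * (if c = r then 1 else 0)) = X r r"
  proof -
    have "(\<Sum>k<d. \<Sum>c<d. cnj (if k = r then 1 else 0) * X k c * (if c = r then 1 else 0)) =
       (\<Sum>k<d. \<Sum>c<d. X k c * (if k = r \<and> c = r then 1 else 0))"
      by (intro sum.cong) auto
    then show ?thesis using sum_delta2[OF assms(2,2), of X] by simp
  qed
  moreover have "0 \<le> (\<Sum>k<d. \<Sum>c<d. cnj (if k = r then 1 else 0) * X k c * (if c = r then 1 else 0))"
    using assms(1) unfolding psd_fun_def by (rule spec)
  ultimately show ?thesis by simp
qed

text \<open>Positivity includes being real: \<open>z = 1\<close> shows that the imaginary parts of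
  \<open>X r c\<close> and \<open>X c r\<close> cancel, and \<open>z = \<i>\<close> that their real
  parts agree.\<close>

lemma psd_fun_hermitian:
  assumes "psd_fun d X" "r < d" "c < d"
  shows "X c r = cnj (X r c)"
proof (cases "r = c")
  case True
  then show ?thesis using psd_fun_diag[OF assms(1,2)]
    by (simp add: complex_eq_iff less_eq_complex_def)
next
  case False
  have "Im (X r r) = 0" "Im (X c c) = 0"
    using psd_fun_diag[OF assms(1)] assms(2,3) by (auto simp: less_eq_complex_def)
  then show ?thesis
    using psd_fun_two_coords[OF assms False, of 1] psd_fun_two_coords[OF assms False, of \<i>]
    by (simp add: complex_eq_iff less_eq_complex_def)
qed

text \<open>Cholesky decomposition: the last row and column are split off.  If the last diagonal entry
  vanishes, then so do they, which is consistent with \<open>x / 0 = 0\<close>.\<close>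

lemma psd_fun_Gram:
  "psd_fun d X \<Longrightarrow> \<exists>(n::nat) v. \<forall>r<d. \<forall>c<d. X r c = (\<Sum>k<n. v k r * cnj (v k c))"
proof (induction d arbitrary: X)
  case 0
  then show ?case by simp
next
  case (Suc d)
  define \<alpha> where "\<alpha> = X d d"
  have \<alpha>: "0 \<le> \<alpha>" unfolding \<alpha>_def by (rule psd_fun_diag[OF Suc.prems]) simp
  then have \<alpha>r: "\<alpha> = of_real (Re \<alpha>)" "Re \<alpha> \<ge> 0"
    by (auto simp: less_eq_complex_def complex_eq_iff)
  have herm: "X r d = cnj (X d r)" if "r < Suc d" for r
    using psd_fun_hermitian[OF Suc.prems, of d r] that by simp
  \<comment> \<open>The Schur complement of the last diagonal entry.\<close>
  define Y where "Y r c = X r c - X r d * X d c / \<alpha>" for r c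
  have quad: "0 \<le> (\<Sum>r<d. \<Sum>c<d. cnj (v r) * X r c * v c) + cnj z * (\<Sum>c<d. X d c * v c)
      + z * cnj (\<Sum>c<d. X d c * v c) + \<alpha> * (cnj z * z)" for v z
  proof -
    have "(\<Sum>r<Suc d. \<Sum>c<Suc d. cnj ((v(d:=z)) r) * X r c * (v(d:=z)) c) =
      (\<Sum>r<d. \<Sum>c<d. cnj (v r) * X r c * v c) + cnj z * (\<Sum>c<d. X d c * v c)
      + z * (\<Sum>r<d. cnj (v r) * X r d) + \<alpha> * (cnj z * z)"
      by (simp add: sum.distrib sum_distrib_left sum_distrib_right \<alpha>_def algebra_simps)
    moreover have "(\<Sum>r<d. cnj (v r) * X r d) = cnj (\<Sum>c<d. X d c * v c)"
      by (simp add: herm mult.commute)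
    moreover have "0 \<le> (\<Sum>r<Suc d. \<Sum>c<Suc d. cnj ((v(d:=z)) r) * X r c * (v(d:=z)) c)"
      using Suc.prems unfolding psd_fun_def by blast
    ultimately show ?thesis by argo
  qed
  have zero: "X d c = 0" if "\<alpha> = 0" "c < d" for c
  proof (rule ccontr)
    assume nz: "X d c \<noteq> 0"
    define x where "x = Re (X c c)"
    define y where "y = (cmod (X d c))\<^sup>2"
    have y: "y > 0" using nz by (simp add: y_def)
    \<comment> \<open>With \<open>\<alpha> = 0\<close> the form is linear in \<open>t\<close> along
      the \<open>z\<close> below: its value is \<open>x - 2 * t * y\<close>, and this
      \<open>t\<close> makes it \<open>- x - 2\<close>, which is negative.\<close>
    define t where "t = (x + 1) / y"
    define z where "z = - of_real t * X d c"
    have y': "of_real y = X d c * cnj (X d c)"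
      by (simp only: y_def complex_norm_square)
    have "0 \<le> X c c + z * cnj (X d c) + cnj z * X d c + cnj z * z * \<alpha>"
      using psd_fun_two_coords[OF Suc.prems, of c d z] that herm[of c] by (simp add: \<alpha>_def)
    moreover have "X c c + z * cnj (X d c) + cnj z * X d c + cnj z * z * \<alpha> = X c c - 2 * of_real t * of_real y"
      unfolding y' using that(1) by (simp add: z_def algebra_simps)
    ultimately have "0 \<le> X c c - 2 * of_real t * of_real y" by argo
    then have "0 \<le> x - 2 * t * y" by (simp add: x_def less_eq_complex_def)
    moreover have "t * y = x + 1" using y by (simp add: t_def)
    moreover have "x \<ge> 0" using psd_fun_diag[OF Suc.prems, of c] that by (simp add: x_def less_eq_complex_def)
    ultimately show False by linarith
  qed
  have "psd_fun d Y"
    unfolding psd_fun_def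
  proof
    fix v :: "nat \<Rightarrow> complex"
    define w where "w = (\<Sum>c<d. X d c * v c)"
    have w': "(\<Sum>r<d. cnj (v r) * X r d) = cnj w"
      by (simp add: w_def herm mult.commute)
    have "(\<Sum>r<d. \<Sum>c<d. cnj (v r) * Y r c * v c) =
       (\<Sum>r<d. \<Sum>c<d. cnj (v r) * X r c * v c) - (\<Sum>r<d. \<Sum>c<d. (cnj (v r) * X r d) * (X d c * v c)) / \<alpha>"
      unfolding sum_divide_distrib sum_subtractf[symmetric]
      by (intro sum.cong refl) (simp add: Y_def algebra_simps diff_divide_distrib)
    also have "\<dots> = (\<Sum>r<d. \<Sum>c<d. cnj (v r) * X r c * v c) - cnj w * w / \<alpha>"
      unfolding w'[symmetric] by (simp add: w_def sum_product)
    \<comment> \<open>Completing the square: \<open>z = - w / \<alpha>\<close> minimises the form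
      over the last coordinate, so that \<open>quad\<close> yields positivity of the Schur
      complement. For \<open>\<alpha> = 0\<close> the extra terms on both sides are 0.\<close>
    also have "\<dots> = (\<Sum>r<d. \<Sum>c<d. cnj (v r) * X r c * v c) + cnj (- w / \<alpha>) * w
      + (- w / \<alpha>) * cnj w + \<alpha> * (cnj (- w / \<alpha>) * (- w / \<alpha>))"
    proof (cases "\<alpha> = 0")
      case False
      have "cnj \<alpha> = \<alpha>" using \<alpha> by (simp add: complex_eq_iff less_eq_complex_def)
      with False have "cnj (- w / \<alpha>) * w + (- w / \<alpha>) * cnj w + \<alpha> * (cnj (- w / \<alpha>) * (- w / \<alpha>))
          = - (cnj w * w / \<alpha>)" by simp
      then show ?thesis by (simp only: add.assoc diff_conv_add_uminus)
    qed simp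
    finally show "0 \<le> (\<Sum>r<d. \<Sum>c<d. cnj (v r) * Y r c * v c)"
      using quad[of v "- w / \<alpha>"] unfolding w_def by simp
  qed
  from Suc.IH[OF this] obtain n :: nat and v
    where v: "\<And>r c. r < d \<Longrightarrow> c < d \<Longrightarrow> Y r c = (\<Sum>k<n. v k r * cnj (v k c))" by blast
  define u where "u r = X r d / of_real (sqrt (Re \<alpha>))" for r
  have uu: "u r * cnj (u c) = X r d * X d c / \<alpha>" if "r < Suc d" "c < Suc d" for r c
  proof -
    have "complex_of_real (sqrt (Re \<alpha>)) * of_real (sqrt (Re \<alpha>)) = of_real (Re \<alpha>)"
      using \<alpha>r(2) by (simp flip: of_real_mult)
    also have "\<dots> = \<alpha>" using \<alpha>r(1) by (rule sym)
    finally show ?thesis using herm[OF that(2)] by (simp add: u_def)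
  qed
  define v' where "v' k r = (if k < n then (if r < d then v k r else 0) else u r)" for k r
  have "X r c = (\<Sum>k<Suc n. v' k r * cnj (v' k c))" if "r < Suc d" "c < Suc d" for r c
  proof -
    have eq: "(\<Sum>k<Suc n. v' k r * cnj (v' k c)) =
        (if r < d \<and> c < d then (\<Sum>k<n. v k r * cnj (v k c)) else 0) + X r d * X d c / \<alpha>"
      using uu[OF that] by (simp add: v'_def)
    show ?thesis
    proof (cases "r < d \<and> c < d")
      case True
      then show ?thesis unfolding eq using v[of r c] by (simp add: Y_def diff_eq_eq)
    next
      case False
      have zero': "X d c = 0" "X c d = 0" if "\<alpha> = 0" "c < Suc d" for c
      proof -
        show "X d c = 0" using that zero[of c] by (cases "c = d") (simp_all add: \<alpha>_def)
        then show "X c d = 0" using that(2) by (subst herm) simp_all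
      qed
      have "X r d * X d c / \<alpha> = X r c"
      proof (cases "\<alpha> = 0")
        case True
        then show ?thesis using zero'[of r] zero'[of c] False that by (cases "r = d"; cases "c = d") auto
      next
        case nz: False
        then show ?thesis using False that by (cases "r = d"; cases "c = d") (auto simp: \<alpha>_def)
      qed
      then show ?thesis unfolding eq using False by auto
    qed
  qed
  then show ?case by blast
qed

lemma psd_iff_psd_fun:
  "psd d X \<longleftrightarrow> X \<in> carrier_mat d d \<and> psd_fun d (\<lambda>r c. X $$ (r, c))"
proof -
  have eq: "(X *\<^sub>v v) \<bullet>c v = (\<Sum>r<d. \<Sum>c<d. cnj (v $ r) * X $$ (r, c) * v $ c)"
    if "X \<in> carrier_mat d d" "v \<in> carrier_vec d" for v
    using that by (auto simp: scalar_prod_def sum_distrib_left sum_distrib_right row_def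
        lessThan_atLeast0 mult_ac intro!: sum.cong)
  show ?thesis
  proof safe
    assume psd: "psd d X"
    then show X: "X \<in> carrier_mat d d" by (simp add: psd_def)
    show "psd_fun d (\<lambda>r c. X $$ (r, c))"
      unfolding psd_fun_def
    proof
      fix v
      have "0 \<le> (X *\<^sub>v vec d v) \<bullet>c vec d v" using psd by (simp add: psd_def)
      then show "0 \<le> (\<Sum>r<d. \<Sum>c<d. cnj (v r) * X $$ (r, c) * v c)"
        by (simp add: eq[OF X])
    qed
  next
    assume "X \<in> carrier_mat d d" "psd_fun d (\<lambda>r c. X $$ (r, c))"
    then show "psd d X"
      by (auto simp: psd_def eq psd_fun_def)
  qed
qed

lemma psd_fun_Gram_iff:
  "psd_fun d X \<longleftrightarrow> (\<exists>(n::nat) v. \<forall>r<d. \<forall>c<d. X r c = (\<Sum>k<n. v k r * cnj (v k c)))"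
proof
  assume "\<exists>(n::nat) v. \<forall>r<d. \<forall>c<d. X r c = (\<Sum>k<n. v k r * cnj (v k c))"
  then obtain n :: nat and v where X: "\<And>r c. r < d \<Longrightarrow> c < d \<Longrightarrow> X r c = (\<Sum>k<n. v k r * cnj (v k c))"
    by blast
  show "psd_fun d X" unfolding psd_fun_def
  proof
    fix w :: "nat \<Rightarrow> complex"
    have "(\<Sum>r<d. \<Sum>c<d. cnj (w r) * X r c * w c) =
       (\<Sum>r<d. \<Sum>c<d. \<Sum>k<n. (cnj (w r) * v k r) * cnj (cnj (w c) * v k c))"
      by (intro sum.cong refl) (simp add: X sum_distrib_left sum_distrib_right mult_ac)
    also have "\<dots> = (\<Sum>k<n. \<Sum>r<d. \<Sum>c<d. (cnj (w r) * v k r) * cnj (cnj (w c) * v k c))"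
      by (rule sum_swap3)
    also have "\<dots> = (\<Sum>k<n. (\<Sum>r<d. cnj (w r) * v k r) * cnj (\<Sum>r<d. cnj (w r) * v k r))"
      by (simp add: sum_product)
    also have "\<dots> = (\<Sum>k<n. of_real ((cmod (\<Sum>r<d. cnj (w r) * v k r))\<^sup>2))"
      by (simp only: complex_norm_square)
    also have "\<dots> \<ge> 0" by (intro sum_nonneg) (simp add: less_eq_complex_def)
    finally show "0 \<le> (\<Sum>r<d. \<Sum>c<d. cnj (w r) * X r c * w c)" .
  qed
qed (rule psd_fun_Gram)

lemma psd_Gram_iff:
  "psd d X \<longleftrightarrow> X \<in> carrier_mat d d \<and>
     (\<exists>(n::nat) v. \<forall>r<d. \<forall>c<d. X $$ (r, c) = (\<Sum>k<n. v k r * cnj (v k c)))"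
  unfolding psd_iff_psd_fun psd_fun_Gram_iff ..


section \<open>Kernels of linear maps\<close>

type_synonym kernel = "nat \<Rightarrow> nat \<Rightarrow> nat \<Rightarrow> nat \<Rightarrow> complex"

text \<open>A map is handled through the entries of its values on matrix units, which form its
  unnormalised Choi operator with rows \<open>(i, r)\<close> and columns \<open>(j, c)\<close>.
  Sums, limits and compositions become statements about complex numbers. Only indices below the
  dimensions carry meaning, hence \<open>kernel_eq\<close>.\<close>

definition ent :: "nat \<Rightarrow> superop \<Rightarrow> kernel" where
  "ent d E i j r c = E (mat_unit d i j) $$ (r, c)"

definition kernel_map :: "nat \<Rightarrow> nat \<Rightarrow> kernel \<Rightarrow> superop" where
  "kernel_map d d' e X = mat d' d' (\<lambda>(r, c). \<Sum>i<d. \<Sum>j<d. X $$ (i, j) * e i j r c)"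

definition kernel_eq :: "nat \<Rightarrow> nat \<Rightarrow> kernel \<Rightarrow> kernel \<Rightarrow> bool" where
  "kernel_eq d d' e f \<longleftrightarrow> (\<forall>i<d. \<forall>j<d. \<forall>r<d'. \<forall>c<d'. e i j r c = f i j r c)"

definition tensor_kernel :: "nat \<Rightarrow> nat \<Rightarrow> kernel \<Rightarrow> kernel \<Rightarrow> kernel" where
  "tensor_kernel b b' e f i j r c =
     e (i div b) (j div b) (r div b') (c div b') * f (i mod b) (j mod b) (r mod b') (c mod b')"

definition id_kernel :: kernel where
  "id_kernel i j r c = (if r = i \<and> c = j then 1 else 0)"

text \<open>A Kraus form with operators \<open>K k\<close>. With the pairs \<open>(i, r)\<close> as
  indices it is a Gram decomposition of the Choi operator.\<close>

definition cp_kernel :: "nat \<Rightarrow> nat \<Rightarrow> kernel \<Rightarrow> bool" where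
  "cp_kernel d d' e \<longleftrightarrow>
     (\<exists>(n::nat) K. kernel_eq d d' e (\<lambda>i j r c. \<Sum>k<n. K k r i * cnj (K k c j)))"

definition tp_kernel :: "nat \<Rightarrow> nat \<Rightarrow> kernel \<Rightarrow> bool" where
  "tp_kernel d d' e \<longleftrightarrow> (\<forall>i<d. \<forall>j<d. (\<Sum>r<d'. e i j r r) = (if i = j then 1 else 0))"

abbreviation kernel_sum :: "'x set \<Rightarrow> ('x \<Rightarrow> kernel) \<Rightarrow> kernel" where
  "kernel_sum A e \<equiv> \<lambda>i j r c. \<Sum>x\<in>A. e x i j r c"

lemma mat_unit_carrier [simp]: "mat_unit d i j \<in> carrier_mat d d"
  by (simp add: mat_unit_def ketbra_def)

lemma mat_unit_dim [simp]: "dim_row (mat_unit d i j) = d" "dim_col (mat_unit d i j) = d"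
  by (simp_all add: mat_unit_def ketbra_def)

lemma mat_unit_index [simp]:
  "r < d \<Longrightarrow> c < d \<Longrightarrow> mat_unit d i j $$ (r, c) = (if r = i \<and> c = j then 1 else 0)"
  by (auto simp: mat_unit_def ketbra_def unit_vec_def)

lemma kernel_map_carrier [simp]: "kernel_map d d' e X \<in> carrier_mat d' d'"
  by (simp add: kernel_map_def)

lemma kernel_map_dim [simp]: "dim_row (kernel_map d d' e X) = d'" "dim_col (kernel_map d d' e X) = d'"
  by (simp_all add: kernel_map_def)

lemma kernel_map_index [simp]:
  "r < d' \<Longrightarrow> c < d' \<Longrightarrow> kernel_map d d' e X $$ (r, c) = (\<Sum>i<d. \<Sum>j<d. X $$ (i, j) * e i j r c)"
  by (simp add: kernel_map_def)

lemma kernel_map_cong: "kernel_eq d d' e f \<Longrightarrow> kernel_map d d' e X = kernel_map d d' f X"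
  by (auto simp: kernel_map_def kernel_eq_def intro!: eq_matI sum.cong)

lemma ent_kernel_map [simp]:
  assumes "i < d" "j < d" "r < d'" "c < d'"
  shows "ent d (kernel_map d d' e) i j r c = e i j r c"
proof -
  have "ent d (kernel_map d d' e) i j r c =
      (\<Sum>p<d. \<Sum>q<d. e p q r c * (if p = i \<and> q = j then 1 else 0))"
    using assms by (auto simp: ent_def mult.commute intro!: sum.cong)
  then show ?thesis using assms by (simp add: sum_delta2)
qed

lemma linear_superop_kernel_map: "linear_superop d d' (kernel_map d d' e)"
  unfolding linear_superop_def
  by (auto intro!: eq_matI sum.cong simp: sum.distrib sum_distrib_left algebra_simps kernel_map_def)

lemma linear_superop_apply:
  assumes E: "linear_superop d d' E" and X: "X \<in> carrier_mat d d" and rc: "r < d'" "c < d'"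
  shows "E X $$ (r, c) = (\<Sum>i<d. \<Sum>j<d. X $$ (i, j) * ent d E i j r c)"
proof -
  \<comment> \<open>\<open>X\<close> restricted to a set \<open>S\<close> of positions. The
    induction on \<open>S\<close> adds one multiple of a matrix unit at a time, so additivity of
    \<open>E\<close> is only used for two summands.\<close>
  define Y where "Y S = mat d d (\<lambda>p. if p \<in> S then X $$ p else 0)" for S
  have Y: "Y S \<in> carrier_mat d d" for S by (simp add: Y_def)
  have car: "E Z \<in> carrier_mat d' d'" if "Z \<in> carrier_mat d d" for Z
    using E that by (auto simp: linear_superop_def)
  have zero: "E (0\<^sub>m d d) $$ (r, c) = 0"
  proof -
    have "E (0 \<cdot>\<^sub>m 0\<^sub>m d d) = 0 \<cdot>\<^sub>m E (0\<^sub>m d d)"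
      using E unfolding linear_superop_def by (metis zero_carrier_mat)
    moreover have "0 \<cdot>\<^sub>m 0\<^sub>m d d = (0\<^sub>m d d :: complex mat)" by auto
    ultimately have "E (0\<^sub>m d d) = 0 \<cdot>\<^sub>m E (0\<^sub>m d d)" by simp
    then show ?thesis using car[of "0\<^sub>m d d"] rc
      by (metis carrier_matD(1) carrier_matD(2) index_smult_mat(1) mult_zero_left zero_carrier_mat)
  qed
  have "E (Y S) $$ (r, c) = (\<Sum>p\<in>S. X $$ p * E (mat_unit d (fst p) (snd p)) $$ (r, c))"
    if "finite S" "S \<subseteq> {..<d} \<times> {..<d}" for S
    using that
  proof (induction S rule: finite_induct)
    case empty
    have "Y {} = 0\<^sub>m d d" by (auto simp: Y_def intro!: eq_matI)
    then show ?case by (simp add: zero)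
  next
    case (insert p S)
    define U where "U = mat_unit d (fst p) (snd p)"
    have U: "U \<in> carrier_mat d d" by (simp add: U_def)
    have "Y (insert p S) = Y S + (X $$ p) \<cdot>\<^sub>m U"
      using insert.hyps by (cases p) (auto simp: Y_def U_def intro!: eq_matI)
    moreover have "E (Y S + (X $$ p) \<cdot>\<^sub>m U) = E (Y S) + E ((X $$ p) \<cdot>\<^sub>m U)"
      using E Y[of S] U by (simp add: linear_superop_def)
    moreover have "E ((X $$ p) \<cdot>\<^sub>m U) = (X $$ p) \<cdot>\<^sub>m E U"
      using E U by (simp add: linear_superop_def)
    ultimately show ?case
      using insert car[OF U] car[OF Y] rc by (simp add: U_def add.commute)
  qed
  from this[of "{..<d} \<times> {..<d}"] have "E (Y ({..<d} \<times> {..<d})) $$ (r, c) =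
      (\<Sum>i<d. \<Sum>j<d. X $$ (i, j) * ent d E i j r c)"
    by (simp add: sum.cartesian_product ent_def case_prod_beta)
  moreover have "Y ({..<d} \<times> {..<d}) = X" using X by (auto simp: Y_def intro!: eq_matI)
  ultimately show ?thesis by simp
qed

lemma linear_superop_carrier:
  "linear_superop d d' E \<Longrightarrow> X \<in> carrier_mat d d \<Longrightarrow> E X \<in> carrier_mat d' d'"
  by (simp add: linear_superop_def)

lemma tensor_superop_eq_kernel_map:
  assumes E: "\<And>i j. i < a \<Longrightarrow> j < a \<Longrightarrow> E (mat_unit a i j) \<in> carrier_mat a' a'"
    and F: "\<And>i j. i < b \<Longrightarrow> j < b \<Longrightarrow> F (mat_unit b i j) \<in> carrier_mat b' b'"
  shows "tensor_superop a b a' b' E F X =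
     kernel_map (a * b) (a' * b') (tensor_kernel b b' (ent a E) (ent b F)) X"
proof (rule eq_matI)
  fix r c assume "r < dim_row (kernel_map (a * b) (a' * b') (tensor_kernel b b' (ent a E) (ent b F)) X)"
    "c < dim_col (kernel_map (a * b) (a' * b') (tensor_kernel b b' (ent a E) (ent b F)) X)"
  then have rc: "r < a' * b'" "c < a' * b'" by (simp_all add: kernel_map_def)
  have kr: "(E (mat_unit a i j) \<otimes>\<^sub>k F (mat_unit b k l)) $$ (r, c) =
      ent a E i j (r div b') (c div b') * ent b F k l (r mod b') (c mod b')"
    if "i < a" "j < a" "k < b" "l < b" for i j k l
    using E[OF that(1,2)] F[OF that(3,4)] rc by (simp add: kron_def ent_def)
  have "tensor_superop a b a' b' E F X $$ (r, c) = (\<Sum>i<a. \<Sum>j<a. \<Sum>k<b. \<Sum>l<b.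
       X $$ (i * b + k, j * b + l) *
       (ent a E i j (r div b') (c div b') * ent b F k l (r mod b') (c mod b')))"
    using rc by (auto simp: tensor_superop_def kr intro!: sum.cong)
  also have "\<dots> = (\<Sum>i<a. \<Sum>k<b. \<Sum>j<a. \<Sum>l<b.
       X $$ (i * b + k, j * b + l) *
       (ent a E i j (r div b') (c div b') * ent b F k l (r mod b') (c mod b')))"
    by (intro sum.cong refl sum.swap)
  also have "\<dots> = (\<Sum>I<a*b. \<Sum>J<a*b. X $$ (I, J) * tensor_kernel b b' (ent a E) (ent b F) I J r c)"
    unfolding sum_prod_index by (intro sum.cong refl) (simp add: tensor_kernel_def)
  finally show "tensor_superop a b a' b' E F X $$ (r, c) =
     kernel_map (a * b) (a' * b') (tensor_kernel b b' (ent a E) (ent b F)) X $$ (r, c)"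
    using rc by simp
qed (simp_all add: tensor_superop_def kernel_map_def)

lemma ent_id: "i < d \<Longrightarrow> j < d \<Longrightarrow> r < d \<Longrightarrow> c < d \<Longrightarrow> ent d (\<lambda>Y. Y) i j r c = id_kernel i j r c"
  by (simp add: ent_def id_kernel_def)

text \<open>Kraus forms compose to Kraus forms: for each pair of labels the sum over the
  intermediate indices factorises, and the pair \<open>(k, l)\<close> is coded as the single label
  \<open>h = k * m + l\<close>.\<close>

lemma sum_Gram_product:
  fixes n m d :: nat
  assumes "\<And>p q. p < d \<Longrightarrow> q < d \<Longrightarrow> X p q = (\<Sum>k<n. v k p * cnj (w k q))"
  shows "(\<Sum>p<d. \<Sum>q<d. X p q * (\<Sum>l<m. M l p * cnj (N l q))) =
      (\<Sum>h<n*m. (\<Sum>p<d. v (h div m) p * M (h mod m) p) * cnj (\<Sum>q<d. w (h div m) q * N (h mod m) q))"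
proof -
  have "(\<Sum>p<d. \<Sum>q<d. X p q * (\<Sum>l<m. M l p * cnj (N l q))) =
      (\<Sum>p<d. \<Sum>q<d. \<Sum>k<n. \<Sum>l<m. (v k p * M l p) * cnj (w k q * N l q))"
    by (intro sum.cong refl, subst assms, simp, simp, unfold sum_product, intro sum.cong refl)
      (simp add: mult_ac)
  also have "\<dots> = (\<Sum>k<n. \<Sum>l<m. \<Sum>p<d. \<Sum>q<d. (v k p * M l p) * cnj (w k q * N l q))"
    by (rule sum_swap4)
  also have "\<dots> = (\<Sum>h<n*m. (\<Sum>p<d. v (h div m) p * M (h mod m) p) * cnj (\<Sum>q<d. w (h div m) q * N (h mod m) q))"
    unfolding sum_lessThan_mult[of "\<lambda>k l. \<Sum>p<d. \<Sum>q<d. (v k p * M l p) * cnj (w k q * N l q)", symmetric]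
    by (simp add: sum_product)
  finally show ?thesis .
qed

text \<open>Here \<open>X\<close> is \<open>z\<close> times the unnormalised maximally entangled
  operator. The value \<open>z = 1\<close> serves the Choi-Kraus theorem, \<open>z = 1 / d\<close>
  the Choi state.\<close>

lemma tensor_id_superop_index:
  assumes E: "linear_superop d d' E"
    and X: "\<And>p k q l. p < d \<Longrightarrow> k < d \<Longrightarrow> q < d \<Longrightarrow> l < d \<Longrightarrow>
      X $$ (p * d + k, q * d + l) = (if p = k \<and> q = l then z else 0)"
    and x: "x < d * d'" and y: "y < d * d'"
  shows "tensor_superop d d d d' (\<lambda>Y. Y) E X $$ (x, y) =
    z * ent d E (x div d') (y div d') (x mod d') (y mod d')"
proof -
  let ?i = "x div d'" and ?j = "y div d'" and ?r = "x mod d'" and ?c = "y mod d'"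
  have less: "?i < d" "?j < d" using x y by (auto simp: div_mod_less)
  have "tensor_superop d d d d' (\<lambda>Y. Y) E X $$ (x, y) =
      (\<Sum>I<d*d. \<Sum>J<d*d. X $$ (I, J) * tensor_kernel d d' (ent d (\<lambda>Y. Y)) (ent d E) I J x y)"
    using x y linear_superop_carrier[OF E] by (subst tensor_superop_eq_kernel_map) auto
  also have "\<dots> = (\<Sum>p<d. \<Sum>k<d. \<Sum>q<d. \<Sum>l<d. X $$ (p * d + k, q * d + l) *
      (ent d (\<lambda>Y. Y) p q ?i ?j * ent d E k l ?r ?c))"
    unfolding sum_prod_index by (simp add: tensor_kernel_def)
  also have "\<dots> = (\<Sum>p<d. \<Sum>k<d. \<Sum>q<d. \<Sum>l<d.
      (if p = ?i \<and> q = ?j then if k = ?i \<and> l = ?j then z * ent d E k l ?r ?c else 0 else 0))"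
    using less by (intro sum.cong refl) (auto simp: X ent_id id_kernel_def)
  also have "\<dots> = (\<Sum>p<d. \<Sum>q<d. \<Sum>k<d. \<Sum>l<d.
      (if p = ?i \<and> q = ?j then if k = ?i \<and> l = ?j then z * ent d E k l ?r ?c else 0 else 0))"
    by (intro sum.cong refl sum.swap)
  also have "\<dots> = (\<Sum>p<d. \<Sum>q<d. (\<Sum>k<d. \<Sum>l<d. z * ent d E k l ?r ?c * (if k = ?i \<and> l = ?j then 1 else 0))
      * (if p = ?i \<and> q = ?j then 1 else 0))"
    unfolding sum_distrib_right by (intro sum.cong refl) auto
  also have "\<dots> = z * ent d E ?i ?j ?r ?c"
    using less by (simp only: sum_delta2)
  finally show ?thesis .
qed

text \<open>The Choi-Kraus theorem. In one direction the ancilla has dimension \<open>d\<close> and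
  the Gram vectors of the Choi operator are read as Kraus operators; in the other the Kraus
  operators are extended by the identity on the ancilla.\<close>

lemma completely_positive_iff:
  "completely_positive d d' E \<longleftrightarrow> linear_superop d d' E \<and> cp_kernel d d' (ent d E)"
proof safe
  assume cp: "completely_positive d d' E"
  then show lin: "linear_superop d d' E" by (simp add: completely_positive_def)
  define X where "X = mat (d * d) (d * d)
    (\<lambda>(p, q). (if p div d = p mod d then 1 else 0) * cnj (if q div d = q mod d then 1 else (0::complex)))"
  have "psd (d * d) X"
    unfolding psd_Gram_iff X_def
    by (auto intro!: exI[of _ "1::nat"] exI[of _ "\<lambda>_ p. if p div d = p mod d then 1 else (0::complex)"])
  then have "psd (d * d') (tensor_superop d d d d' (\<lambda>Y. Y) E X)"
    using cp by (simp add: completely_positive_def)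
  then obtain n :: nat and v where v: "\<And>r c. r < d * d' \<Longrightarrow> c < d * d' \<Longrightarrow>
     tensor_superop d d d d' (\<lambda>Y. Y) E X $$ (r, c) = (\<Sum>k<n. v k r * cnj (v k c))"
    by (auto simp: psd_Gram_iff)
  have "ent d E i j r c = (\<Sum>k<n. v k (i * d' + r) * cnj (v k (j * d' + c)))"
    if "i < d" "j < d" "r < d'" "c < d'" for i j r c
  proof -
    have "X $$ (p * d + k, q * d + l) = (if p = k \<and> q = l then 1 else 0)"
      if "p < d" "k < d" "q < d" "l < d" for p k q l
      using that by (simp add: X_def prod_index_less)
    from tensor_id_superop_index[OF lin this, of "i * d' + r" "j * d' + c"] show ?thesis
      using v that by (simp add: prod_index_less)
  qed
  then show "cp_kernel d d' (ent d E)"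
    unfolding cp_kernel_def kernel_eq_def
    by (intro exI[of _ n] exI[of _ "\<lambda>k r i. v k (i * d' + r)"]) blast
next
  assume lin: "linear_superop d d' E" and "cp_kernel d d' (ent d E)"
  then obtain n :: nat and K where K: "\<And>i j r c. i < d \<Longrightarrow> j < d \<Longrightarrow> r < d' \<Longrightarrow> c < d' \<Longrightarrow>
      ent d E i j r c = (\<Sum>k<n. K k r i * cnj (K k c j))"
    by (auto simp: cp_kernel_def kernel_eq_def)
  have "psd (k * d') (tensor_superop k d k d' (\<lambda>Y. Y) E X)" if X: "psd (k * d) X" for k X
  proof -
    obtain m :: nat and v where v: "\<And>r c. r < k * d \<Longrightarrow> c < k * d \<Longrightarrow> X $$ (r, c) = (\<Sum>h<m. v h r * cnj (v h c))"
      using X by (auto simp: psd_Gram_iff)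
    \<comment> \<open>The Kraus operators of the extended map: the ancilla indices have to agree,
      and \<open>K h\<close> acts on the remaining ones.\<close>
    define M where "M r h I = (if I div d = r div d' then K h (r mod d') (I mod d) else 0)" for r h I
    have "tensor_superop k d k d' (\<lambda>Y. Y) E X $$ (r, c) =
       (\<Sum>h<m*n. (\<Sum>p<k*d. v (h div n) p * M r (h mod n) p) * cnj (\<Sum>q<k*d. v (h div n) q * M c (h mod n) q))"
      if rc: "r < k * d'" "c < k * d'" for r c
    proof -
      have "tensor_superop k d k d' (\<lambda>Y. Y) E X $$ (r, c) =
        (\<Sum>I<k*d. \<Sum>J<k*d. X $$ (I, J) * tensor_kernel d d' (ent k (\<lambda>Y. Y)) (ent d E) I J r c)"
        using rc linear_superop_carrier[OF lin]
        by (subst tensor_superop_eq_kernel_map) auto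
      also have "\<dots> = (\<Sum>I<k*d. \<Sum>J<k*d. X $$ (I, J) * (\<Sum>h<n. M r h I * cnj (M c h J)))"
        using rc
        by (intro sum.cong refl)
          (auto simp: tensor_kernel_def ent_id id_kernel_def K div_mod_less M_def)
      finally show ?thesis using sum_Gram_product[of "k * d" "\<lambda>p q. X $$ (p, q)", OF v] by simp
    qed
    then show ?thesis unfolding psd_Gram_iff
      by (intro conjI exI[of _ "m * n"] exI[of _ "\<lambda>h r. \<Sum>p<k*d. v (h div n) p * M r (h mod n) p"])
        (auto simp: tensor_superop_def)
  qed
  then show "completely_positive d d' E" using lin by (simp add: completely_positive_def)
qed

lemma trace_preserving_iff:
  assumes "linear_superop d d' E"
  shows "trace_preserving d E \<longleftrightarrow> tp_kernel d d' (ent d E)"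
proof
  assume tp: "trace_preserving d E"
  show "tp_kernel d d' (ent d E)" unfolding tp_kernel_def
  proof (intro allI impI)
    fix i j assume ij: "i < d" "j < d"
    have "mtrace (E (mat_unit d i j)) = mtrace (mat_unit d i j)"
      using tp by (simp add: trace_preserving_def)
    moreover have "mtrace (mat_unit d i j) = (\<Sum>r<d. if r = i then (if i = j then 1 else 0) else 0)"
      unfolding mtrace_def using carrier_matD(1)[OF mat_unit_carrier[of d i j]]
      by (intro sum.cong) auto
    moreover have "mtrace (E (mat_unit d i j)) = (\<Sum>r<d'. ent d E i j r r)"
      using linear_superop_carrier[OF assms, of "mat_unit d i j"] by (auto simp: mtrace_def ent_def)
    ultimately show "(\<Sum>r<d'. ent d E i j r r) = (if i = j then 1 else 0)" using ij by simp
  qed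
next
  assume tp: "tp_kernel d d' (ent d E)"
  show "trace_preserving d E" unfolding trace_preserving_def
  proof
    fix X :: "complex mat" assume X: "X \<in> carrier_mat d d"
    have "mtrace (E X) = (\<Sum>r<d'. \<Sum>i<d. \<Sum>j<d. X $$ (i, j) * ent d E i j r r)"
      using linear_superop_carrier[OF assms X] linear_superop_apply[OF assms X] by (auto simp: mtrace_def)
    also have "\<dots> = (\<Sum>i<d. \<Sum>j<d. \<Sum>r<d'. X $$ (i, j) * ent d E i j r r)"
      by (rule sum_swap3[symmetric])
    also have "\<dots> = (\<Sum>i<d. \<Sum>j<d. if i = j then X $$ (i, j) else 0)"
      using tp by (intro sum.cong refl) (simp add: tp_kernel_def flip: sum_distrib_left)
    also have "\<dots> = mtrace X" using X by (simp add: mtrace_def)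
    finally show "mtrace (E X) = mtrace X" .
  qed
qed


section \<open>Separable kernels\<close>

definition prod_op ::
  "nat \<Rightarrow> nat \<Rightarrow> (nat \<Rightarrow> nat \<Rightarrow> complex) \<Rightarrow> (nat \<Rightarrow> nat \<Rightarrow> complex) \<Rightarrow> nat \<Rightarrow> nat \<Rightarrow> complex" where
  "prod_op b b' K L r i = K (r div b') (i div b) * L (r mod b') (i mod b)"

type_synonym sep_term = "real \<times> (nat \<Rightarrow> nat \<Rightarrow> complex) \<times> (nat \<Rightarrow> nat \<Rightarrow> complex)"

fun term_kernel :: "nat \<Rightarrow> nat \<Rightarrow> sep_term \<Rightarrow> kernel" where
  "term_kernel b b' (w, K, L) i j r c =
     complex_of_real w * (prod_op b b' K L r i * cnj (prod_op b b' K L c j))"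

text \<open>The Choi operator of a term is \<open>w\<close> times the rank-one operator given by the
  vectorisation of the product of \<open>K\<close> and \<open>L\<close>. The sum is the squared norm
  of this vector, so for \<open>w \<ge> 0\<close> the cost is the trace of the Choi
  operator.\<close>

fun term_cost :: "nat \<Rightarrow> nat \<Rightarrow> nat \<Rightarrow> nat \<Rightarrow> sep_term \<Rightarrow> real" where
  "term_cost a b a' b' (w, K, L) =
     \<bar>w\<bar> * (\<Sum>i<a*b. \<Sum>r<a'*b'. (cmod (prod_op b b' K L r i))\<^sup>2)"

definition terms_kernel :: "nat \<Rightarrow> nat \<Rightarrow> sep_term list \<Rightarrow> kernel" where
  "terms_kernel b b' ts i j r c = (\<Sum>t\<leftarrow>ts. term_kernel b b' t i j r c)"

text \<open>A combination of conjugations by product operators, whose total weight, in terms of the traces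
  of the Choi operators, is at most \<open>s\<close>.\<close>

definition sep_sum :: "nat \<Rightarrow> nat \<Rightarrow> nat \<Rightarrow> nat \<Rightarrow> bool \<Rightarrow> kernel \<Rightarrow> real \<Rightarrow> bool" where
  "sep_sum a b a' b' pos e s \<longleftrightarrow> (\<exists>ts. (pos \<longrightarrow> (\<forall>t\<in>set ts. 0 \<le> fst t)) \<and>
     kernel_eq (a * b) (a' * b') e (terms_kernel b b' ts) \<and> (\<Sum>t\<leftarrow>ts. term_cost a b a' b' t) \<le> s)"

text \<open>The quantifiers range over finite sets so that \<open>eventually\<close> can be moved
  through them, as in \<open>near_of_tendsto\<close>.\<close>

definition near :: "nat \<Rightarrow> nat \<Rightarrow> real \<Rightarrow> kernel \<Rightarrow> kernel \<Rightarrow> bool" where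
  "near d d' \<epsilon> e f \<longleftrightarrow> (\<forall>i\<in>{..<d}. \<forall>j\<in>{..<d}. \<forall>r\<in>{..<d'}. \<forall>c\<in>{..<d'}. dist (f i j r c) (e i j r c) < \<epsilon>)"

text \<open>The closure of the cone of separable Choi operators. Closing is forced by infinitely
  many merged outcomes and by the limit over rounds. The cost \<open>s\<close> of the approximants
  is left unrestricted here.\<close>

definition sep_kernel :: "nat \<Rightarrow> nat \<Rightarrow> nat \<Rightarrow> nat \<Rightarrow> kernel \<Rightarrow> bool" where
  "sep_kernel a b a' b' e \<longleftrightarrow>
     (\<forall>\<epsilon>>0. \<exists>f s. sep_sum a b a' b' True f s \<and> near (a * b) (a' * b') \<epsilon> e f)"

text \<open>The signed counterpart, with the cost controlled up to the same
  \<open>\<epsilon>\<close> as the distance. It bounds the cost of approximants only; for Hermitian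
  kernels \<open>sep_cost_exact\<close> transfers the bound to \<open>e\<close> itself.\<close>

definition sep_cost :: "nat \<Rightarrow> nat \<Rightarrow> nat \<Rightarrow> nat \<Rightarrow> kernel \<Rightarrow> real \<Rightarrow> bool" where
  "sep_cost a b a' b' e s \<longleftrightarrow>
     (\<forall>\<epsilon>>0. \<exists>f. sep_sum a b a' b' False f (s + \<epsilon>) \<and> near (a * b) (a' * b') \<epsilon> e f)"

section \<open>Approximation and combinations of separable kernels\<close>

lemma near_trans: "near d d' \<epsilon> e f \<Longrightarrow> near d d' \<delta> f g \<Longrightarrow> near d d' (\<epsilon> + \<delta>) e g"
  unfolding near_def by (smt (verit) dist_triangle2 dist_commute)

lemma near_half_trans: "near d d' (\<epsilon>/2) e f \<Longrightarrow> near d d' (\<epsilon>/2) f g \<Longrightarrow> near d d' \<epsilon> e g"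
  using near_trans[of d d' "\<epsilon>/2" e f "\<epsilon>/2" g] by simp

lemma near_cong: "kernel_eq d d' e e' \<Longrightarrow> near d d' \<epsilon> e f = near d d' \<epsilon> e' f"
  by (auto simp: near_def kernel_eq_def)

lemma near_of_tendsto:
  assumes "\<And>i j r c. i < d \<Longrightarrow> j < d \<Longrightarrow> r < d' \<Longrightarrow> c < d' \<Longrightarrow> ((\<lambda>x. f x i j r c) \<longlongrightarrow> e i j r c) F" "0 < \<epsilon>"
  shows "eventually (\<lambda>x. near d d' \<epsilon> e (f x)) F"
  unfolding near_def using assms by (auto simp: eventually_ball_finite_distrib tendsto_iff)

text \<open>The extra 1 in the denominator covers the empty sum and keeps the total error strictly
  below \<open>\<epsilon>\<close>.\<close>

lemma near_sum:
  assumes "finite A" "\<And>x. x \<in> A \<Longrightarrow> near d d' (\<epsilon> / (real (card A) + 1)) (e x) (f x)" "0 < \<epsilon>"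
  shows "near d d' \<epsilon> (kernel_sum A e) (kernel_sum A f)"
  unfolding near_def
proof (intro ballI)
  fix i j r c assume "i \<in> {..<d}" "j \<in> {..<d}" "r \<in> {..<d'}" "c \<in> {..<d'}"
  then have "dist (f x i j r c) (e x i j r c) \<le> \<epsilon> / (real (card A) + 1)" if "x \<in> A" for x
    using assms(2)[OF that] unfolding near_def by (meson less_imp_le)
  then have "(\<Sum>x\<in>A. cmod (f x i j r c - e x i j r c)) \<le> (\<Sum>x\<in>A. \<epsilon> / (real (card A) + 1))"
    by (intro sum_mono) (simp add: dist_norm)
  moreover have "dist (\<Sum>x\<in>A. f x i j r c) (\<Sum>x\<in>A. e x i j r c) \<le> (\<Sum>x\<in>A. cmod (f x i j r c - e x i j r c))"
    unfolding dist_norm sum_subtractf[symmetric] by (rule norm_sum)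
  ultimately have "dist (\<Sum>x\<in>A. f x i j r c) (\<Sum>x\<in>A. e x i j r c) \<le> (\<Sum>x\<in>A. \<epsilon> / (real (card A) + 1))"
    by linarith
  also have "\<dots> < \<epsilon>" using assms(3) by (simp add: field_simps)
  finally show "dist (\<Sum>x\<in>A. f x i j r c) (\<Sum>x\<in>A. e x i j r c) < \<epsilon>" .
qed

lemma terms_kernel_append:
  "terms_kernel b b' (ts @ us) i j r c = terms_kernel b b' ts i j r c + terms_kernel b b' us i j r c"
  by (simp add: terms_kernel_def)

lemma sep_sum_cong:
  "kernel_eq (a * b) (a' * b') e f \<Longrightarrow> sep_sum a b a' b' pos e s = sep_sum a b a' b' pos f s"
  by (auto simp: sep_sum_def kernel_eq_def)

lemma sep_sum_mono: "sep_sum a b a' b' pos e s \<Longrightarrow> s \<le> s' \<Longrightarrow> sep_sum a b a' b' pos e s'"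
  by (force simp: sep_sum_def)

lemma sep_sum_single:
  assumes "pos \<longrightarrow> 0 \<le> w"
  shows "sep_sum a b a' b' pos (term_kernel b b' (w, K, L)) (term_cost a b a' b' (w, K, L))"
  unfolding sep_sum_def using assms
  by (intro exI[of _ "[(w, K, L)]"]) (auto simp: kernel_eq_def terms_kernel_def)

lemma sep_sum_sum:
  assumes "finite A" "\<And>x. x \<in> A \<Longrightarrow> sep_sum a b a' b' pos (e x) (s x)"
  shows "sep_sum a b a' b' pos (kernel_sum A e) (\<Sum>x\<in>A. s x)"
  using assms
proof (induction A rule: finite_induct)
  case empty
  then show ?case by (auto simp: sep_sum_def kernel_eq_def terms_kernel_def intro!: exI[of _ "[]"])
next
  case (insert x A)
  obtain ts where ts: "pos \<longrightarrow> (\<forall>t\<in>set ts. 0 \<le> fst t)" "kernel_eq (a * b) (a' * b') (e x) (terms_kernel b b' ts)"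
     "(\<Sum>t\<leftarrow>ts. term_cost a b a' b' t) \<le> s x"
    using insert.prems[of x] by (auto simp: sep_sum_def)
  obtain us where us: "pos \<longrightarrow> (\<forall>t\<in>set us. 0 \<le> fst t)"
     "kernel_eq (a * b) (a' * b') (kernel_sum A e) (terms_kernel b b' us)"
     "(\<Sum>t\<leftarrow>us. term_cost a b a' b' t) \<le> (\<Sum>x\<in>A. s x)"
    using insert by (auto simp: sep_sum_def)
  show ?case unfolding sep_sum_def
    using ts us insert.hyps by (intro exI[of _ "ts @ us"]) (auto simp: kernel_eq_def terms_kernel_append)
qed

lemma terms_kernel_eq_sum:
  "terms_kernel b b' ts i j r c = (\<Sum>x<length ts. term_kernel b b' (ts ! x) i j r c)"
  by (simp add: terms_kernel_def sum_list_sum_nth lessThan_atLeast0)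

lemma sep_sum_scale:
  assumes "sep_sum a b a' b' False e s"
  shows "sep_sum a b a' b' False (\<lambda>i j r c. complex_of_real \<beta> * e i j r c) (\<bar>\<beta>\<bar> * s)"
proof -
  obtain ts where ts: "kernel_eq (a * b) (a' * b') e (terms_kernel b b' ts)"
     "(\<Sum>t\<leftarrow>ts. term_cost a b a' b' t) \<le> s"
    using assms by (auto simp: sep_sum_def)
  have "complex_of_real \<beta> * terms_kernel b b' ts i j r c = terms_kernel b b' (map (\<lambda>(w, K, L). (\<beta> * w, K, L)) ts) i j r c" for i j r c
    unfolding terms_kernel_def by (induction ts) (auto simp: algebra_simps)
  moreover have "(\<Sum>t\<leftarrow>map (\<lambda>(w, K, L). (\<beta> * w, K, L)) ts. term_cost a b a' b' t) = \<bar>\<beta>\<bar> * (\<Sum>t\<leftarrow>ts. term_cost a b a' b' t)"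
    by (induction ts) (auto simp: algebra_simps abs_mult)
  ultimately show ?thesis unfolding sep_sum_def using ts
    by (intro exI[of _ "map (\<lambda>(w, K, L). (\<beta> * w, K, L)) ts"]) (auto simp: kernel_eq_def mult_left_mono)
qed

text \<open>Nonnegative weights do not cancel, so the cost of a combination is the trace of its Choi
  operator. An uncontrolled bound \<open>s\<close> is thereby replaced by a quantity that depends on
  \<open>e\<close> alone and is continuous in it.\<close>

lemma sep_sum_trace:
  assumes "sep_sum a b a' b' True e s"
  shows "sep_sum a b a' b' True e (Re (\<Sum>i<a*b. \<Sum>r<a'*b'. e i i r r))"
proof -
  obtain ts where ts: "\<forall>t\<in>set ts. 0 \<le> fst t" "kernel_eq (a * b) (a' * b') e (terms_kernel b b' ts)"
    using assms by (auto simp: sep_sum_def)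
  have cost: "(\<Sum>i<a*b. \<Sum>r<a'*b'. term_kernel b b' t i i r r) = of_real (term_cost a b a' b' t)"
    if "0 \<le> fst t" for t
    using that by (cases t) (simp flip: complex_norm_square of_real_power add: sum_distrib_left)
  have "(\<Sum>i<a*b. \<Sum>r<a'*b'. e i i r r) = (\<Sum>i<a*b. \<Sum>r<a'*b'. \<Sum>x<length ts. term_kernel b b' (ts ! x) i i r r)"
    using ts(2) by (intro sum.cong refl) (simp add: kernel_eq_def terms_kernel_eq_sum)
  also have "\<dots> = (\<Sum>x<length ts. \<Sum>i<a*b. \<Sum>r<a'*b'. term_kernel b b' (ts ! x) i i r r)"
    by (rule sum_swap3)
  also have "\<dots> = (\<Sum>x<length ts. of_real (term_cost a b a' b' (ts ! x)))"
    using ts(1) by (intro sum.cong refl) (simp add: cost)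
  finally have "Re (\<Sum>i<a*b. \<Sum>r<a'*b'. e i i r r) = (\<Sum>t\<leftarrow>ts. term_cost a b a' b' t)"
    by (simp add: sum_list_sum_nth lessThan_atLeast0)
  then show ?thesis unfolding sep_sum_def using ts by auto
qed

lemma sep_kernelI_sum: "sep_sum a b a' b' True e s \<Longrightarrow> sep_kernel a b a' b' e"
  unfolding sep_kernel_def by (intro allI impI exI[of _ e] exI[of _ s]) (simp add: near_def)

lemma sep_kernel_cong:
  "kernel_eq (a * b) (a' * b') e f \<Longrightarrow> sep_kernel a b a' b' e = sep_kernel a b a' b' f"
  by (simp add: sep_kernel_def near_cong)

lemma sep_kernel_closed:
  assumes "\<And>\<epsilon>. 0 < \<epsilon> \<Longrightarrow> \<exists>f. sep_kernel a b a' b' f \<and> near (a * b) (a' * b') \<epsilon> e f"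
  shows "sep_kernel a b a' b' e"
  unfolding sep_kernel_def
proof (intro allI impI)
  fix \<epsilon> :: real assume "0 < \<epsilon>"
  then have \<epsilon>: "0 < \<epsilon>/2" by simp
  obtain f where f: "sep_kernel a b a' b' f" "near (a * b) (a' * b') (\<epsilon>/2) e f"
    using assms[OF \<epsilon>] by auto
  obtain g s where "sep_sum a b a' b' True g s" "near (a * b) (a' * b') (\<epsilon>/2) f g"
    using f(1) \<epsilon> unfolding sep_kernel_def by metis
  then show "\<exists>f s. sep_sum a b a' b' True f s \<and> near (a * b) (a' * b') \<epsilon> e f"
    using near_half_trans[OF f(2)] by auto
qed

lemma sep_kernel_sum:
  assumes "finite A" "\<And>x. x \<in> A \<Longrightarrow> sep_kernel a b a' b' (e x)"
  shows "sep_kernel a b a' b' (kernel_sum A e)"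
  unfolding sep_kernel_def
proof (intro allI impI)
  fix \<epsilon> :: real assume \<epsilon>: "0 < \<epsilon>"
  then have "\<epsilon> / (real (card A) + 1) > 0" by simp
  with assms(2) have "\<forall>x\<in>A. \<exists>f s. sep_sum a b a' b' True f s \<and> near (a * b) (a' * b') (\<epsilon> / (real (card A) + 1)) (e x) f"
    unfolding sep_kernel_def by blast
  then obtain f s where "\<And>x. x \<in> A \<Longrightarrow> sep_sum a b a' b' True (f x) (s x)"
    "\<And>x. x \<in> A \<Longrightarrow> near (a * b) (a' * b') (\<epsilon> / (real (card A) + 1)) (e x) (f x)"
    by metis
  then show "\<exists>f s. sep_sum a b a' b' True f s \<and> near (a * b) (a' * b') \<epsilon> (kernel_sum A e) f"
    using near_sum[OF assms(1) _ \<epsilon>] sep_sum_sum[OF assms(1)] by blast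
qed

lemma has_sum_near:
  assumes "\<And>i j r c. i < d \<Longrightarrow> j < d \<Longrightarrow> r < d' \<Longrightarrow> c < d' \<Longrightarrow> ((\<lambda>x. e x i j r c) has_sum f i j r c) I" "0 < \<epsilon>"
  obtains F where "finite F" "F \<subseteq> I" "near d d' \<epsilon> f (kernel_sum F e)"
proof -
  have "eventually (\<lambda>F. near d d' \<epsilon> f (kernel_sum F e)) (finite_subsets_at_top I)"
    using assms by (intro near_of_tendsto) (auto simp: has_sum_def)
  then show ?thesis using that unfolding eventually_finite_subsets_at_top by blast
qed

lemma sep_kernel_has_sum:
  assumes "\<And>i j r c. i < a * b \<Longrightarrow> j < a * b \<Longrightarrow> r < a' * b' \<Longrightarrow> c < a' * b' \<Longrightarrow>
      ((\<lambda>x. e x i j r c) has_sum f i j r c) I"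
    and "\<And>x. x \<in> I \<Longrightarrow> sep_kernel a b a' b' (e x)"
  shows "sep_kernel a b a' b' f"
proof (rule sep_kernel_closed)
  fix \<epsilon> :: real assume "0 < \<epsilon>"
  then obtain F where "finite F" "F \<subseteq> I" "near (a * b) (a' * b') \<epsilon> f (kernel_sum F e)"
    using has_sum_near[where e = e and f = f and I = I, OF assms(1)] by blast
  then show "\<exists>g. sep_kernel a b a' b' g \<and> near (a * b) (a' * b') \<epsilon> f g"
    using assms(2) by (intro exI[of _ "\<lambda>i j r c. \<Sum>x\<in>F. e x i j r c"]) (auto intro!: sep_kernel_sum)
qed

section \<open>Composition and tensor products of separable kernels\<close>

definition comp_kernel :: "nat \<Rightarrow> kernel \<Rightarrow> kernel \<Rightarrow> kernel" where
  "comp_kernel m f e i j r c = (\<Sum>p<m. \<Sum>q<m. f i j p q * e p q r c)"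

lemma prod_op_comp:
  "(\<Sum>p<c*d. prod_op d b' K' L' r p * prod_op b d K L p i) =
     prod_op b b' (\<lambda>r i. \<Sum>p<c. K' r p * K p i) (\<lambda>r i. \<Sum>p<d. L' r p * L p i) r i"
proof -
  have "(\<Sum>p<c*d. prod_op d b' K' L' r p * prod_op b d K L p i) =
     (\<Sum>p<c. \<Sum>q<d. (K' (r div b') p * K p (i div b)) * (L' (r mod b') q * L q (i mod b)))"
    unfolding prod_op_def
    using sum_lessThan_mult[of "\<lambda>p q. (K' (r div b') p * K p (i div b)) * (L' (r mod b') q * L q (i mod b))" d c]
    by (simp add: mult_ac)
  then show ?thesis by (simp add: prod_op_def sum_product)
qed

text \<open>In \<open>comp_kernel\<close> the first kernel acts first. Composites of product
  operators are product operators and the weights multiply, so they stay nonnegative. No cost is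
  tracked, since it can be recovered from the trace.\<close>

lemma sep_sum_comp:
  assumes "sep_sum a b c d True f s" "sep_sum c d a' b' True e s'"
  shows "\<exists>s. sep_sum a b a' b' True (comp_kernel (c * d) f e) s"
proof -
  obtain ts where ts: "\<forall>t\<in>set ts. 0 \<le> fst t" "kernel_eq (a * b) (c * d) f (terms_kernel b d ts)"
    using assms(1) by (auto simp: sep_sum_def)
  obtain us where us: "\<forall>t\<in>set us. 0 \<le> fst t" "kernel_eq (c * d) (a' * b') e (terms_kernel d b' us)"
    using assms(2) by (auto simp: sep_sum_def)
  define g where "g x y i j r k = (\<Sum>p<c*d. \<Sum>q<c*d. term_kernel b d (ts ! x) i j p q * term_kernel d b' (us ! y) p q r k)"
    for x y i j r k
  have "kernel_eq (a * b) (a' * b') (comp_kernel (c * d) f e) (\<lambda>i j r k. \<Sum>x<length ts. \<Sum>y<length us. g x y i j r k)"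
    unfolding kernel_eq_def
  proof (intro allI impI)
    fix i j r k assume "i < a * b" "j < a * b" "r < a' * b'" "k < a' * b'"
    then have "comp_kernel (c * d) f e i j r k = (\<Sum>p<c*d. \<Sum>q<c*d. \<Sum>x<length ts. \<Sum>y<length us.
        term_kernel b d (ts ! x) i j p q * term_kernel d b' (us ! y) p q r k)"
      using ts(2) us(2) unfolding comp_kernel_def
      by (intro sum.cong refl) (simp add: kernel_eq_def terms_kernel_eq_sum sum_product)
    also have "\<dots> = (\<Sum>x<length ts. \<Sum>y<length us. g x y i j r k)"
      unfolding g_def by (rule sum_swap4)
    finally show "comp_kernel (c * d) f e i j r k = (\<Sum>x<length ts. \<Sum>y<length us. g x y i j r k)" .
  qed
  moreover have "\<exists>s. sep_sum a b a' b' True (g x y) s" if xy: "x < length ts" "y < length us" for x y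
  proof -
    obtain w K L where t: "ts ! x = (w, K, L)" by (cases "ts ! x")
    obtain w' K' L' where u: "us ! y = (w', K', L')" by (cases "us ! y")
    have w: "0 \<le> w" "0 \<le> w'" using ts(1) us(1) xy t u nth_mem by force+
    let ?K = "\<lambda>r i. \<Sum>p<c. K' r p * K p i" and ?L = "\<lambda>r i. \<Sum>p<d. L' r p * L p i"
    have "g x y i j r k = term_kernel b b' (w * w', ?K, ?L) i j r k" for i j r k
    proof -
      have "g x y i j r k = of_real (w * w') * (\<Sum>p<c*d. \<Sum>q<c*d.
          (prod_op d b' K' L' r p * prod_op b d K L p i) * cnj (prod_op d b' K' L' k q * prod_op b d K L q j))"
        by (simp add: g_def t u sum_distrib_left mult_ac)
      also have "\<dots> = term_kernel b b' (w * w', ?K, ?L) i j r k"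
        unfolding term_kernel.simps prod_op_comp[symmetric] by (simp add: sum_product)
      finally show ?thesis .
    qed
    then have "g x y = term_kernel b b' (w * w', ?K, ?L)" by (intro ext)
    then show ?thesis using sep_sum_single[of True "w * w'" a b a' b' ?K ?L] w by auto
  qed
  then obtain s where "\<And>x y. x < length ts \<Longrightarrow> y < length us \<Longrightarrow> sep_sum a b a' b' True (g x y) (s x y)"
    by metis
  then have "sep_sum a b a' b' True (\<lambda>i j r k. \<Sum>x<length ts. \<Sum>y<length us. g x y i j r k)
      (\<Sum>x<length ts. \<Sum>y<length us. s x y)"
    by (intro sep_sum_sum) auto
  ultimately show ?thesis using sep_sum_cong by blast
qed

text \<open>Approximation is turned into convergence of entries, so that composition of limits
  follows from continuity of finite sums and products.\<close>

lemma sep_kernel_sequence: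
  assumes "sep_kernel a b a' b' e"
  obtains f where "\<And>n::nat. \<exists>s. sep_sum a b a' b' True (f n) s"
    "\<And>i j r c. i < a * b \<Longrightarrow> j < a * b \<Longrightarrow> r < a' * b' \<Longrightarrow> c < a' * b' \<Longrightarrow> (\<lambda>n. f n i j r c) \<longlonglongrightarrow> e i j r c"
proof -
  have "\<exists>f s. sep_sum a b a' b' True f s \<and> near (a * b) (a' * b') (1 / real (Suc n)) e f" for n
    using assms by (simp add: sep_kernel_def)
  then obtain f where f: "\<And>n. \<exists>s. sep_sum a b a' b' True (f n) s"
     "\<And>n. near (a * b) (a' * b') (1 / real (Suc n)) e (f n)"
    by metis
  have "(\<lambda>n. f n i j r c) \<longlonglongrightarrow> e i j r c" if "i < a * b" "j < a * b" "r < a' * b'" "c < a' * b'" for i j r c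
  proof (rule metric_LIMSEQ_I)
    fix \<epsilon> :: real assume "0 < \<epsilon>"
    then obtain N where N: "1 / real (Suc N) < \<epsilon>" using nat_approx_posE by blast
    have "dist (f n i j r c) (e i j r c) < \<epsilon>" if "n \<ge> N" for n
    proof -
      have "dist (f n i j r c) (e i j r c) < 1 / real (Suc n)"
        using f(2)[of n] \<open>i < _\<close> \<open>j < _\<close> \<open>r < _\<close> \<open>c < _\<close> by (simp add: near_def)
      also have "\<dots> \<le> 1 / real (Suc N)" using that by (simp add: field_simps)
      finally show ?thesis using N by simp
    qed
    then show "\<exists>N. \<forall>n\<ge>N. dist (f n i j r c) (e i j r c) < \<epsilon>" by blast
  qed
  then show ?thesis using that f(1) by blast
qed

lemma sep_kernel_comp:
  assumes "sep_kernel a b c d f" "sep_kernel c d a' b' e"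
  shows "sep_kernel a b a' b' (comp_kernel (c * d) f e)"
proof -
  obtain f' where f': "\<And>n::nat. \<exists>s. sep_sum a b c d True (f' n) s"
    "\<And>i j r k. i < a * b \<Longrightarrow> j < a * b \<Longrightarrow> r < c * d \<Longrightarrow> k < c * d \<Longrightarrow> (\<lambda>n. f' n i j r k) \<longlonglongrightarrow> f i j r k"
    using sep_kernel_sequence[OF assms(1)] by blast
  obtain e' where e': "\<And>n::nat. \<exists>s. sep_sum c d a' b' True (e' n) s"
    "\<And>i j r k. i < c * d \<Longrightarrow> j < c * d \<Longrightarrow> r < a' * b' \<Longrightarrow> k < a' * b' \<Longrightarrow> (\<lambda>n. e' n i j r k) \<longlonglongrightarrow> e i j r k"
    using sep_kernel_sequence[OF assms(2)] by blast
  show ?thesis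
  proof (rule sep_kernel_closed)
    fix \<epsilon> :: real assume "0 < \<epsilon>"
    then have "eventually (\<lambda>n. near (a * b) (a' * b') \<epsilon> (comp_kernel (c * d) f e) (comp_kernel (c * d) (f' n) (e' n))) sequentially"
      unfolding comp_kernel_def using f'(2) e'(2)
      by (intro near_of_tendsto tendsto_sum tendsto_mult) auto
    then obtain n where "near (a * b) (a' * b') \<epsilon> (comp_kernel (c * d) f e) (comp_kernel (c * d) (f' n) (e' n))"
      using eventually_happens' sequentially_bot by blast
    moreover have "sep_kernel a b a' b' (comp_kernel (c * d) (f' n) (e' n))"
      using sep_sum_comp f'(1) e'(1) sep_kernelI_sum by metis
    ultimately show "\<exists>g. sep_kernel a b a' b' g \<and> near (a * b) (a' * b') \<epsilon> (comp_kernel (c * d) f e) g"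
      by blast
  qed
qed

lemma sep_sum_tensor:
  assumes "cp_kernel a a' e" "cp_kernel b b' f"
  shows "\<exists>s. sep_sum a b a' b' True (tensor_kernel b b' e f) s"
proof -
  obtain n :: nat and K where K: "kernel_eq a a' e (\<lambda>i j r c. \<Sum>k<n. K k r i * cnj (K k c j))"
    using assms(1) by (auto simp: cp_kernel_def)
  obtain m :: nat and L where L: "kernel_eq b b' f (\<lambda>i j r c. \<Sum>k<m. L k r i * cnj (L k c j))"
    using assms(2) by (auto simp: cp_kernel_def)
  have "sep_sum a b a' b' True (\<lambda>i j r c. \<Sum>k<n. \<Sum>l<m. term_kernel b b' (1, K k, L l) i j r c)
     (\<Sum>k<n. \<Sum>l<m. term_cost a b a' b' (1, K k, L l))"
    by (intro sep_sum_sum sep_sum_single) auto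
  moreover have "kernel_eq (a * b) (a' * b') (tensor_kernel b b' e f)
      (\<lambda>i j r c. \<Sum>k<n. \<Sum>l<m. term_kernel b b' (1, K k, L l) i j r c)"
    unfolding kernel_eq_def
  proof (intro allI impI)
    fix i j r c assume "i < a * b" "j < a * b" "r < a' * b'" "c < a' * b'"
    then have "tensor_kernel b b' e f i j r c =
       (\<Sum>k<n. K k (r div b') (i div b) * cnj (K k (c div b') (j div b))) *
       (\<Sum>l<m. L l (r mod b') (i mod b) * cnj (L l (c mod b') (j mod b)))"
      using K L by (simp add: kernel_eq_def tensor_kernel_def div_mod_less)
    then show "tensor_kernel b b' e f i j r c = (\<Sum>k<n. \<Sum>l<m. term_kernel b b' (1, K k, L l) i j r c)"
      by (simp add: sum_product prod_op_def mult_ac)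
  qed
  ultimately show ?thesis using sep_sum_cong by blast
qed

lemma sep_kernel_tensor:
  "cp_kernel a a' e \<Longrightarrow> cp_kernel b b' f \<Longrightarrow> sep_kernel a b a' b' (tensor_kernel b b' e f)"
  using sep_sum_tensor sep_kernelI_sum by blast


section \<open>LOCC maps have separable kernels\<close>

lemma instrument_cp:
  assumes "instrument d d' I E" "x \<in> I"
  shows "linear_superop d d' (E x)" "cp_kernel d d' (ent d (E x))"
  using assms by (auto simp: instrument_def completely_positive_iff)

lemma superop_sum_ent:
  assumes "superop_sum d d' I E F" "i < d" "j < d" "r < d'" "c < d'"
  shows "((\<lambda>x. ent d (E x) i j r c) has_sum ent d F i j r c) I"
  using assms by (auto simp: superop_sum_def ent_def)

lemma ent_tensor_superop:
  assumes E: "linear_superop a a' E" and F: "linear_superop b b' F"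
    and G: "\<And>X. X \<in> carrier_mat (a * b) (a * b) \<Longrightarrow> G X = tensor_superop a b a' b' E F X"
  shows "linear_superop (a * b) (a' * b') G"
    "kernel_eq (a * b) (a' * b') (ent (a * b) G) (tensor_kernel b b' (ent a E) (ent b F))"
proof -
  have GX: "G X = kernel_map (a * b) (a' * b') (tensor_kernel b b' (ent a E) (ent b F)) X"
    if "X \<in> carrier_mat (a * b) (a * b)" for X
    unfolding G[OF that] using E F
    by (intro tensor_superop_eq_kernel_map) (auto intro: linear_superop_carrier)
  show "linear_superop (a * b) (a' * b') G"
    using linear_superop_kernel_map[of "a * b" "a' * b'" "tensor_kernel b b' (ent a E) (ent b F)"]
    unfolding linear_superop_def by (simp add: GX)
  have "ent (a * b) G i j r c = ent (a * b) (kernel_map (a * b) (a' * b') (tensor_kernel b b' (ent a E) (ent b F))) i j r c"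
    for i j r c by (simp add: ent_def GX)
  then show "kernel_eq (a * b) (a' * b') (ent (a * b) G) (tensor_kernel b b' (ent a E) (ent b F))"
    by (simp add: kernel_eq_def)
qed

text \<open>The direction of communication is irrelevant at this point: for either party, each
  outcome is a tensor product of two completely positive maps.\<close>

lemma one_way_local_sep:
  assumes "one_way_local a b a' b' I F" "x \<in> I"
  shows "linear_superop (a * b) (a' * b') (F x) \<and> sep_kernel a b a' b' (ent (a * b) (F x))"
proof -
  obtain E T where "completely_positive a a' E" "completely_positive b b' T"
    and F: "\<And>X. X \<in> carrier_mat (a * b) (a * b) \<Longrightarrow> F x X = tensor_superop a b a' b' E T X"
    using assms unfolding one_way_local_def one_way_local_fst_def one_way_local_snd_def
      instrument_def cptp_def by meson
  then have E: "linear_superop a a' E" "cp_kernel a a' (ent a E)"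
    and T: "linear_superop b b' T" "cp_kernel b b' (ent b T)" by (auto simp: completely_positive_iff)
  show ?thesis
    using ent_tensor_superop[of a a' E b b' T "F x", OF E(1) T(1) F] sep_kernel_tensor[OF E(2) T(2)]
    by (simp add: sep_kernel_cong)
qed

lemma ent_comp:
  assumes "linear_superop d m E" "linear_superop m d' F"
  shows "kernel_eq d d' (ent d (F \<circ> E)) (comp_kernel m (ent d E) (ent m F))"
proof -
  have "ent d (F \<circ> E) i j r c = (\<Sum>p<m. \<Sum>q<m. E (mat_unit d i j) $$ (p, q) * ent m F p q r c)"
    if "r < d'" "c < d'" for i j r c
    using linear_superop_apply[OF assms(2) linear_superop_carrier[OF assms(1)], of "mat_unit d i j" r c] that
    by (simp add: ent_def)
  then show ?thesis by (simp add: kernel_eq_def comp_kernel_def ent_def)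
qed

lemma coarse_graining_sep:
  assumes cg: "coarse_graining (a * b) (a' * b') I E K G" and "k \<in> K"
    and "\<And>x. x \<in> I \<Longrightarrow> sep_kernel a b a' b' (ent (a * b) (E x))"
  shows "sep_kernel a b a' b' (ent (a * b) (G k))"
proof -
  obtain f where f: "superop_sum (a * b) (a' * b') {i \<in> I. f i = k} E (G k)"
    using cg \<open>k \<in> K\<close> by (auto simp: coarse_graining_def)
  show ?thesis
  proof (rule sep_kernel_has_sum)
    show "((\<lambda>x. ent (a * b) (E x) i j r c) has_sum ent (a * b) (G k) i j r c) {i \<in> I. f i = k}"
      if "i < a * b" "j < a * b" "r < a' * b'" "c < a' * b'" for i j r c
      using superop_sum_ent[OF f that] .
  qed (use assms(3) in auto)
qed

text \<open>Linearity is carried along because kernels determine the composite only of linear maps.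
  For the merged outcomes it comes from \<open>G\<close> being an instrument.\<close>

lemma locc_rounds_sep:
  assumes "locc_rounds a b a' b' n K G"
  shows "\<forall>k\<in>K. linear_superop (a * b) (a' * b') (G k) \<and> sep_kernel a b a' b' (ent (a * b) (G k))"
  using assms
proof (induction rule: locc_rounds.induct)
  case (one a' b' I E K G)
  show ?case
  proof
    fix k assume k: "k \<in> K"
    show "linear_superop (a * b) (a' * b') (G k) \<and> sep_kernel a b a' b' (ent (a * b) (G k))"
      using instrument_cp(1)[OF one(2) k] coarse_graining_sep[OF one(3) k] one_way_local_sep[OF one(1)]
      by blast
  qed
next
  case (link c d n I E a' b' K G)
  obtain L J where J: "\<And>j. j \<in> I \<Longrightarrow> one_way_local c d a' b' (L j) (J j)"
    and cg: "coarse_graining (a * b) (a' * b') (SIGMA j:I. L j) (\<lambda>(j, j'). J j j' \<circ> E j) K G"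
    and instr: "instrument (a * b) (a' * b') K G"
    using link.hyps(2) unfolding locc_linked_def by blast
  have "sep_kernel a b a' b' (ent (a * b) (J j j' \<circ> E j))" if "j \<in> I" "j' \<in> L j" for j j'
    using one_way_local_sep[OF J[OF that(1)] that(2)] link.IH that(1)
      sep_kernel_comp[of a b c d "ent (a * b) (E j)" a' b' "ent (c * d) (J j j')"]
      ent_comp[of "a * b" "c * d" "E j" "a' * b'" "J j j'"]
    by (simp add: sep_kernel_cong)
  then have "sep_kernel a b a' b' (ent (a * b) (G k))" if "k \<in> K" for k
    using coarse_graining_sep[OF cg that] by auto
  then show ?case using instrument_cp(1)[OF instr] by blast
qed

section \<open>Limits of LOCC protocols\<close>

lemma superop_norm_entry:
  assumes "i < d" "j < d" "r < d'" "c < d'"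
  shows "cmod (ent d E i j r c) \<le> superop_norm d d' E"
proof -
  have "cmod (ent d E i j r c) \<le> (\<Sum>(i, j, r, c)\<in>{..<d} \<times> {..<d} \<times> {..<d'} \<times> {..<d'}. cmod (ent d E i j r c))"
    using member_le_sum[of "(i, j, r, c)" "{..<d} \<times> {..<d} \<times> {..<d'} \<times> {..<d'}" "\<lambda>(i, j, r, c). cmod (ent d E i j r c)"] assms
    by auto
  then show ?thesis by (simp add: superop_norm_def ent_def sum.cartesian_product case_prod_beta)
qed

lemma superop_norm_nonneg: "0 \<le> superop_norm d d' E"
  by (simp add: superop_norm_def sum_nonneg)

text \<open>All terms of the distance are nonnegative, so the one belonging to \<open>x\<close> is
  bounded by the whole sum, and each entry is bounded by the norm.\<close>

lemma family_dist_less_near: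
  assumes "family_dist_less d d' K G I E \<epsilon>" "x \<in> I" "linear_superop d d' (E x)"
    "\<And>k. k \<in> K \<Longrightarrow> linear_superop d d' (G k)"
  shows "near d d' \<epsilon> (ent d (E x)) (ent d (zero_ext d' K G x))"
proof -
  define D where "D k = (\<lambda>X. zero_ext d' K G k X - zero_ext d' I E k X)" for k
  obtain s where s: "s < \<epsilon>" "((\<lambda>k. superop_norm d d' (D k)) has_sum s) (K \<union> I)"
    using assms(1) by (auto simp: family_dist_less_def D_def)
  have "superop_norm d d' (D x) \<le> s"
    using finite_sum_le_has_sum[OF s(2), of "{x}"] assms(2) by (simp add: superop_norm_nonneg)
  then have "cmod (ent d (D x) i j r c) < \<epsilon>" if "i < d" "j < d" "r < d'" "c < d'" for i j r c
    using superop_norm_entry[OF that, of "D x"] s(1) by linarith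
  moreover have "ent d (D x) i j r c = ent d (zero_ext d' K G x) i j r c - ent d (E x) i j r c"
    if "i < d" "j < d" "r < d'" "c < d'" for i j r c
    using assms(2) that linear_superop_carrier[OF assms(3), of "mat_unit d i j"]
    by (simp add: D_def ent_def zero_ext_def)
  ultimately show ?thesis by (simp add: near_def dist_norm)
qed

lemma locc_instrument_sep:
  assumes locc: "locc_instrument a b I E" and x: "x \<in> I"
  shows "sep_kernel a b a b (ent (a * b) (E x))"
proof (rule sep_kernel_closed)
  fix \<epsilon> :: real assume \<epsilon>: "0 < \<epsilon>"
  obtain c d K G K' G' where
    rounds: "\<forall>n. locc_rounds a b (c n) (d n) (Suc n) (K n) (G n)" and
    "\<forall>n. locc_linked a b (c n) (d n) (c (Suc n)) (d (Suc n)) (K (Suc n)) (G (Suc n)) (K n) (G n)" and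
    K': "\<forall>n. instrument (a * b) (c n * d n) (K' n) (G' n) \<and>
      coarse_graining (a * b) (c n * d n) (K n) (G n) (K' n) (G' n)" and
    lim: "\<forall>\<epsilon>>0. \<forall>\<^sub>F n in sequentially. c n = a \<and> d n = b \<and>
           family_dist_less (a * b) (a * b) (K' n) (G' n) I E \<epsilon>"
    using locc unfolding locc_instrument_def by (elim conjE exE) (rule that)
  note instr = K'[rule_format, THEN conjunct1] and cg = K'[rule_format, THEN conjunct2]
  obtain n where n: "c n = a" "d n = b" "family_dist_less (a * b) (a * b) (K' n) (G' n) I E \<epsilon>"
    using eventually_happens'[OF sequentially_bot lim[rule_format, OF \<epsilon>]] by auto
  have G': "sep_kernel a b a b (ent (a * b) (G' n k))" if "k \<in> K' n" for k
    using coarse_graining_sep[OF cg[of n, unfolded n(1,2)] that] locc_rounds_sep[OF rounds[rule_format, of n, unfolded n(1,2)]]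
    by blast
  have "sep_kernel a b a b (ent (a * b) (zero_ext (a * b) (K' n) (G' n) x))"
  proof (cases "x \<in> K' n")
    case True
    then show ?thesis using G' by (simp add: zero_ext_def)
  next
    case False
    \<comment> \<open>The approximating instrument may lack the label \<open>x\<close>. It then
      contributes the zero map, which is the empty combination.\<close>
    have "sep_kernel a b a b (\<lambda>_ _ _ _. 0)" using sep_kernel_sum[of "{}" a b a b] by simp
    moreover have "kernel_eq (a * b) (a * b) (ent (a * b) (zero_ext (a * b) (K' n) (G' n) x)) (\<lambda>_ _ _ _. 0)"
      using False by (simp add: kernel_eq_def ent_def zero_ext_def)
    ultimately show ?thesis by (simp add: sep_kernel_cong)
  qed
  moreover have "near (a * b) (a * b) \<epsilon> (ent (a * b) (E x)) (ent (a * b) (zero_ext (a * b) (K' n) (G' n) x))"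
    using locc instrument_cp(1)[OF instr[of n, unfolded n(1,2)]] x
    by (intro family_dist_less_near[OF n(3)]) (auto simp: locc_instrument_def dest: instrument_cp)
  ultimately show "\<exists>f. sep_kernel a b a b f \<and> near (a * b) (a * b) \<epsilon> (ent (a * b) (E x)) f" by blast
qed

section \<open>The trace of the Choi operator as a bound on the cost\<close>

definition kernel_trace :: "nat \<Rightarrow> nat \<Rightarrow> kernel \<Rightarrow> real" where
  "kernel_trace d d' e = Re (\<Sum>i<d. \<Sum>r<d'. e i i r r)"

lemma kernel_trace_near:
  assumes "near d d' \<epsilon> e f"
  shows "kernel_trace d d' f \<le> kernel_trace d d' e + real d * real d' * \<epsilon>"
proof -
  have "Re (f i i r r) \<le> Re (e i i r r) + \<epsilon>" if "i < d" "r < d'" for i r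
  proof -
    have "cmod (f i i r r - e i i r r) < \<epsilon>" using assms that by (auto simp: near_def dist_norm)
    then show ?thesis using complex_Re_le_cmod[of "f i i r r - e i i r r"] by simp
  qed
  then have "(\<Sum>i<d. \<Sum>r<d'. Re (f i i r r)) \<le> (\<Sum>i<d. \<Sum>r<d'. Re (e i i r r) + \<epsilon>)"
    by (intro sum_mono) auto
  then show ?thesis by (simp add: kernel_trace_def sum.distrib mult.assoc)
qed

lemma sep_sum_weaken: "sep_sum a b a' b' True e s \<Longrightarrow> sep_sum a b a' b' False e s"
  by (auto simp: sep_sum_def)

lemma sep_cost_trace:
  assumes "sep_kernel a b a' b' e"
  shows "sep_cost a b a' b' e (kernel_trace (a * b) (a' * b') e)"
  unfolding sep_cost_def
proof (intro allI impI)
  fix \<epsilon> :: real assume \<epsilon>: "0 < \<epsilon>"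
  define D where "D = real (a * b) * real (a' * b') + 1"
  have D: "D \<ge> 1" by (simp add: D_def)
  \<comment> \<open>The trace has \<open>a * b * (a' * b')\<close> summands, each off by less than
    \<open>\<delta>\<close>. The 1 added in \<open>D\<close> makes the quotient meaningful and
    ensures \<open>\<delta> \<le> \<epsilon>\<close>.\<close>
  define \<delta> where "\<delta> = \<epsilon> / D"
  have \<delta>: "0 < \<delta>" "\<delta> \<le> \<epsilon>" using \<epsilon> D by (auto simp: \<delta>_def field_simps)
  obtain f s where f: "sep_sum a b a' b' True f s" "near (a * b) (a' * b') \<delta> e f"
    using assms \<delta>(1) unfolding sep_kernel_def by metis
  have "sep_sum a b a' b' False f (kernel_trace (a * b) (a' * b') f)"
    using sep_sum_trace[OF f(1)] sep_sum_weaken by (simp add: kernel_trace_def)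
  moreover have "kernel_trace (a * b) (a' * b') f \<le> kernel_trace (a * b) (a' * b') e + \<epsilon>"
  proof -
    have "real (a * b) * real (a' * b') * \<delta> \<le> D * \<delta>" using \<delta> by (simp add: D_def)
    also have "D * \<delta> = \<epsilon>" using D by (simp add: \<delta>_def)
    finally show ?thesis using kernel_trace_near[OF f(2)] by linarith
  qed
  moreover have "near (a * b) (a' * b') \<epsilon> e f"
    using f(2) \<delta>(2) unfolding near_def by (meson less_le_trans)
  ultimately show "\<exists>f. sep_sum a b a' b' False f (kernel_trace (a * b) (a' * b') e + \<epsilon>) \<and> near (a * b) (a' * b') \<epsilon> e f"
    using sep_sum_mono by blast
qed

lemma sep_cost_cong:
  "kernel_eq (a * b) (a' * b') e f \<Longrightarrow> sep_cost a b a' b' e s = sep_cost a b a' b' f s"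
  by (simp add: sep_cost_def near_cong)

lemma sep_cost_mono: "sep_cost a b a' b' e s \<Longrightarrow> s \<le> s' \<Longrightarrow> sep_cost a b a' b' e s'"
  unfolding sep_cost_def using sep_sum_mono by (metis add_le_cancel_right)

lemma sep_cost_scale:
  assumes "sep_cost a b a' b' e s"
  shows "sep_cost a b a' b' (\<lambda>i j r c. complex_of_real \<beta> * e i j r c) (\<bar>\<beta>\<bar> * s)"
  unfolding sep_cost_def
proof (intro allI impI)
  fix \<epsilon> :: real assume \<epsilon>: "0 < \<epsilon>"
  define \<delta> where "\<delta> = \<epsilon> / (\<bar>\<beta>\<bar> + 1)"
  have \<delta>: "0 < \<delta>" using \<epsilon> by (simp add: \<delta>_def)
  have \<beta>\<delta>: "\<bar>\<beta>\<bar> * \<delta> < \<epsilon>" using \<epsilon> by (simp add: \<delta>_def field_simps)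
  obtain f where f: "sep_sum a b a' b' False f (s + \<delta>)" "near (a * b) (a' * b') \<delta> e f"
    using assms \<delta> unfolding sep_cost_def by metis
  have "sep_sum a b a' b' False (\<lambda>i j r c. complex_of_real \<beta> * f i j r c) (\<bar>\<beta>\<bar> * s + \<epsilon>)"
    using sep_sum_scale[OF f(1), of \<beta>] \<beta>\<delta> by (auto elim!: sep_sum_mono simp: algebra_simps)
  moreover have "near (a * b) (a' * b') \<epsilon> (\<lambda>i j r c. complex_of_real \<beta> * e i j r c) (\<lambda>i j r c. complex_of_real \<beta> * f i j r c)"
    unfolding near_def
  proof (intro ballI)
    fix i j r c assume "i \<in> {..<a*b}" "j \<in> {..<a*b}" "r \<in> {..<a'*b'}" "c \<in> {..<a'*b'}"
    then have "dist (f i j r c) (e i j r c) < \<delta>" using f(2) by (simp add: near_def)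
    then have "\<bar>\<beta>\<bar> * dist (f i j r c) (e i j r c) \<le> \<bar>\<beta>\<bar> * \<delta>" by (intro mult_left_mono) auto
    then show "dist (complex_of_real \<beta> * f i j r c) (complex_of_real \<beta> * e i j r c) < \<epsilon>"
      using \<beta>\<delta> by (simp add: dist_norm norm_mult flip: right_diff_distrib)
  qed
  ultimately show "\<exists>f. sep_sum a b a' b' False f (\<bar>\<beta>\<bar> * s + \<epsilon>) \<and>
      near (a * b) (a' * b') \<epsilon> (\<lambda>i j r c. complex_of_real \<beta> * e i j r c) f" by blast
qed

lemma sep_cost_sum:
  assumes "finite A" "\<And>x. x \<in> A \<Longrightarrow> sep_cost a b a' b' (e x) (s x)"
  shows "sep_cost a b a' b' (kernel_sum A e) (\<Sum>x\<in>A. s x)"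
  unfolding sep_cost_def
proof (intro allI impI)
  fix \<epsilon> :: real assume \<epsilon>: "0 < \<epsilon>"
  define \<delta> where "\<delta> = \<epsilon> / (real (card A) + 1)"
  have \<delta>: "0 < \<delta>" using \<epsilon> by (simp add: \<delta>_def)
  have "\<forall>x\<in>A. \<exists>f. sep_sum a b a' b' False f (s x + \<delta>) \<and> near (a * b) (a' * b') \<delta> (e x) f"
    using assms(2) \<delta> unfolding sep_cost_def by blast
  then obtain f where f: "\<And>x. x \<in> A \<Longrightarrow> sep_sum a b a' b' False (f x) (s x + \<delta>)"
    "\<And>x. x \<in> A \<Longrightarrow> near (a * b) (a' * b') \<delta> (e x) (f x)"
    by metis
  have le: "(\<Sum>x\<in>A. s x + \<delta>) \<le> (\<Sum>x\<in>A. s x) + \<epsilon>"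
  proof -
    have "real (card A) * \<delta> \<le> \<epsilon>" using \<epsilon> by (simp add: \<delta>_def field_simps)
    then show ?thesis by (simp add: sum.distrib)
  qed
  show "\<exists>f. sep_sum a b a' b' False f ((\<Sum>x\<in>A. s x) + \<epsilon>) \<and>
      near (a * b) (a' * b') \<epsilon> (kernel_sum A e) f"
    using near_sum[where e = e and f = f, OF assms(1) f(2)[unfolded \<delta>_def] \<epsilon>]
      sep_sum_mono[OF sep_sum_sum[where e = f and s = "\<lambda>x. s x + \<delta>", OF assms(1) f(1)] le]
    by blast
qed

lemma sep_cost_closed:
  assumes "\<And>\<epsilon>. 0 < \<epsilon> \<Longrightarrow> \<exists>f. sep_cost a b a' b' f s \<and> near (a * b) (a' * b') \<epsilon> e f"
  shows "sep_cost a b a' b' e s"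
  unfolding sep_cost_def
proof (intro allI impI)
  fix \<epsilon> :: real assume "0 < \<epsilon>"
  then have \<epsilon>: "0 < \<epsilon>/2" by simp
  obtain f where f: "sep_cost a b a' b' f s" "near (a * b) (a' * b') (\<epsilon>/2) e f"
    using assms[OF \<epsilon>] by auto
  obtain g where "sep_sum a b a' b' False g (s + \<epsilon>/2)" "near (a * b) (a' * b') (\<epsilon>/2) f g"
    using f(1) \<epsilon> unfolding sep_cost_def by metis
  then show "\<exists>f. sep_sum a b a' b' False f (s + \<epsilon>) \<and> near (a * b) (a' * b') \<epsilon> e f"
    using near_half_trans[OF f(2)] sep_sum_mono[of a b a' b' False g "s + \<epsilon>/2" "s + \<epsilon>"] \<epsilon> by auto
qed

lemma cp_kernel_trace_nonneg:
  assumes "cp_kernel d d' e"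
  shows "0 \<le> kernel_trace d d' e"
proof -
  obtain n :: nat and K where "kernel_eq d d' e (\<lambda>i j r c. \<Sum>k<n. K k r i * cnj (K k c j))"
    using assms by (auto simp: cp_kernel_def)
  then have "kernel_trace d d' e = (\<Sum>i<d. \<Sum>r<d'. \<Sum>k<n. (cmod (K k r i))\<^sup>2)"
    by (simp add: kernel_trace_def kernel_eq_def flip: complex_norm_square of_real_power)
  then show ?thesis by (simp add: sum_nonneg)
qed

lemma has_sum_sum:
  fixes f :: "'i \<Rightarrow> 'j \<Rightarrow> complex"
  assumes "finite A" "\<And>x. x \<in> A \<Longrightarrow> (f x has_sum s x) I"
  shows "((\<lambda>y. \<Sum>x\<in>A. f x y) has_sum (\<Sum>x\<in>A. s x)) I"
  using assms by (induction A rule: finite_induct) (auto intro!: has_sum_add)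

text \<open>The individual outcomes need not preserve the trace, but their sum does, and each of the
  \<open>d\<close> diagonal matrix units contributes 1 to the trace of its Choi operator.\<close>

lemma instrument_trace_has_sum:
  assumes "instrument d d' I E"
  shows "((\<lambda>x. kernel_trace d d' (ent d (E x))) has_sum real d) I"
proof -
  obtain F where F: "superop_sum d d' I E F" "trace_preserving d F"
    using assms by (auto simp: instrument_def)
  have "(\<Sum>r<d'. ent d F i i r r) = 1" if "i < d" for i
  proof -
    have "mtrace (F (mat_unit d i i)) = mtrace (mat_unit d i i)"
      using F(2) by (simp add: trace_preserving_def)
    moreover have "dim_row (F (mat_unit d i i)) = d'"
      using F(1) by (auto simp: superop_sum_def)
    ultimately show ?thesis using that by (simp add: mtrace_def ent_def)
  qed
  moreover have "((\<lambda>x. kernel_trace d d' (ent d (E x))) has_sum kernel_trace d d' (ent d F)) I"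
    unfolding kernel_trace_def
    by (intro has_sum_Re has_sum_sum superop_sum_ent[OF F(1)]) auto
  ultimately show ?thesis by (simp add: kernel_trace_def)
qed

text \<open>The cost of outcome \<open>x\<close> is at most \<open>\<bar>\<beta> x\<bar>\<close>
  times its trace. As these factors are at most 1 and the traces of all outcomes sum to
  \<open>a * b\<close>, every finite partial sum costs at most \<open>a * b\<close>, and the bound
  survives the limit.\<close>

lemma LOCC_star_sep_cost:
  assumes "F \<in> LOCC_star a b"
  shows "sep_cost a b a b (ent (a * b) F) (real (a * b))"
proof (rule sep_cost_closed)
  fix \<epsilon> :: real assume \<epsilon>: "0 < \<epsilon>"
  define D where "D = a * b"
  obtain I E \<beta> where locc: "locc_instrument a b I E" and \<beta>: "\<And>i. i \<in> I \<Longrightarrow> \<beta> i \<in> {-1..1::real}"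
    and F: "superop_sum D D I (\<lambda>i X. complex_of_real (\<beta> i) \<cdot>\<^sub>m E i X) F"
    using assms by (auto simp: LOCC_star_def D_def)
  have instr: "instrument D D I E" using locc by (simp add: locc_instrument_def D_def)
  define e where "e x i j r c = complex_of_real (\<beta> x) * ent D (E x) i j r c" for x i j r c
  have "((\<lambda>x. e x i j r c) has_sum ent D F i j r c) I" if "i < D" "j < D" "r < D" "c < D" for i j r c
  proof -
    have "ent D (\<lambda>X. complex_of_real (\<beta> x) \<cdot>\<^sub>m E x X) i j r c = e x i j r c" if "x \<in> I" for x
      using linear_superop_carrier[OF instrument_cp(1)[OF instr that], of "mat_unit D i j"]
        \<open>r < D\<close> \<open>c < D\<close> by (auto simp: e_def ent_def)
    then show ?thesis using superop_sum_ent[OF F that] by (simp cong: has_sum_cong)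
  qed
  from has_sum_near[where e = e and f = "ent D F" and I = I and \<epsilon> = \<epsilon>, OF this \<epsilon>]
  obtain A where A: "finite A" "A \<subseteq> I" "near D D \<epsilon> (ent D F) (kernel_sum A e)" by blast
  have "sep_cost a b a b (kernel_sum A e) (\<Sum>x\<in>A. \<bar>\<beta> x\<bar> * kernel_trace D D (ent D (E x)))"
    unfolding e_def D_def using A(2) locc_instrument_sep[OF locc]
    by (intro sep_cost_sum A(1) sep_cost_scale sep_cost_trace) auto
  moreover have "(\<Sum>x\<in>A. \<bar>\<beta> x\<bar> * kernel_trace D D (ent D (E x))) \<le> (\<Sum>x\<in>A. kernel_trace D D (ent D (E x)))"
  proof (rule sum_mono)
    fix x assume "x \<in> A"
    then have "\<bar>\<beta> x\<bar> \<le> 1" "0 \<le> kernel_trace D D (ent D (E x))"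
      using \<beta>[of x] A(2) cp_kernel_trace_nonneg[OF instrument_cp(2)[OF instr]]
      by (auto simp: subset_iff abs_le_iff)
    then show "\<bar>\<beta> x\<bar> * kernel_trace D D (ent D (E x)) \<le> kernel_trace D D (ent D (E x))"
      by (simp add: mult_left_le_one_le)
  qed
  moreover have "(\<Sum>x\<in>A. kernel_trace D D (ent D (E x))) \<le> real D"
    using A cp_kernel_trace_nonneg[OF instrument_cp(2)[OF instr]]
    by (intro finite_sum_le_has_sum[OF instrument_trace_has_sum[OF instr]]) auto
  ultimately have "sep_cost a b a b (kernel_sum A e) (real D)"
    by (meson order_trans sep_cost_mono)
  then show "\<exists>f. sep_cost a b a b f (real (a * b)) \<and> near (a * b) (a * b) \<epsilon> (ent (a * b) F) f"
    using A(3) by (auto simp: D_def)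
qed


section \<open>Exact decompositions of Hermitian kernels\<close>

definition hermitian_kernel :: "nat \<Rightarrow> nat \<Rightarrow> kernel \<Rightarrow> bool" where
  "hermitian_kernel d d' e \<longleftrightarrow> kernel_eq d d' e (\<lambda>i j r c. cnj (e j i c r))"

lemma hermitian_kernelD:
  assumes "hermitian_kernel d d' e" "i < d" "j < d" "r < d'" "c < d'"
  shows "cnj (e j i c r) = e i j r c"
  using assms unfolding hermitian_kernel_def kernel_eq_def by (intro sym[of "e i j r c"]) blast

text \<open>The vectors \<open>e\<^bsub>(R, I)\<^esub> + \<i>\<^sup>k e\<^bsub>(C, J)\<^esub>\<close> of the polarization identity.\<close>

definition polar :: "nat \<Rightarrow> nat \<Rightarrow> nat \<Rightarrow> nat \<Rightarrow> nat \<Rightarrow> nat \<Rightarrow> nat \<Rightarrow> complex" where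
  "polar k R I C J r i = (if r = R \<and> i = I then 1 else 0) + \<i> ^ k * (if r = C \<and> i = J then 1 else 0)"

text \<open>With the vectors \<open>x + \<i>^k y\<close> and \<open>z + \<i>^k w\<close> only the
  product of \<open>x\<close> and \<open>cnj w\<close> is free of a phase after multiplication by
  \<open>\<i>^k\<close>. The other three carry \<open>\<i>^k\<close> or \<open>\<i>^(2k)\<close>,
  whose sums over \<open>k < 4\<close> vanish.\<close>

lemma polarization:
  "(\<Sum>k<4. \<i> ^ k * (polar k R I C J r i * cnj (polar k R I C J c j))) =
     (if r = R \<and> i = I \<and> c = C \<and> j = J then 4 else 0)"
proof -
  define x y z w :: complex where "x = (if r = R \<and> i = I then 1 else 0)" and "y = (if r = C \<and> i = J then 1 else 0)"
    and "z = (if c = R \<and> j = I then 1 else 0)" and "w = (if c = C \<and> j = J then 1 else 0)"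
  have "(\<Sum>k<4. \<i> ^ k * (polar k R I C J r i * cnj (polar k R I C J c j))) =
      (\<Sum>k<4. \<i> ^ k * ((x + \<i> ^ k * y) * cnj (z + \<i> ^ k * w)))"
    by (simp add: polar_def x_def y_def z_def w_def)
  also have "\<dots> = 4 * (x * cnj w)"
    by (simp add: eval_nat_numeral algebra_simps)
  finally show ?thesis by (simp add: x_def w_def)
qed

lemma norm_polar: "cmod (polar k R I C J r i) \<le> 2"
  unfolding polar_def by (rule order_trans[OF norm_triangle_ineq]) (auto simp: norm_mult norm_power)

definition polar_op :: "nat \<Rightarrow> nat \<Rightarrow> nat \<Rightarrow> nat \<Rightarrow> nat \<Rightarrow> nat \<Rightarrow> nat \<Rightarrow> nat \<Rightarrow> nat \<Rightarrow> nat \<Rightarrow> complex" where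
  "polar_op b b' I J R C k l = prod_op b b' (polar k (R div b') (I div b) (C div b') (J div b))
     (polar l (R mod b') (I mod b) (C mod b') (J mod b))"

lemma eq_iff_div_mod: "x = y \<longleftrightarrow> x div b = y div b \<and> x mod b = y mod (b::nat)"
  by (metis div_mult_mod_eq)

text \<open>One polarization is used on either side of the cut, so the vectors remain products; 16
  is the product of the two factors 4. Weights have to be real, hence the real part, which is
  harmless once the coefficients of a Hermitian kernel are summed.\<close>

definition polar_term :: "nat \<Rightarrow> nat \<Rightarrow> nat \<Rightarrow> nat \<Rightarrow> nat \<Rightarrow> nat \<Rightarrow> nat \<Rightarrow> nat \<Rightarrow> complex \<Rightarrow> sep_term" where
  "polar_term b b' I J R C k l z = (Re (z * \<i> ^ k * \<i> ^ l) / 16,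
     polar k (R div b') (I div b) (C div b') (J div b), polar l (R mod b') (I mod b) (C mod b') (J mod b))"

lemma sum_polar_prod:
  "(\<Sum>k<4. \<Sum>l<4. z * \<i> ^ k * \<i> ^ l / 16 *
     (polar_op b b' I J R C k l r i *
      cnj (polar_op b b' I J R C k l c j)))
   = (if r = R \<and> i = I \<and> c = C \<and> j = J then z else 0)"
proof -
  define f where "f k = \<i> ^ k * (polar k (R div b') (I div b) (C div b') (J div b) (r div b') (i div b) *
      cnj (polar k (R div b') (I div b) (C div b') (J div b) (c div b') (j div b)))" for k
  define g where "g l = \<i> ^ l * (polar l (R mod b') (I mod b) (C mod b') (J mod b) (r mod b') (i mod b) *
      cnj (polar l (R mod b') (I mod b) (C mod b') (J mod b) (c mod b') (j mod b)))" for l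
  have "(\<Sum>k<4. \<Sum>l<4. z * \<i> ^ k * \<i> ^ l / 16 *
     (polar_op b b' I J R C k l r i *
      cnj (polar_op b b' I J R C k l c j)))
     = (\<Sum>k<4. \<Sum>l<4. z / 16 * (f k * g l))"
    by (intro sum.cong refl) (simp add: polar_op_def prod_op_def f_def g_def mult_ac)
  also have "\<dots> = z / 16 * ((\<Sum>k<4. f k) * (\<Sum>l<4. g l))"
    unfolding sum_product by (simp only: sum_distrib_left)
  also have "\<dots> = (if r = R \<and> i = I \<and> c = C \<and> j = J then z else 0)"
    unfolding f_def g_def polarization
    by (simp add: eq_iff_div_mod[of r R b'] eq_iff_div_mod[of i I b] eq_iff_div_mod[of c C b'] eq_iff_div_mod[of j J b])
  finally show ?thesis .
qed

lemma sum_delta4: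
  fixes X :: "nat \<Rightarrow> nat \<Rightarrow> nat \<Rightarrow> nat \<Rightarrow> 'a::comm_ring_1"
  assumes "i < d" "j < d" "r < d'" "c < d'"
  shows "(\<Sum>I<d. \<Sum>J<d. \<Sum>R<d'. \<Sum>C<d'. if r = R \<and> i = I \<and> c = C \<and> j = J then X I J R C else 0) = X i j r c"
proof -
  have "(\<Sum>I<d. \<Sum>J<d. \<Sum>R<d'. \<Sum>C<d'. if r = R \<and> i = I \<and> c = C \<and> j = J then X I J R C else 0) =
     (\<Sum>I<d. \<Sum>J<d. (\<Sum>R<d'. \<Sum>C<d'. X I J R C * (if R = r \<and> C = c then 1 else 0)) * (if I = i \<and> J = j then 1 else 0))"
    unfolding sum_distrib_right by (intro sum.cong refl) auto
  then show ?thesis using assms by (simp only: sum_delta2)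
qed

text \<open>Every entry is expanded by polarization on both sides of the cut. Put
  \<open>N = a * b * (a' * b')\<close>. There are \<open>N^2\<close> entries with 16 pairs
  \<open>(k, l)\<close> each. A weight is at most \<open>\<delta> / 16\<close>, the squared modulus
  of each of the \<open>N\<close> entries of a product operator at most 16, so a term costs at most
  \<open>N * \<delta>\<close>.\<close>

lemma hermitian_sep_sum:
  assumes e: "hermitian_kernel (a * b) (a' * b') e"
    and small: "near (a * b) (a' * b') \<delta> (\<lambda>_ _ _ _. 0) e" and \<delta>: "0 < \<delta>"
  shows "sep_sum a b a' b' False e (16 * (real (a * b) * real (a' * b')) ^ 3 * \<delta>)"
proof -
  define D D' where "D = a * b" and "D' = a' * b'"
  define t where "t I J R C k l = polar_term b b' I J R C k l (e I J R C)" for I J R C k l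
  have cost: "term_cost a b a' b' (t I J R C k l) \<le> real D * real D' * \<delta>"
    if "I < D" "J < D" "R < D'" "C < D'" for I J R C k l
  proof -
    have "cmod (e I J R C) < \<delta>" using small that by (simp add: near_def D_def D'_def)
    then have w: "\<bar>Re (e I J R C * \<i> ^ k * \<i> ^ l) / 16\<bar> \<le> \<delta> / 16"
      using abs_Re_le_cmod[of "e I J R C * \<i> ^ k * \<i> ^ l"] by (simp add: norm_mult norm_power)
    have "(cmod (polar_op b b' I J R C k l r i))\<^sup>2 \<le> 16" for r i
    proof -
      have "cmod (polar_op b b' I J R C k l r i) \<le> 2 * 2"
        unfolding polar_op_def prod_op_def norm_mult by (intro mult_mono norm_polar) auto
      from power_mono[OF this, of 2] show ?thesis by simp
    qed
    then have "(\<Sum>i<D. \<Sum>r<D'. (cmod (polar_op b b' I J R C k l r i))\<^sup>2) \<le> (\<Sum>i<D. \<Sum>r<D'. 16)"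
      by (intro sum_mono)
    then have "term_cost a b a' b' (t I J R C k l) \<le> \<delta> / 16 * (\<Sum>i<D. \<Sum>r<D'. 16)"
      unfolding t_def polar_term_def term_cost.simps polar_op_def[symmetric] D_def D'_def using \<delta> w
      by (intro mult_mono sum_nonneg) auto
    then show ?thesis by (simp add: mult_ac)
  qed
  have "e i j r c = (\<Sum>I<D. \<Sum>J<D. \<Sum>R<D'. \<Sum>C<D'. \<Sum>k<4. \<Sum>l<4. term_kernel b b' (t I J R C k l) i j r c)"
    if "i < D" "j < D" "r < D'" "c < D'" for i j r c
  proof -
    define M where "M = polar_op b b'"
    define z where "z I J R C k l = e I J R C * \<i> ^ k * \<i> ^ l / 16" for I J R C k l
    \<comment> \<open>Doubling replaces the real part of a coefficient by the coefficient plus its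
      conjugate. The first half sums to the kernel, the second to its Hermitian conjugate, which is
      the kernel again.\<close>
    have "(\<Sum>I<D. \<Sum>J<D. \<Sum>R<D'. \<Sum>C<D'. \<Sum>k<4. \<Sum>l<4. 2 * term_kernel b b' (t I J R C k l) i j r c) =
       (\<Sum>I<D. \<Sum>J<D. \<Sum>R<D'. \<Sum>C<D'. \<Sum>k<4. \<Sum>l<4. z I J R C k l * (M I J R C k l r i * cnj (M I J R C k l c j))
         + cnj (z I J R C k l * (M I J R C k l c j * cnj (M I J R C k l r i))))"
    proof (intro sum.cong refl)
      fix I J R C k l
      have "2 * complex_of_real (Re (z I J R C k l)) = z I J R C k l + cnj (z I J R C k l)"
        by (simp add: complex_add_cnj)
      moreover have "Re (z I J R C k l) = Re (e I J R C * \<i> ^ k * \<i> ^ l) / 16"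
        by (simp add: z_def)
      ultimately show "2 * term_kernel b b' (t I J R C k l) i j r c =
          z I J R C k l * (M I J R C k l r i * cnj (M I J R C k l c j))
         + cnj (z I J R C k l * (M I J R C k l c j * cnj (M I J R C k l r i)))"
        unfolding t_def polar_term_def term_kernel.simps polar_op_def[symmetric] M_def[symmetric]
        by (simp add: distrib_right mult.assoc[symmetric])
    qed
    also have "\<dots> = (\<Sum>I<D. \<Sum>J<D. \<Sum>R<D'. \<Sum>C<D'. \<Sum>k<4. \<Sum>l<4. z I J R C k l * (M I J R C k l r i * cnj (M I J R C k l c j)))
       + cnj (\<Sum>I<D. \<Sum>J<D. \<Sum>R<D'. \<Sum>C<D'. \<Sum>k<4. \<Sum>l<4. z I J R C k l * (M I J R C k l c j * cnj (M I J R C k l r i)))"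
      by (simp only: sum.distrib cnj_sum)
    also have "\<dots> = e i j r c + cnj (e j i c r)"
      unfolding z_def M_def sum_polar_prod using that by (simp only: sum_delta4)
    also have "\<dots> = 2 * e i j r c"
      using hermitian_kernelD[OF e] that by (simp add: D_def D'_def)
    finally show ?thesis by (simp only: sum_distrib_left[symmetric]) simp
  qed
  then have eq: "kernel_eq D D' e
      (\<lambda>i j r c. \<Sum>I<D. \<Sum>J<D. \<Sum>R<D'. \<Sum>C<D'. \<Sum>k<4. \<Sum>l<4. term_kernel b b' (t I J R C k l) i j r c)"
    by (simp add: kernel_eq_def)
  have "sep_sum a b a' b' False
      (\<lambda>i j r c. \<Sum>I<D. \<Sum>J<D. \<Sum>R<D'. \<Sum>C<D'. \<Sum>k<4. \<Sum>l<4. term_kernel b b' (t I J R C k l) i j r c)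
      (\<Sum>I<D. \<Sum>J<D. \<Sum>R<D'. \<Sum>C<D'. \<Sum>k<(4::nat). \<Sum>l<(4::nat). real D * real D' * \<delta>)"
  proof (intro sep_sum_sum finite_lessThan)
    fix I J R C k l assume "I \<in> {..<D}" "J \<in> {..<D}" "R \<in> {..<D'}" "C \<in> {..<D'}"
    then show "sep_sum a b a' b' False (term_kernel b b' (t I J R C k l)) (real D * real D' * \<delta>)"
      unfolding t_def polar_term_def
      by (intro sep_sum_mono[OF sep_sum_single cost[of I J R C k l, unfolded t_def polar_term_def]]) auto
  qed
  moreover have "(\<Sum>I<D. \<Sum>J<D. \<Sum>R<D'. \<Sum>C<D'. \<Sum>k<(4::nat). \<Sum>l<(4::nat). real D * real D' * \<delta>) =
      16 * (real D * real D') ^ 3 * \<delta>"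
    by (simp add: power3_eq_cube)
  ultimately have "sep_sum a b a' b' False e (16 * (real D * real D') ^ 3 * \<delta>)"
    using sep_sum_cong[OF eq[unfolded D_def D'_def]] by (simp only: D_def D'_def)
  then show ?thesis by (simp only: D_def D'_def)
qed

lemma sep_sum_hermitian: "sep_sum a b a' b' pos e s \<Longrightarrow> hermitian_kernel (a * b) (a' * b') e"
proof -
  assume "sep_sum a b a' b' pos e s"
  then obtain ts where ts: "kernel_eq (a * b) (a' * b') e (terms_kernel b b' ts)" by (auto simp: sep_sum_def)
  have "term_kernel b b' t i j r c = cnj (term_kernel b b' t j i c r)" for t i j r c
    by (cases t) simp
  then have "terms_kernel b b' ts i j r c = cnj (terms_kernel b b' ts j i c r)" for i j r c
    unfolding terms_kernel_eq_sum cnj_sum by (intro sum.cong refl)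
  with ts show ?thesis unfolding hermitian_kernel_def kernel_eq_def by metis
qed

lemma sep_sum_add:
  assumes "sep_sum a b a' b' pos e s" "sep_sum a b a' b' pos f s'"
  shows "sep_sum a b a' b' pos (\<lambda>i j r c. e i j r c + f i j r c) (s + s')"
  using sep_sum_sum[of "{0, 1::nat}" a b a' b' pos "\<lambda>x. if x = 0 then e else f" "\<lambda>x. if x = 0 then s else s'"] assms
  by auto

lemma sep_cost_exact:
  assumes e: "hermitian_kernel (a * b) (a' * b') e" and cost: "sep_cost a b a' b' e s" and \<epsilon>: "0 < \<epsilon>"
  shows "sep_sum a b a' b' False e (s + \<epsilon>)"
proof -
  \<comment> \<open>\<open>C * \<delta>\<close> collects the excess \<open>\<delta>\<close> of the
    approximant and the cost of expanding the remainder \<open>e - f\<close>.\<close>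
  define C where "C = 16 * (real (a * b) * real (a' * b')) ^ 3 + 1"
  have C: "C \<ge> 1" by (simp add: C_def)
  define \<delta> where "\<delta> = \<epsilon> / (2 * C)"
  have \<delta>: "0 < \<delta>" "\<delta> \<le> \<epsilon> / 2" using \<epsilon> C by (auto simp: \<delta>_def field_simps)
  obtain f where f: "sep_sum a b a' b' False f (s + \<delta>)" "near (a * b) (a' * b') \<delta> e f"
    using cost \<delta>(1) unfolding sep_cost_def by metis
  have "hermitian_kernel (a * b) (a' * b') (\<lambda>i j r c. e i j r c - f i j r c)"
    using hermitian_kernelD[OF e] hermitian_kernelD[OF sep_sum_hermitian[OF f(1)]]
    by (subst hermitian_kernel_def) (simp add: kernel_eq_def)
  moreover have "near (a * b) (a' * b') \<delta> (\<lambda>_ _ _ _. 0) (\<lambda>i j r c. e i j r c - f i j r c)"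
    using f(2) by (simp add: near_def dist_norm norm_minus_commute)
  ultimately have "sep_sum a b a' b' False (\<lambda>i j r c. e i j r c - f i j r c) (16 * (real (a * b) * real (a' * b')) ^ 3 * \<delta>)"
    using \<delta>(1) by (rule hermitian_sep_sum)
  from sep_sum_add[OF f(1) this]
  have "sep_sum a b a' b' False e (s + \<delta> + 16 * (real (a * b) * real (a' * b')) ^ 3 * \<delta>)" by simp
  moreover have "\<delta> + 16 * (real (a * b) * real (a' * b')) ^ 3 * \<delta> = C * \<delta>"
    unfolding C_def by (simp only: distrib_right mult_1_left add.commute)
  moreover have "C * \<delta> = \<epsilon> / 2" using C by (simp add: \<delta>_def)
  ultimately show ?thesis using \<epsilon> by (elim sep_sum_mono) linarith
qed


section \<open>Decompositions of the Choi state\<close>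

lemma choi_state_index:
  assumes E: "linear_superop d d' E" and x: "x < d * d'" and y: "y < d * d'"
  shows "choi_state d d' E $$ (x, y) = ent d E (x div d') (y div d') (x mod d') (y mod d') / of_nat d"
proof -
  define X where "X = ketbra (max_entangled d) (max_entangled d)"
  have sq: "complex_of_real (1 / sqrt (real d)) * cnj (complex_of_real (1 / sqrt (real d))) = 1 / of_nat d"
    by (simp flip: of_real_mult add: of_real_divide)
  have "X $$ (p * d + k, q * d + l) = (if p = k \<and> q = l then 1 / of_nat d else 0)"
    if "p < d" "k < d" "q < d" "l < d" for p q k l
    using that prod_index_less[of p d k d] prod_index_less[of q d l d] sq
    by (auto simp: X_def ketbra_def max_entangled_def)
  from tensor_id_superop_index[OF E this x y] show ?thesis
    by (simp add: choi_state_def X_def)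
qed

lemma choi_state_carrier: "choi_state d d' E \<in> carrier_mat (d * d') (d * d')"
  by (simp add: choi_state_def tensor_superop_def)

text \<open>The index of \<open>|i\<^sub>1\<rangle>|r\<^sub>1\<rangle>|i\<^sub>2\<rangle>|r\<^sub>2\<rangle>\<close>, where \<open>i = (i\<^sub>1, i\<^sub>2)\<close> and \<open>r = (r\<^sub>1, r\<^sub>2)\<close>.\<close>

definition interleave :: "nat \<Rightarrow> nat \<Rightarrow> nat \<Rightarrow> nat \<Rightarrow> nat" where
  "interleave a b i r = ((i div b) * a + r div b) * (b * b) + ((i mod b) * b + r mod b)"

lemma interleave_less:
  assumes "i < a * b" "r < a * b"
  shows "interleave a b i r < (a * a) * (b * b)"
  unfolding interleave_def using assms by (intro prod_index_less) (auto simp: div_mod_less)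

lemma interleave_div_mod:
  assumes "i < a * b" "r < a * b"
  shows "interleave a b i r div (b * b) = (i div b) * a + r div b"
    "interleave a b i r mod (b * b) = (i mod b) * b + r mod b"
proof -
  have "(i mod b) * b + r mod b < b * b" using assms by (intro prod_index_less) (auto simp: div_mod_less)
  then show "interleave a b i r div (b * b) = (i div b) * a + r div b"
    "interleave a b i r mod (b * b) = (i mod b) * b + r mod b"
    by (simp_all add: interleave_def)
qed

section \<open>The permutation exchanging the two middle tensor factors\<close>

definition swap_middle :: "nat \<Rightarrow> nat \<Rightarrow> complex mat" where
  "swap_middle a b = 1\<^sub>m a \<otimes>\<^sub>k swap_mat a b \<otimes>\<^sub>k 1\<^sub>m b"

lemma swap_middle_carrier: "swap_middle a b \<in> carrier_mat ((a * b) * (a * b)) ((a * a) * (b * b))"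
  by (simp add: swap_middle_def kron_def swap_mat_def mult_ac)

text \<open>Rows are written in mixed radix with radices \<open>a, b, a, b\<close> and digits
  \<open>i1, i2, r1, r2\<close>, columns with radices \<open>a, a, b, b\<close> and digits
  \<open>y1, y2, y3, y4\<close>. The entry is 1 exactly if the digits agree after exchanging the
  middle two.\<close>

lemma swap_middle_index:
  assumes i: "i < a * b" and r: "r < a * b" and y: "y < (a * a) * (b * b)"
  shows "swap_middle a b $$ (i * (a * b) + r, y) = (if y = interleave a b i r then 1 else 0)"
proof -
  define y4 where "y4 = y mod b"
  define y3 where "y3 = y div b mod b"
  define y2 where "y2 = y div b div b mod a"
  define y1 where "y1 = y div b div b div a"
  have b: "0 < b" using i by (auto intro: gr0I)
  have a: "0 < a" using i by (auto intro: gr0I)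
  have y_eq: "y = y1 * (a * b * b) + ((y2 * b + y3) * b + y4)"
  proof -
    have "y = (y div b) * b + y4" by (simp add: y4_def)
    moreover have "y div b = (y div b div b) * b + y3" by (simp add: y3_def)
    moreover have "y div b div b = y1 * a + y2" by (simp add: y1_def y2_def)
    ultimately show ?thesis by (simp add: algebra_simps)
  qed
  have lt: "y4 < b" "y3 < b" "y2 < a" using a b by (simp_all add: y4_def y3_def y2_def)
  have y1: "y1 < a"
  proof -
    have "y div b div b div a = y div (a * b * b)" by (simp add: div_mult2_eq[symmetric] mult_ac)
    then show ?thesis using y unfolding y1_def by (simp add: less_mult_imp_div_less mult_ac)
  qed
  have lt2: "y2 * b + y3 < a * b" using lt by (intro prod_index_less)
  have lt3: "(y2 * b + y3) * b + y4 < a * b * b" using lt lt2 by (intro prod_index_less)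
  define i1 i2 r1 r2 where "i1 = i div b" and "i2 = i mod b" and "r1 = r div b" and "r2 = r mod b"
  have ir: "i1 < a" "i2 < b" "r1 < a" "r2 < b"
    using i r by (auto simp: i1_def i2_def r1_def r2_def div_mod_less)
  have x_eq: "i * (a * b) + r = i1 * (b * a * b) + ((i2 * a + r1) * b + r2)"
  proof -
    have "i = i1 * b + i2" "r = r1 * b + r2" by (simp_all add: i1_def i2_def r1_def r2_def)
    then show ?thesis by (simp add: algebra_simps)
  qed
  have ltx: "i2 * a + r1 < b * a" using ir by (intro prod_index_less)
  have ltx2: "(i2 * a + r1) * b + r2 < b * a * b" using ir ltx by (intro prod_index_less)
  have x: "i1 * (b * a * b) + ((i2 * a + r1) * b + r2) < a * (b * a * b)"
    using ir ltx2 by (intro prod_index_less)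
  have y': "y1 * (a * b * b) + ((y2 * b + y3) * b + y4) < a * (a * b * b)"
    using y1 lt3 by (rule prod_index_less)
  have S: "(swap_mat a b \<otimes>\<^sub>k 1\<^sub>m b) $$ ((i2 * a + r1) * b + r2, (y2 * b + y3) * b + y4) =
     (if i2 = y3 \<and> r1 = y2 \<and> r2 = y4 then 1 else 0)"
    using ir lt ltx ltx2 lt2 lt3 by (simp add: kron_def swap_mat_def)
  have "swap_middle a b $$ (i1 * (b * a * b) + ((i2 * a + r1) * b + r2), y1 * (a * b * b) + ((y2 * b + y3) * b + y4)) =
     (if i1 = y1 then 1 else 0) * (if i2 = y3 \<and> r1 = y2 \<and> r2 = y4 then 1 else 0)"
    using x y' ltx2 lt3 ir y1 S[unfolded kron_def]
    unfolding swap_middle_def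
    by (subst kron_def) (simp add: swap_mat_def kron_def)
  moreover have "y = interleave a b i r \<longleftrightarrow> i1 = y1 \<and> i2 = y3 \<and> r1 = y2 \<and> r2 = y4"
  proof
    assume "y = interleave a b i r"
    then have "y = (i1 * a + r1) * (b * b) + (i2 * b + r2)"
      by (simp add: interleave_def i1_def i2_def r1_def r2_def)
    then have y: "y = ((i1 * a + r1) * b + i2) * b + r2" by (simp add: algebra_simps)
    have "y div b = (i1 * a + r1) * b + i2" "y mod b = r2" unfolding y using ir by simp_all
    then show "i1 = y1 \<and> i2 = y3 \<and> r1 = y2 \<and> r2 = y4"
      using ir by (simp add: y1_def y2_def y3_def y4_def)
  next
    assume "i1 = y1 \<and> i2 = y3 \<and> r1 = y2 \<and> r2 = y4"
    then show "y = interleave a b i r"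
      unfolding y_eq interleave_def i1_def[symmetric] i2_def[symmetric] r1_def[symmetric] r2_def[symmetric]
      by (simp add: algebra_simps)
  qed
  ultimately show ?thesis using x_eq y_eq by auto
qed

lemma mat_adjoint_index:
  "r < dim_col A \<Longrightarrow> c < dim_row A \<Longrightarrow> mat_adjoint A $$ (r, c) = cnj (A $$ (c, r))"
  by (simp add: mat_adjoint_def mat_of_rows_def)

lemma mat_adjoint_dim [simp]: "dim_row (mat_adjoint A) = dim_col A" "dim_col (mat_adjoint A) = dim_row A"
  by (simp_all add: mat_adjoint_def mat_of_rows_def)

lemma conj_mat_index:
  assumes W: "W \<in> carrier_mat m n" and X: "X \<in> carrier_mat n n" and "r < m" "c < m"
  shows "(W * X * mat_adjoint W) $$ (r, c) = (\<Sum>p<n. \<Sum>q<n. X $$ (p, q) * (W $$ (r, p) * cnj (W $$ (c, q))))"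
proof -
  have "(W * X * mat_adjoint W) $$ (r, c) = (\<Sum>q<n. (\<Sum>p<n. W $$ (r, p) * X $$ (p, q)) * cnj (W $$ (c, q)))"
    using assms by (auto simp: scalar_prod_def lessThan_atLeast0 mat_adjoint_index intro!: sum.cong)
  also have "\<dots> = (\<Sum>q<n. \<Sum>p<n. X $$ (p, q) * (W $$ (r, p) * cnj (W $$ (c, q))))"
    by (simp add: sum_distrib_left sum_distrib_right mult_ac)
  also have "\<dots> = (\<Sum>p<n. \<Sum>q<n. X $$ (p, q) * (W $$ (r, p) * cnj (W $$ (c, q))))"
    by (rule sum.swap)
  finally show ?thesis .
qed

definition reorder :: "nat \<Rightarrow> nat \<Rightarrow> complex mat \<Rightarrow> complex mat" where
  "reorder a b \<sigma> = swap_middle a b * \<sigma> * mat_adjoint (swap_middle a b)"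

lemma SEP_ref_eq: "SEP_ref a b = reorder a b ` SEP (a * a) (b * b)"
  by (simp add: SEP_ref_def reorder_def swap_middle_def Let_def)

lemma reorder_carrier: "reorder a b \<sigma> \<in> carrier_mat ((a * b) * (a * b)) ((a * b) * (a * b))"
  unfolding reorder_def
  by (rule carrier_matI) (simp_all add: carrier_matD[OF swap_middle_carrier])

lemma reorder_index:
  assumes \<sigma>: "\<sigma> \<in> carrier_mat ((a * a) * (b * b)) ((a * a) * (b * b))"
    and x: "x < (a * b) * (a * b)" and y: "y < (a * b) * (a * b)"
  shows "reorder a b \<sigma> $$ (x, y) =
     \<sigma> $$ (interleave a b (x div (a * b)) (x mod (a * b)), interleave a b (y div (a * b)) (y mod (a * b)))"
proof -
  let ?i = "interleave a b (x div (a * b)) (x mod (a * b))" and ?j = "interleave a b (y div (a * b)) (y mod (a * b))"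
  have ij: "?i < (a * a) * (b * b)" "?j < (a * a) * (b * b)"
    using x y by (auto intro!: interleave_less simp: div_mod_less)
  have "reorder a b \<sigma> $$ (x, y) = (\<Sum>p<(a*a)*(b*b). \<Sum>q<(a*a)*(b*b). \<sigma> $$ (p, q) *
      (swap_middle a b $$ (x, p) * cnj (swap_middle a b $$ (y, q))))"
    unfolding reorder_def using conj_mat_index[OF swap_middle_carrier \<sigma> x y] .
  also have "\<dots> = (\<Sum>p<(a*a)*(b*b). \<Sum>q<(a*a)*(b*b). \<sigma> $$ (p, q) * (if p = ?i \<and> q = ?j then 1 else 0))"
  proof (intro sum.cong refl)
    fix p q assume "p \<in> {..<(a*a)*(b*b)}" "q \<in> {..<(a*a)*(b*b)}"
    then have "swap_middle a b $$ (x, p) = (if p = ?i then 1 else 0)"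
      "swap_middle a b $$ (y, q) = (if q = ?j then 1 else 0)"
      using swap_middle_index[of "x div (a * b)" a b "x mod (a * b)" p, unfolded div_mult_mod_eq]
        swap_middle_index[of "y div (a * b)" a b "y mod (a * b)" q, unfolded div_mult_mod_eq] x y
      by (simp_all add: div_mod_less)
    then show "\<sigma> $$ (p, q) * (swap_middle a b $$ (x, p) * cnj (swap_middle a b $$ (y, q))) =
        \<sigma> $$ (p, q) * (if p = ?i \<and> q = ?j then 1 else 0)" by simp
  qed
  also have "\<dots> = \<sigma> $$ (?i, ?j)" using ij by (rule sum_delta2)
  finally show ?thesis .
qed

section \<open>Product terms as multiples of separable states\<close>

definition pure_state :: "nat \<Rightarrow> (nat \<Rightarrow> complex) \<Rightarrow> complex mat" where
  "pure_state d v = mat d d (\<lambda>(p, q). v p * cnj (v q) / of_real (\<Sum>p<d. (cmod (v p))\<^sup>2))"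

lemma pure_state_states:
  assumes "(\<Sum>p<d. (cmod (v p))\<^sup>2) \<noteq> 0"
  shows "pure_state d v \<in> states d"
proof -
  define N where "N = (\<Sum>p<d. (cmod (v p))\<^sup>2)"
  have N: "0 < N" using assms by (simp add: N_def less_le sum_nonneg)
  have sN: "complex_of_real (sqrt N) * of_real (sqrt N) = of_real N"
    using N by (simp flip: of_real_mult)
  have "psd d (pure_state d v)" unfolding psd_Gram_iff
    by (intro conjI exI[of _ "1::nat"] exI[of _ "\<lambda>_ p. v p / of_real (sqrt N)"])
      (auto simp: pure_state_def sN N_def[symmetric])
  moreover have "mtrace (pure_state d v) = (\<Sum>p<d. of_real ((cmod (v p))\<^sup>2) / of_real N)"
    by (simp add: mtrace_def pure_state_def N_def[symmetric] flip: complex_norm_square of_real_power)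
  moreover have "\<dots> = of_real N / of_real N"
    unfolding sum_divide_distrib[symmetric] of_real_sum[symmetric] N_def ..
  ultimately show ?thesis using N by (simp add: states_def)
qed

lemma states_nonempty: "0 < d \<Longrightarrow> \<exists>\<rho>. \<rho> \<in> states d"
  using pure_state_states[where v = "\<lambda>_. 1" and d = d] by auto

lemma SEP_product:
  assumes "\<rho> \<in> states x" "\<sigma> \<in> states y"
  shows "\<rho> \<otimes>\<^sub>k \<sigma> \<in> SEP x y"
proof -
  have car: "\<rho> \<in> carrier_mat x x" "\<sigma> \<in> carrier_mat y y"
    using assms by (auto simp: states_def psd_def)
  then have "\<rho> \<otimes>\<^sub>k \<sigma> = mat (x * y) (x * y) (\<lambda>rc. \<Sum>i<(1::nat). complex_of_real 1 * (\<rho> \<otimes>\<^sub>k \<sigma>) $$ rc)"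
    by (auto intro!: eq_matI simp: kron_def)
  then show ?thesis unfolding SEP_def using assms
    by (intro CollectI exI[of _ "1::nat"] exI[of _ "\<lambda>_. 1"] exI[of _ "\<lambda>_. \<rho>"] exI[of _ "\<lambda>_. \<sigma>"]) auto
qed

lemma SEP_carrier: "\<sigma> \<in> SEP x y \<Longrightarrow> \<sigma> \<in> carrier_mat (x * y) (x * y)"
  by (auto simp: SEP_def)

lemma sum_prod_op_norm:
  "(\<Sum>i<a*b. \<Sum>r<a'*b'. (cmod (prod_op b b' K L r i))\<^sup>2) =
     (\<Sum>i<a. \<Sum>r<a'. (cmod (K r i))\<^sup>2) * (\<Sum>i<b. \<Sum>r<b'. (cmod (L r i))\<^sup>2)"
proof -
  have "(\<Sum>i<a*b. \<Sum>r<a'*b'. (cmod (prod_op b b' K L r i))\<^sup>2) =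
     (\<Sum>i<a. \<Sum>k<b. \<Sum>r<a'. \<Sum>s<b'. (cmod (K r i))\<^sup>2 * (cmod (L s k))\<^sup>2)"
    unfolding sum_prod_index by (intro sum.cong refl) (simp add: prod_op_def norm_mult power_mult_distrib)
  then show ?thesis by (simp only: sum_product)
qed

text \<open>Up to the factor \<open>w\<close>, the Choi operator of a term projects onto the product
  of the vectorisations of \<open>K\<close> and \<open>L\<close>. Normalising both factors gives
  pure states on \<open>A'A\<close> and \<open>B'B\<close>, and the norms move into the
  coefficient.\<close>

lemma product_term_state:
  assumes "0 < a" "0 < b"
  obtains \<sigma> where "\<sigma> \<in> SEP_ref a b"
    "\<And>x y. x < (a * b) * (a * b) \<Longrightarrow> y < (a * b) * (a * b) \<Longrightarrow>
      term_kernel b b (w, K, L) (x div (a * b)) (y div (a * b)) (x mod (a * b)) (y mod (a * b)) =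
        of_real (w * (\<Sum>i<a*b. \<Sum>r<a*b. (cmod (prod_op b b K L r i))\<^sup>2)) * \<sigma> $$ (x, y)"
proof -
  \<comment> \<open>The vectorisation of \<open>K\<close>: the reference (input) index is the high
    digit \<open>p div a\<close>, the output index the low digit \<open>p mod a\<close>.\<close>
  define v where "v p = K (p mod a) (p div a)" for p
  define u where "u p = L (p mod b) (p div b)" for p
  define N where "N = (\<Sum>p<a*a. (cmod (v p))\<^sup>2)"
  define M where "M = (\<Sum>p<b*b. (cmod (u p))\<^sup>2)"
  have NM: "(\<Sum>i<a*b. \<Sum>r<a*b. (cmod (prod_op b b K L r i))\<^sup>2) = N * M"
    unfolding sum_prod_op_norm N_def M_def by (simp add: sum_prod_index v_def u_def)
  show ?thesis
  proof (cases "N * M = 0")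
    case True
    \<comment> \<open>A vanishing product operator cannot be normalised. Its coefficient is 0, so
      any separable state will do, and one exists in positive dimensions.\<close>
    obtain \<rho> \<tau> where "\<rho> \<in> states (a * a)" "\<tau> \<in> states (b * b)"
      using assms states_nonempty by (metis nat_0_less_mult_iff)
    then have "reorder a b (\<rho> \<otimes>\<^sub>k \<tau>) \<in> SEP_ref a b"
      unfolding SEP_ref_eq by (intro imageI SEP_product)
    moreover have "(\<Sum>i<a*b. \<Sum>r<a*b. (cmod (prod_op b b K L r i))\<^sup>2) = 0"
      using True NM by simp
    then have "prod_op b b K L r i = 0" if "r < a * b" "i < a * b" for r i
      using that by (simp add: sum_nonneg_eq_0_iff sum_nonneg)
    ultimately show ?thesis
      using that True NM by (force simp: div_mod_less)
  next
    case False
    define \<tau> where "\<tau> = pure_state (a * a) v \<otimes>\<^sub>k pure_state (b * b) u"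
    have \<tau>: "\<tau> \<in> SEP (a * a) (b * b)"
      unfolding \<tau>_def using False by (intro SEP_product pure_state_states) (auto simp: N_def M_def)
    have idx: "\<tau> $$ (x, y) = v (x div (b*b)) * cnj (v (y div (b*b))) / of_real N * (u (x mod (b*b)) * cnj (u (y mod (b*b))) / of_real M)"
      if "x < (a*a)*(b*b)" "y < (a*a)*(b*b)" for x y
      using that by (simp add: \<tau>_def kron_def pure_state_def N_def M_def div_mod_less)
    have "term_kernel b b (w, K, L) (x div (a * b)) (y div (a * b)) (x mod (a * b)) (y mod (a * b)) =
        of_real (w * (N * M)) * reorder a b \<tau> $$ (x, y)"
      if x: "x < (a * b) * (a * b)" and y: "y < (a * b) * (a * b)" for x y
    proof -
      let ?i = "x div (a * b)" and ?j = "y div (a * b)" and ?r = "x mod (a * b)" and ?c = "y mod (a * b)"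
      have lt: "?i < a * b" "?j < a * b" "?r < a * b" "?c < a * b" using x y by (auto simp: div_mod_less)
      have lt': "?i mod b < b" "?j mod b < b" "?r mod b < b" "?c mod b < b" "?r div b < a" "?c div b < a"
        using lt by (auto simp: div_mod_less)
      have "reorder a b \<tau> $$ (x, y) = \<tau> $$ (interleave a b ?i ?r, interleave a b ?j ?c)"
        by (rule reorder_index[OF SEP_carrier[OF \<tau>] x y])
      also have "\<dots> = prod_op b b K L ?r ?i * cnj (prod_op b b K L ?c ?j) / of_real (N * M)"
        using lt lt' by (subst idx) (simp_all add: interleave_less interleave_div_mod v_def u_def prod_op_def)
      finally show ?thesis using False by simp
    qed
    then show ?thesis using that[of "reorder a b \<tau>"] \<tau> NM by (simp add: SEP_ref_eq)
  qed
qed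

section \<open>Bounds on the extent of the Choi state\<close>

lemma op_superop_decomposition:
  fixes k :: nat
  assumes J: "J \<in> carrier_mat n n" and \<sigma>: "\<And>x. x < k \<Longrightarrow> \<sigma> x \<in> carrier_mat n n"
    and eq: "\<And>r c. r < n \<Longrightarrow> c < n \<Longrightarrow> J $$ (r, c) = (\<Sum>x<k. of_real (\<alpha> x) * \<sigma> x $$ (r, c))"
  shows "superop_sum 1 n {..<k} (\<lambda>x X. complex_of_real (\<alpha> x) \<cdot>\<^sub>m op_superop (\<sigma> x) X) (op_superop J)"
  unfolding superop_sum_def
proof (intro ballI conjI allI impI)
  fix X :: "complex mat" and r c assume "r < n" "c < n"
  have "(\<Sum>x<k. (complex_of_real (\<alpha> x) \<cdot>\<^sub>m op_superop (\<sigma> x) X) $$ (r, c)) =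
      (\<Sum>x<k. X $$ (0, 0) * (of_real (\<alpha> x) * \<sigma> x $$ (r, c)))"
  proof (intro sum.cong refl)
    fix x assume "x \<in> {..<k}"
    then show "(complex_of_real (\<alpha> x) \<cdot>\<^sub>m op_superop (\<sigma> x) X) $$ (r, c) = X $$ (0, 0) * (of_real (\<alpha> x) * \<sigma> x $$ (r, c))"
      using \<sigma>[of x] \<open>r < n\<close> \<open>c < n\<close> by (auto simp: op_superop_def)
  qed
  also have "\<dots> = op_superop J X $$ (r, c)"
    using J \<open>r < n\<close> \<open>c < n\<close> by (auto simp: op_superop_def eq sum_distrib_left)
  finally show "((\<lambda>x. (complex_of_real (\<alpha> x) \<cdot>\<^sub>m op_superop (\<sigma> x) X) $$ (r, c)) has_sum op_superop J X $$ (r, c)) {..<k}"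
    by (simp add: has_sum_finiteI)
qed (use J in \<open>auto simp: op_superop_def\<close>)

lemma qp_extent_op_le:
  fixes k :: nat
  assumes "1 \<le> k" "J \<in> carrier_mat n n" "\<And>x. x < k \<Longrightarrow> \<sigma> x \<in> S" "\<And>\<tau>. \<tau> \<in> S \<Longrightarrow> \<tau> \<in> carrier_mat n n"
    and "\<And>r c. r < n \<Longrightarrow> c < n \<Longrightarrow> J $$ (r, c) = (\<Sum>x<k. of_real (\<alpha> x) * \<sigma> x $$ (r, c))"
  shows "qp_extent_op n S J \<le> ereal (\<Sum>x<k. \<bar>\<alpha> x\<bar>)"
  unfolding qp_extent_op_def qp_extent_def
proof (intro Inf_lower CollectI exI[of _ k] exI[of _ \<alpha>] exI[of _ "\<lambda>x. op_superop (\<sigma> x)"] conjI)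
  show "superop_sum 1 n {..<k} (\<lambda>x X. complex_of_real (\<alpha> x) \<cdot>\<^sub>m op_superop (\<sigma> x) X) (op_superop J)"
    using assms by (intro op_superop_decomposition) auto
qed (use assms in auto)

text \<open>The coefficient of each separable state has the cost of its term as absolute value. The
  division by \<open>a * b\<close> is the normalisation of the Choi state.\<close>

lemma sep_sum_imp_qp_extent_op_le:
  assumes ab: "0 < a" "0 < b" and V: "linear_superop (a * b) (a * b) V"
    and sep: "sep_sum a b a b False (ent (a * b) V) s"
  shows "qp_extent_op ((a * b) * (a * b)) (SEP_ref a b) (choi_state (a * b) (a * b) V) \<le> ereal (s / real (a * b))"
proof -
  define D where "D = a * b"
  have D: "0 < D" using ab by (simp add: D_def)
  obtain ts0 where ts0: "kernel_eq D D (ent D V) (terms_kernel b b ts0)" "(\<Sum>t\<leftarrow>ts0. term_cost a b a b t) \<le> s"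
    using sep by (auto simp: sep_sum_def D_def)
  \<comment> \<open>A zero term is put in front because the extent requires at least one
    summand.\<close>
  define ts where "ts = (0, \<lambda>_ _. 0, \<lambda>_ _. 0) # ts0"
  define k where "k = length ts"
  have "terms_kernel b b ts = terms_kernel b b ts0" by (intro ext) (simp add: terms_kernel_def ts_def)
  with ts0 have ts: "kernel_eq D D (ent D V) (terms_kernel b b ts)" "(\<Sum>t\<leftarrow>ts. term_cost a b a b t) \<le> s"
    by (simp_all add: ts_def)
  define \<nu> where "\<nu> t = (case t of (w, K, L) \<Rightarrow> w * (\<Sum>i<a*b. \<Sum>r<a*b. (cmod (prod_op b b K L r i))\<^sup>2))"
    for t :: sep_term
  have "\<exists>\<sigma>. \<sigma> \<in> SEP_ref a b \<and> (\<forall>x<D*D. \<forall>y<D*D.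
      term_kernel b b t (x div D) (y div D) (x mod D) (y mod D) = of_real (\<nu> t) * \<sigma> $$ (x, y))" for t
  proof -
    obtain w K L where t: "t = (w, K, L)" by (cases t)
    show ?thesis using product_term_state[OF ab, of w K L] unfolding t \<nu>_def D_def
      by (metis (no_types, lifting) case_prod_conv)
  qed
  then obtain \<sigma> where \<sigma>: "\<And>t. \<sigma> t \<in> SEP_ref a b"
    "\<And>t x y. x < D * D \<Longrightarrow> y < D * D \<Longrightarrow>
      term_kernel b b t (x div D) (y div D) (x mod D) (y mod D) = of_real (\<nu> t) * \<sigma> t $$ (x, y)"
    by metis
  have "qp_extent_op (D * D) (SEP_ref a b) (choi_state D D V) \<le> ereal (\<Sum>x<k. \<bar>\<nu> (ts ! x) / real D\<bar>)"
  proof (rule qp_extent_op_le)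
    show "1 \<le> k" by (simp add: k_def ts_def)
    show "\<tau> \<in> carrier_mat (D * D) (D * D)" if "\<tau> \<in> SEP_ref a b" for \<tau>
      using that reorder_carrier by (auto simp: SEP_ref_eq D_def)
    fix x y assume xy: "x < D * D" "y < D * D"
    then have "choi_state D D V $$ (x, y) = terms_kernel b b ts (x div D) (y div D) (x mod D) (y mod D) / of_nat D"
      using choi_state_index[of D D V x y] V ts(1) by (simp add: kernel_eq_def div_mod_less D_def)
    also have "\<dots> = (\<Sum>h<k. of_real (\<nu> (ts ! h) / real D) * \<sigma> (ts ! h) $$ (x, y))"
      unfolding terms_kernel_eq_sum sum_divide_distrib k_def
      by (intro sum.cong refl) (simp add: \<sigma>(2)[OF xy])
    finally show "choi_state D D V $$ (x, y) = (\<Sum>h<k. of_real (\<nu> (ts ! h) / real D) * \<sigma> (ts ! h) $$ (x, y))" .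
  qed (auto simp: choi_state_carrier \<sigma>)
  also have "(\<Sum>x<k. \<bar>\<nu> (ts ! x) / real D\<bar>) \<le> s / real D"
  proof -
    have "\<bar>\<nu> t\<bar> = term_cost a b a b t" for t
      by (cases t) (simp add: \<nu>_def abs_mult sum_nonneg)
    then have "(\<Sum>x<k. \<bar>\<nu> (ts ! x) / real D\<bar>) = (\<Sum>t\<leftarrow>ts. term_cost a b a b t) / real D"
      by (simp add: sum_divide_distrib sum_list_sum_nth lessThan_atLeast0 k_def)
    then show ?thesis using ts(2) D by (simp add: divide_right_mono)
  qed
  finally show ?thesis by (simp add: D_def)
qed

text \<open>Each \<open>F x\<close> costs at most \<open>a * b\<close>, which cancels against the
  normalisation of the Choi state. Only approximants of \<open>V\<close> are bounded at first, so an
  arbitrarily small excess is left over; it disappears because the extent is an infimum bounded by a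
  fixed number.\<close>

lemma LOCC_star_decomposition_bound:
  fixes k :: nat
  assumes ab: "0 < a" "0 < b" and V: "linear_superop (a * b) (a * b) V"
    and herm: "hermitian_kernel (a * b) (a * b) (ent (a * b) V)"
    and F: "\<And>x. x < k \<Longrightarrow> F x \<in> LOCC_star a b"
    and sum: "superop_sum (a * b) (a * b) {..<k} (\<lambda>x X. complex_of_real (\<alpha> x) \<cdot>\<^sub>m F x X) V"
  shows "qp_extent_op ((a * b) * (a * b)) (SEP_ref a b) (choi_state (a * b) (a * b) V) \<le> ereal (\<Sum>x<k. \<bar>\<alpha> x\<bar>)"
proof (rule ereal_le_epsilon2)
  define D where "D = a * b"
  have D: "0 < D" using ab by (simp add: D_def)
  have "sep_cost a b a b (\<lambda>i j r c. \<Sum>x<k. of_real (\<alpha> x) * ent D (F x) i j r c) (\<Sum>x<k. \<bar>\<alpha> x\<bar> * real D)"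
    using LOCC_star_sep_cost[OF F] by (intro sep_cost_sum finite_lessThan sep_cost_scale) (auto simp: D_def)
  moreover have "kernel_eq D D (ent D V) (\<lambda>i j r c. \<Sum>x<k. of_real (\<alpha> x) * ent D (F x) i j r c)"
    unfolding kernel_eq_def
  proof (intro allI impI)
    fix i j r c assume lt: "i < D" "j < D" "r < D" "c < D"
    have "F x (mat_unit D i j) \<in> carrier_mat D D" if "x < k" for x
      using F[OF that] by (auto simp: LOCC_star_def superop_sum_def D_def)
    from carrier_matD[OF this]
    have "ent D (\<lambda>X. complex_of_real (\<alpha> x) \<cdot>\<^sub>m F x X) i j r c = of_real (\<alpha> x) * ent D (F x) i j r c" if "x < k" for x
      using lt that by (simp add: ent_def)
    then have "(\<Sum>x<k. ent D (\<lambda>X. complex_of_real (\<alpha> x) \<cdot>\<^sub>m F x X) i j r c) = (\<Sum>x<k. of_real (\<alpha> x) * ent D (F x) i j r c)"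
      by simp
    moreover have "ent D V i j r c = (\<Sum>x<k. ent D (\<lambda>X. complex_of_real (\<alpha> x) \<cdot>\<^sub>m F x X) i j r c)"
      using lt by (intro has_sum_unique[OF superop_sum_ent[OF sum[folded D_def]] has_sum_finite]) auto
    ultimately show "ent D V i j r c = (\<Sum>x<k. of_real (\<alpha> x) * ent D (F x) i j r c)" by simp
  qed
  ultimately have cost: "sep_cost a b a b (ent D V) (real D * (\<Sum>x<k. \<bar>\<alpha> x\<bar>))"
    by (simp add: sep_cost_cong D_def sum_distrib_left mult.commute)
  fix \<epsilon> :: real assume "0 < \<epsilon>"
  then have "0 < real D * \<epsilon>" using D by simp
  then have "sep_sum a b a b False (ent D V) (real D * (\<Sum>x<k. \<bar>\<alpha> x\<bar>) + real D * \<epsilon>)"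
    using sep_cost_exact[of a b a b "ent D V"] cost herm by (simp add: D_def)
  from sep_sum_imp_qp_extent_op_le[OF ab V this[unfolded D_def]]
  show "qp_extent_op ((a * b) * (a * b)) (SEP_ref a b) (choi_state (a * b) (a * b) V) \<le> ereal (\<Sum>x<k. \<bar>\<alpha> x\<bar>) + ereal \<epsilon>"
    using ab by (simp add: distrib_left[symmetric] add_divide_distrib del: of_nat_mult)
qed


section \<open>Two-round LOCC protocols\<close>

lemma cp_kernel_comp:
  assumes "cp_kernel d m e" "cp_kernel m d' f"
  shows "cp_kernel d d' (comp_kernel m e f)"
proof -
  obtain n :: nat and K where K: "kernel_eq d m e (\<lambda>i j r c. \<Sum>k<n. K k r i * cnj (K k c j))"
    using assms(1) by (auto simp: cp_kernel_def)
  obtain h :: nat and L where L: "kernel_eq m d' f (\<lambda>i j r c. \<Sum>k<h. L k r i * cnj (L k c j))"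
    using assms(2) by (auto simp: cp_kernel_def)
  have "kernel_eq d d' (comp_kernel m e f) (\<lambda>i j r c. \<Sum>k<n*h.
      (\<Sum>p<m. K (k div h) p i * L (k mod h) r p) * cnj (\<Sum>q<m. K (k div h) q j * L (k mod h) c q))"
    unfolding kernel_eq_def
  proof (intro allI impI)
    fix i j r c assume ij: "i < d" "j < d" "r < d'" "c < d'"
    then have "comp_kernel m e f i j r c = (\<Sum>p<m. \<Sum>q<m. e i j p q * (\<Sum>l<h. L l r p * cnj (L l c q)))"
      using L by (simp add: comp_kernel_def kernel_eq_def)
    also have "\<dots> = (\<Sum>k<n*h.
      (\<Sum>p<m. K (k div h) p i * L (k mod h) r p) * cnj (\<Sum>q<m. K (k div h) q j * L (k mod h) c q))"
      by (rule sum_Gram_product) (use K ij in \<open>simp add: kernel_eq_def\<close>)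
    finally show "comp_kernel m e f i j r c = (\<Sum>k<n*h.
      (\<Sum>p<m. K (k div h) p i * L (k mod h) r p) * cnj (\<Sum>q<m. K (k div h) q j * L (k mod h) c q))" .
  qed
  then show ?thesis unfolding cp_kernel_def
    by (intro exI[of _ "n * h"] exI[of _ "\<lambda>k r i. \<Sum>p<m. K (k div h) p i * L (k mod h) r p"])
qed

text \<open>A nonnegative weight is absorbed into the Kraus operator as \<open>sqrt w\<close>.
  Complete positivity of tensor products, and of a whole protocol, is thus obtained from their
  separable form.\<close>

lemma sep_sum_imp_cp_kernel:
  assumes "sep_sum a b a' b' True e s"
  shows "cp_kernel (a * b) (a' * b') e"
proof -
  obtain ts where ts: "\<forall>t\<in>set ts. 0 \<le> fst t" "kernel_eq (a * b) (a' * b') e (terms_kernel b b' ts)"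
    using assms by (auto simp: sep_sum_def)
  define M where "M t = (case t of (w, K, L) \<Rightarrow> \<lambda>r i. of_real (sqrt w) * prod_op b b' K L r i)" for t :: sep_term
  have "term_kernel b b' t i j r c = M t r i * cnj (M t c j)" if "0 \<le> fst t" for t i j r c
  proof -
    obtain w K L where t: "t = (w, K, L)" by (cases t)
    have "complex_of_real w = of_real (sqrt w) * of_real (sqrt w)"
      using that by (simp add: t flip: of_real_mult)
    then show ?thesis by (simp add: t M_def)
  qed
  then have "terms_kernel b b' ts i j r c = (\<Sum>k<length ts. M (ts ! k) r i * cnj (M (ts ! k) c j))" for i j r c
    unfolding terms_kernel_eq_sum using ts(1) by (intro sum.cong refl) simp
  then show ?thesis unfolding cp_kernel_def using ts(2)
    by (intro exI[of _ "length ts"] exI[of _ "\<lambda>k. M (ts ! k)"]) (simp add: kernel_eq_def)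
qed

lemma cp_kernel_tensor:
  "cp_kernel a a' e \<Longrightarrow> cp_kernel b b' f \<Longrightarrow> cp_kernel (a * b) (a' * b') (tensor_kernel b b' e f)"
  using sep_sum_tensor sep_sum_imp_cp_kernel by blast

lemma cp_kernel_conj: "cp_kernel d d' (\<lambda>i j r c. K r i * cnj (K c j))"
  unfolding cp_kernel_def by (intro exI[of _ "1::nat"] exI[of _ "\<lambda>_. K"]) (simp add: kernel_eq_def)

lemma cp_kernel_id: "cp_kernel d d id_kernel"
proof -
  have "id_kernel = (\<lambda>i j r c. (if r = i then 1 else 0) * cnj (if c = j then 1 else 0))"
    by (intro ext) (simp add: id_kernel_def)
  then show ?thesis using cp_kernel_conj[where K = "\<lambda>r i. if r = i then 1 else 0"] by simp
qed

lemma tp_kernel_id: "tp_kernel d d id_kernel"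
proof -
  have "(\<Sum>r<d. id_kernel i j r r) = (\<Sum>r<d. if r = i then (if i = j then 1 else 0) else 0)" for i j
    by (intro sum.cong) (auto simp: id_kernel_def)
  then show ?thesis by (simp add: tp_kernel_def)
qed

section \<open>Channels and instruments given by kernels\<close>

lemma completely_positive_kernel_map:
  "cp_kernel d d' e \<Longrightarrow> completely_positive d d' (kernel_map d d' e)"
  by (auto simp: completely_positive_iff linear_superop_kernel_map cp_kernel_def kernel_eq_def)

lemma trace_preserving_kernel_map:
  "tp_kernel d d' e \<Longrightarrow> trace_preserving d (kernel_map d d' e)"
  by (simp add: trace_preserving_iff[OF linear_superop_kernel_map] tp_kernel_def)

lemma cptp_kernel_map:
  "cp_kernel d d' e \<Longrightarrow> tp_kernel d d' e \<Longrightarrow> cptp d d' (kernel_map d d' e)"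
  by (simp add: cptp_def completely_positive_kernel_map trace_preserving_kernel_map)

lemma superop_sum_kernel_map:
  assumes "finite I" "\<And>x X. x \<in> I \<Longrightarrow> X \<in> carrier_mat d d \<Longrightarrow> E x X = kernel_map d d' (e x) X"
    and "kernel_eq d d' f (kernel_sum I e)"
  shows "superop_sum d d' I E (kernel_map d d' f)"
  unfolding superop_sum_def
proof (intro ballI conjI allI impI)
  fix X :: "complex mat" and r c assume X: "X \<in> carrier_mat d d" and rc: "r < d'" "c < d'"
  have "(\<Sum>x\<in>I. E x X $$ (r, c)) = (\<Sum>x\<in>I. \<Sum>i<d. \<Sum>j<d. X $$ (i, j) * e x i j r c)"
    using assms(2) X rc by (intro sum.cong refl) simp
  also have "\<dots> = (\<Sum>i<d. \<Sum>j<d. \<Sum>x\<in>I. X $$ (i, j) * e x i j r c)" by (rule sum_swap3[symmetric])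
  also have "\<dots> = kernel_map d d' f X $$ (r, c)"
    using assms(3) rc by (auto simp: kernel_eq_def sum_distrib_left intro!: sum.cong)
  finally show "((\<lambda>x. E x X $$ (r, c)) has_sum kernel_map d d' f X $$ (r, c)) I"
    by (simp add: has_sum_finiteI[OF assms(1)])
qed simp

text \<open>Outcomes of an instrument must be nonzero. A nonzero trace yields a nonzero diagonal
  entry of the kernel, hence a matrix unit on which the map does not vanish.\<close>

lemma kernel_instrument:
  assumes "finite I" "\<And>x. x \<in> I \<Longrightarrow> cp_kernel d d' (e x)" "\<And>x. x \<in> I \<Longrightarrow> kernel_trace d d' (e x) \<noteq> 0"
    and "tp_kernel d d' (kernel_sum I e)"
  shows "instrument d d' I (\<lambda>x. kernel_map d d' (e x))"
  unfolding instrument_def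
proof (intro conjI ballI)
  fix x assume x: "x \<in> I"
  then show "completely_positive d d' (kernel_map d d' (e x))"
    using assms(2) by (intro completely_positive_kernel_map)
  have "\<exists>i<d. \<exists>r<d'. e x i i r r \<noteq> 0"
  proof (rule ccontr)
    assume "\<not> ?thesis"
    then have "kernel_trace d d' (e x) = 0" by (simp add: kernel_trace_def)
    then show False using assms(3)[OF x] by simp
  qed
  then obtain i r where ir: "i < d" "r < d'" "e x i i r r \<noteq> 0" by blast
  have "kernel_map d d' (e x) (mat_unit d i i) $$ (r, r) = e x i i r r"
    using ent_kernel_map[of i d i r d' r "e x"] ir by (simp only: ent_def)
  then have "kernel_map d d' (e x) (mat_unit d i i) \<noteq> 0\<^sub>m d' d'"
    using ir by (metis index_zero_mat(1))
  then show "\<exists>X\<in>carrier_mat d d. kernel_map d d' (e x) X \<noteq> 0\<^sub>m d' d'"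
    using mat_unit_carrier by blast
next
  show "\<exists>F. superop_sum d d' I (\<lambda>x. kernel_map d d' (e x)) F \<and> trace_preserving d F"
    using assms(1,4) by (intro exI[of _ "kernel_map d d' (kernel_sum I e)"] conjI
        superop_sum_kernel_map trace_preserving_kernel_map) (auto simp: kernel_eq_def)
qed

lemma kernel_map_comp:
  "kernel_map m d' f (kernel_map d m e X) = kernel_map d d' (comp_kernel m e f) X"
proof (rule eq_matI)
  fix r c assume "r < dim_row (kernel_map d d' (comp_kernel m e f) X)" "c < dim_col (kernel_map d d' (comp_kernel m e f) X)"
  then have rc: "r < d'" "c < d'" by simp_all
  have "kernel_map m d' f (kernel_map d m e X) $$ (r, c) =
     (\<Sum>p<m. \<Sum>q<m. \<Sum>i<d. \<Sum>j<d. X $$ (i, j) * (e i j p q * f p q r c))"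
    using rc by (simp add: sum_distrib_right mult.assoc)
  also have "\<dots> = (\<Sum>i<d. \<Sum>j<d. \<Sum>p<m. \<Sum>q<m. X $$ (i, j) * (e i j p q * f p q r c))"
    by (rule sum_swap4)
  also have "\<dots> = kernel_map d d' (comp_kernel m e f) X $$ (r, c)"
    using rc by (simp add: comp_kernel_def sum_distrib_left)
  finally show "kernel_map m d' f (kernel_map d m e X) $$ (r, c) = kernel_map d d' (comp_kernel m e f) X $$ (r, c)" .
qed simp_all

lemma tensor_superop_kernel_map:
  "tensor_superop a b a' b' (kernel_map a a' e) (kernel_map b b' f) X =
     kernel_map (a * b) (a' * b') (tensor_kernel b b' e f) X"
proof -
  have "tensor_superop a b a' b' (kernel_map a a' e) (kernel_map b b' f) X =
     kernel_map (a * b) (a' * b') (tensor_kernel b b' (ent a (kernel_map a a' e)) (ent b (kernel_map b b' f))) X"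
    by (intro tensor_superop_eq_kernel_map) simp_all
  also have "\<dots> = kernel_map (a * b) (a' * b') (tensor_kernel b b' e f) X"
    by (intro kernel_map_cong) (simp add: kernel_eq_def tensor_kernel_def div_mod_less)
  finally show ?thesis .
qed

lemma comp_tensor_kernel:
  "comp_kernel (c * d) (tensor_kernel b d e f) (tensor_kernel d b' e' f') i j r k =
     tensor_kernel b b' (comp_kernel c e e') (comp_kernel d f f') i j r k"
proof -
  have "comp_kernel (c * d) (tensor_kernel b d e f) (tensor_kernel d b' e' f') i j r k =
     (\<Sum>p<c. \<Sum>p'<d. \<Sum>q<c. \<Sum>q'<d. (e (i div b) (j div b) p q * e' p q (r div b') (k div b')) *
         (f (i mod b) (j mod b) p' q' * f' p' q' (r mod b') (k mod b')))"
    unfolding comp_kernel_def sum_prod_index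
    by (intro sum.cong refl) (simp add: tensor_kernel_def mult_ac)
  also have "\<dots> = (\<Sum>p<c. \<Sum>q<c. \<Sum>p'<d. \<Sum>q'<d. (e (i div b) (j div b) p q * e' p q (r div b') (k div b')) *
         (f (i mod b) (j mod b) p' q' * f' p' q' (r mod b') (k mod b')))"
    by (intro sum.cong refl sum.swap)
  also have "\<dots> = tensor_kernel b b' (comp_kernel c e e') (comp_kernel d f f') i j r k"
    unfolding tensor_kernel_def comp_kernel_def sum_distrib_right by (simp only: sum_distrib_left)
  finally show ?thesis .
qed

lemma comp_id_kernel_left:
  assumes "i < m" "j < m"
  shows "comp_kernel m id_kernel f i j r c = f i j r c"
proof -
  have "comp_kernel m id_kernel f i j r c = (\<Sum>p<m. \<Sum>q<m. f p q r c * (if p = i \<and> q = j then 1 else 0))"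
    unfolding comp_kernel_def id_kernel_def by (intro sum.cong refl) simp
  then show ?thesis using assms by (simp only: sum_delta2)
qed

lemma comp_id_kernel_right:
  assumes "r < m" "c < m"
  shows "comp_kernel m e id_kernel i j r c = e i j r c"
proof -
  have "comp_kernel m e id_kernel i j r c = (\<Sum>p<m. \<Sum>q<m. e i j p q * (if p = r \<and> q = c then 1 else 0))"
    unfolding comp_kernel_def id_kernel_def by (intro sum.cong refl) auto
  then show ?thesis using assms by (simp only: sum_delta2)
qed

lemma trace_comp_kernel:
  assumes "tp_kernel m d' f"
  shows "(\<Sum>r<d'. comp_kernel m e f i j r r) = (\<Sum>p<m. e i j p p)"
proof -
  have "(\<Sum>r<d'. comp_kernel m e f i j r r) = (\<Sum>p<m. \<Sum>q<m. \<Sum>r<d'. e i j p q * f p q r r)"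
    unfolding comp_kernel_def by (rule sum_swap3[symmetric])
  also have "\<dots> = (\<Sum>p<m. \<Sum>q<m. if p = q then e i j p q else 0)"
    using assms by (intro sum.cong refl) (simp add: tp_kernel_def flip: sum_distrib_left)
  finally show ?thesis by simp
qed

lemma trace_tensor_kernel:
  "(\<Sum>r<a'*b'. tensor_kernel b b' e f i j r r) =
     (\<Sum>r<a'. e (i div b) (j div b) r r) * (\<Sum>r<b'. f (i mod b) (j mod b) r r)"
  by (simp add: tensor_kernel_def sum_product
      sum_lessThan_mult[of "\<lambda>r s. e (i div b) (j div b) r r * f (i mod b) (j mod b) s s"])

lemma tp_kernel_tensor:
  assumes "tp_kernel a a' e" "tp_kernel b b' f"
  shows "tp_kernel (a * b) (a' * b') (tensor_kernel b b' e f)"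
  unfolding tp_kernel_def trace_tensor_kernel
proof (intro allI impI)
  fix i j assume "i < a * b" "j < a * b"
  then show "(\<Sum>r<a'. e (i div b) (j div b) r r) * (\<Sum>r<b'. f (i mod b) (j mod b) r r) = (if i = j then 1 else 0)"
    using assms by (simp add: tp_kernel_def div_mod_less eq_iff_div_mod[of i j b])
qed

lemma tp_kernel_comp_sum:
  assumes "tp_kernel d m (kernel_sum A e)" "\<And>x. x \<in> A \<Longrightarrow> tp_kernel m d' (f x)"
  shows "tp_kernel d d' (\<lambda>i j r c. \<Sum>x\<in>A. comp_kernel m (e x) (f x) i j r c)"
proof -
  have "(\<Sum>r<d'. \<Sum>x\<in>A. comp_kernel m (e x) (f x) i j r r) = (\<Sum>p<m. \<Sum>x\<in>A. e x i j p p)" for i j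
    by (subst (1 2) sum.swap) (simp add: trace_comp_kernel assms(2))
  then show ?thesis using assms(1) by (simp add: tp_kernel_def)
qed

text \<open>The structure of one round: one party's channel may depend on the outcome, but preserves
  the trace for each of them, while the other party's measurement does so only after
  summation.\<close>

lemma tp_kernel_tensor_sum:
  assumes "\<And>x. x \<in> A \<Longrightarrow> tp_kernel a a' (e x)" "tp_kernel b b' (kernel_sum A f)"
  shows "tp_kernel (a * b) (a' * b') (\<lambda>i j r c. \<Sum>x\<in>A. tensor_kernel b b' (e x) (f x) i j r c)"
  unfolding tp_kernel_def
proof (intro allI impI)
  fix i j assume ij: "i < a * b" "j < a * b"
  have "(\<Sum>r<a'*b'. \<Sum>x\<in>A. tensor_kernel b b' (e x) (f x) i j r r) =
      (\<Sum>x\<in>A. (\<Sum>r<a'. e x (i div b) (j div b) r r) * (\<Sum>r<b'. f x (i mod b) (j mod b) r r))"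
    by (subst sum.swap) (simp only: trace_tensor_kernel)
  also have "\<dots> = (if i div b = j div b then 1 else 0) * (\<Sum>x\<in>A. \<Sum>r<b'. f x (i mod b) (j mod b) r r)"
    unfolding sum_distrib_left using assms(1) ij by (intro sum.cong refl) (simp add: tp_kernel_def div_mod_less)
  also have "(\<Sum>x\<in>A. \<Sum>r<b'. f x (i mod b) (j mod b) r r) = (if i mod b = j mod b then 1 else 0)"
    using assms(2) ij by (subst sum.swap) (simp add: tp_kernel_def div_mod_less)
  finally show "(\<Sum>r<a'*b'. \<Sum>x\<in>A. tensor_kernel b b' (e x) (f x) i j r r) = (if i = j then 1 else 0)"
    by (simp add: eq_iff_div_mod[of i j b])
qed

lemma comp_kernel_sum_right:
  "comp_kernel m e (\<lambda>i j r c. \<Sum>y\<in>Y. x y * f y i j r c) i j r c = (\<Sum>y\<in>Y. x y * comp_kernel m e (f y) i j r c)"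
proof -
  have "comp_kernel m e (\<lambda>i j r c. \<Sum>y\<in>Y. x y * f y i j r c) i j r c =
      (\<Sum>p<m. \<Sum>q<m. \<Sum>y\<in>Y. x y * (e i j p q * f y p q r c))"
    by (simp add: comp_kernel_def sum_distrib_left mult_ac)
  also have "\<dots> = (\<Sum>y\<in>Y. \<Sum>p<m. \<Sum>q<m. x y * (e i j p q * f y p q r c))"
    by (rule sum_swap3)
  finally show ?thesis by (simp add: comp_kernel_def sum_distrib_left)
qed

lemma kernel_trace_tensor_tp:
  assumes "tp_kernel b b' f"
  shows "kernel_trace (a * b) (a' * b') (tensor_kernel b b' e f) = kernel_trace a a' e * real b"
proof -
  have "(\<Sum>i<a*b. \<Sum>r<a'*b'. tensor_kernel b b' e f i i r r) =
     (\<Sum>i<a. \<Sum>k<b. (\<Sum>r<a'. e i i r r) * (\<Sum>r<b'. f k k r r))"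
    unfolding trace_tensor_kernel
    using sum_lessThan_mult[of "\<lambda>i k. (\<Sum>r<a'. e i i r r) * (\<Sum>r<b'. f k k r r)" b a] by simp
  also have "\<dots> = (\<Sum>i<a. \<Sum>r<a'. e i i r r) * of_nat b"
    using assms by (simp add: tp_kernel_def sum_distrib_left mult.commute)
  finally show ?thesis by (simp add: kernel_trace_def)
qed

lemma tp_kernel_trace: "tp_kernel d d' e \<Longrightarrow> kernel_trace d d' e = real d"
  by (simp add: tp_kernel_def kernel_trace_def)

text \<open>Nothing is merged. The map of each outcome is exchanged for a kernel map that agrees
  with it on matrices of the right size.\<close>

lemma coarse_graining_self:
  assumes "\<And>k X. k \<in> K \<Longrightarrow> X \<in> carrier_mat d d \<Longrightarrow> E k X = kernel_map d d' (e k) X"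
  shows "coarse_graining d d' K E K (\<lambda>k. kernel_map d d' (e k))"
  unfolding coarse_graining_def
proof (intro exI[of _ id] conjI ballI)
  fix k assume "k \<in> K"
  then have "{i \<in> K. id i = k} = {k}" by auto
  then show "superop_sum d d' {i \<in> K. id i = k} E (kernel_map d d' (e k))"
    using assms[OF \<open>k \<in> K\<close>] by (auto intro!: superop_sum_kernel_map[where e = e] simp: kernel_eq_def)
qed simp

text \<open>The measurement \<open>e\<close> of Alice is the first round. The second is one-way
  local with respect to Bob: his measurement \<open>f\<close> depends on her outcome, and she
  answers his with the channel \<open>u\<close>. All outcomes of the second round are then merged
  into the single label 0.\<close>

lemma two_round_LOCC:
  fixes A :: "nat set" and B :: "nat \<Rightarrow> nat set"
  assumes a: "0 < a" and b: "0 < b" and fin: "finite A" "\<And>P. P \<in> A \<Longrightarrow> finite (B P)"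
    and e: "\<And>P. P \<in> A \<Longrightarrow> cp_kernel a a (e P)" "\<And>P. P \<in> A \<Longrightarrow> kernel_trace a a (e P) \<noteq> 0"
      "tp_kernel a a (kernel_sum A e)"
    and f: "\<And>P Q. P \<in> A \<Longrightarrow> Q \<in> B P \<Longrightarrow> cp_kernel b b (f P Q)"
      "\<And>P Q. P \<in> A \<Longrightarrow> Q \<in> B P \<Longrightarrow> kernel_trace b b (f P Q) \<noteq> 0"
      "\<And>P. P \<in> A \<Longrightarrow> tp_kernel b b (\<lambda>i j r c. \<Sum>Q\<in>B P. f P Q i j r c)"
    and u: "\<And>P Q. P \<in> A \<Longrightarrow> Q \<in> B P \<Longrightarrow> cp_kernel a a (u P Q)"
      "\<And>P Q. P \<in> A \<Longrightarrow> Q \<in> B P \<Longrightarrow> tp_kernel a a (u P Q)"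
  shows "kernel_map (a * b) (a * b)
     (\<lambda>i j r c. \<Sum>P\<in>A. \<Sum>Q\<in>B P. tensor_kernel b b (comp_kernel a (e P) (u P Q)) (f P Q) i j r c) \<in> LOCC a b"
proof -
  define D where "D = a * b"
  have D: "0 < D" using a b by (simp add: D_def)
  define g where "g P Q = tensor_kernel b b (comp_kernel a (e P) (u P Q)) (f P Q)" for P Q
  define h where "h i j r c = (\<Sum>P\<in>A. \<Sum>Q\<in>B P. g P Q i j r c)" for i j r c
  define H where "H = kernel_map D D h"
  have h_cp: "cp_kernel D D h"
  proof -
    have "\<forall>P\<in>A. \<forall>Q\<in>B P. \<exists>s. sep_sum a b a b True (g P Q) s"
      unfolding g_def using e(1) f(1) u(1) by (intro ballI sep_sum_tensor cp_kernel_comp) auto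
    then obtain s where "\<And>P Q. P \<in> A \<Longrightarrow> Q \<in> B P \<Longrightarrow> sep_sum a b a b True (g P Q) (s P Q)"
      by metis
    then have "sep_sum a b a b True h (\<Sum>P\<in>A. \<Sum>Q\<in>B P. s P Q)"
      unfolding h_def using fin by (intro sep_sum_sum) auto
    then show ?thesis unfolding D_def by (rule sep_sum_imp_cp_kernel)
  qed
  \<comment> \<open>The first round on the joint system, with Bob idle.\<close>
  define e' where "e' P = tensor_kernel b b (e P) id_kernel" for P
  have e'_tp: "tp_kernel D D (kernel_sum A e')"
  proof -
    have "(kernel_sum A e') = tensor_kernel b b (kernel_sum A e) id_kernel"
      by (intro ext) (simp add: e'_def tensor_kernel_def sum_distrib_right)
    then show ?thesis unfolding D_def using tp_kernel_tensor[OF e(3) tp_kernel_id] by simp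
  qed
  have g: "comp_kernel D (e' P) (tensor_kernel b b (u P Q) (f P Q)) i j r c = g P Q i j r c"
    if "i < D" "j < D" for P Q i j r c
    using that unfolding D_def e'_def comp_tensor_kernel
    by (simp add: tensor_kernel_def g_def comp_id_kernel_left div_mod_less)
  have h_tp: "tp_kernel D D h"
  proof -
    have "tp_kernel D D (\<lambda>i j r c. \<Sum>P\<in>A. comp_kernel D (e' P)
        (\<lambda>i j r c. \<Sum>Q\<in>B P. tensor_kernel b b (u P Q) (f P Q) i j r c) i j r c)"
      by (intro tp_kernel_comp_sum[OF e'_tp], unfold D_def, intro tp_kernel_tensor_sum u(2) f(3))
    then show ?thesis
      by (simp add: tp_kernel_def h_def g comp_kernel_sum_right[where x = "\<lambda>_. 1", simplified])
  qed
  have H_instr: "instrument D D {0} (\<lambda>_. H)"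
    unfolding H_def using h_cp h_tp tp_kernel_trace[OF h_tp] D
    by (intro kernel_instrument) (auto simp: tp_kernel_def)
  define G where "G P = kernel_map D D (e' P)" for P
  have G_instr: "instrument D D A G"
    unfolding G_def
  proof (rule kernel_instrument[OF fin(1)])
    fix P assume "P \<in> A"
    then show "cp_kernel D D (e' P)" unfolding e'_def D_def by (intro cp_kernel_tensor e(1) cp_kernel_id)
    show "kernel_trace D D (e' P) \<noteq> 0"
      unfolding e'_def D_def kernel_trace_tensor_tp[OF tp_kernel_id] using e(2)[OF \<open>P \<in> A\<close>] b by simp
  next
    show "tp_kernel D D (kernel_sum A e')" by (rule e'_tp)
  qed
  have round1: "locc_rounds a b a b 1 A G"
  proof (rule locc_rounds.one)
    let ?E = "\<lambda>P. tensor_superop a b a b (kernel_map a a (e P)) (kernel_map b b id_kernel)"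
    have "one_way_local_fst a b a b A ?E"
      unfolding one_way_local_fst_def
      using kernel_instrument[OF fin(1) e] cptp_kernel_map[OF cp_kernel_id tp_kernel_id]
      by (intro exI[of _ "\<lambda>P. kernel_map a a (e P)"] exI[of _ "\<lambda>_. kernel_map b b id_kernel"]) auto
    then show "one_way_local a b a b A ?E" by (simp add: one_way_local_def)
    show "instrument (a * b) (a * b) A G" using G_instr by (simp add: D_def)
    show "coarse_graining (a * b) (a * b) A ?E A G"
      unfolding G_def D_def by (intro coarse_graining_self) (simp add: tensor_superop_kernel_map e'_def)
  qed
  \<comment> \<open>Merging everything into the label 0 is a relabelling onto \<open>{0}\<close>, so
    there has to be some outcome. A sum over no outcomes could not preserve the trace in positive
    dimension.\<close>
  have A: "A \<noteq> {}"
  proof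
    assume "A = {}"
    then show False using e(3)[unfolded tp_kernel_def, rule_format, of 0 0] a by simp
  qed
  have B: "B P \<noteq> {}" if "P \<in> A" for P
  proof
    assume "B P = {}"
    then show False using f(3)[OF that, unfolded tp_kernel_def, rule_format, of 0 0] b by simp
  qed
  have link1: "locc_linked a b a b a b {0} (\<lambda>_. H) A G"
  proof -
    define J where "J P Q = tensor_superop a b a b (kernel_map a a (u P Q)) (kernel_map b b (f P Q))" for P Q
    have "one_way_local a b a b (B P) (J P)" if P: "P \<in> A" for P
    proof -
      have "one_way_local_snd a b a b (B P) (J P)"
        unfolding one_way_local_snd_def J_def
        using kernel_instrument[OF fin(2)[OF P] f(1)[OF P] f(2)[OF P] f(3)[OF P]] cptp_kernel_map[OF u(1)[OF P] u(2)[OF P]]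
        by (intro exI[of _ "\<lambda>Q. kernel_map b b (f P Q)"] exI[of _ "\<lambda>Q. kernel_map a a (u P Q)"]) auto
      then show ?thesis by (simp add: one_way_local_def)
    qed
    moreover have "coarse_graining D D (SIGMA P:A. B P) (\<lambda>(P, Q). J P Q \<circ> G P) {0} (\<lambda>_. H)"
      unfolding coarse_graining_def
    proof (intro exI[of _ "\<lambda>_. 0"] conjI ballI)
      show "(\<lambda>_. 0) ` (SIGMA P:A. B P) = {0::nat}" using A B by fastforce
      fix k :: nat assume "k \<in> {0}"
      have "superop_sum D D (SIGMA P:A. B P) (\<lambda>(P, Q). J P Q \<circ> G P) H"
        unfolding H_def
      proof (rule superop_sum_kernel_map[where e = "\<lambda>(P, Q). g P Q"])
        show "finite (SIGMA P:A. B P)" using fin by auto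
        fix x and X :: "complex mat" assume "x \<in> (SIGMA P:A. B P)"
        have "kernel_map D D (comp_kernel D (e' P) (tensor_kernel b b (u P Q) (f P Q))) X = kernel_map D D (g P Q) X" for P Q
          by (intro kernel_map_cong) (simp add: kernel_eq_def g)
        then show "(case x of (P, Q) \<Rightarrow> J P Q \<circ> G P) X = kernel_map D D (case x of (P, Q) \<Rightarrow> g P Q) X"
          by (cases x) (simp add: J_def G_def tensor_superop_kernel_map kernel_map_comp flip: D_def)
      next
        show "kernel_eq D D h (\<lambda>i j r c. \<Sum>x\<in>(SIGMA P:A. B P). (case x of (P, Q) \<Rightarrow> g P Q) i j r c)"
          using fin by (simp add: kernel_eq_def h_def sum.Sigma case_prod_beta)
      qed
      then show "superop_sum D D {i \<in> (SIGMA P:A. B P). 0 = k} (\<lambda>(P, Q). J P Q \<circ> G P) H"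
        using \<open>k \<in> {0}\<close> by simp
    qed
    ultimately show ?thesis unfolding locc_linked_def using H_instr
      by (intro conjI exI[of _ B] exI[of _ J]) (auto simp: D_def)
  qed
  \<comment> \<open>The definition asks for an infinite sequence of linked rounds, so the protocol
    is continued by rounds in which both parties apply the identity.\<close>
  have link2: "locc_linked a b a b a b {0} (\<lambda>_. H) {0} (\<lambda>_. H)"
  proof -
    define J where "J = tensor_superop a b a b (kernel_map a a id_kernel) (kernel_map b b id_kernel)"
    have "instrument a a {0} (\<lambda>_. kernel_map a a id_kernel)"
      using a tp_kernel_trace[OF tp_kernel_id] cp_kernel_id[of a] tp_kernel_id[of a]
      by (intro kernel_instrument) auto
    then have "one_way_local_fst a b a b {0} (\<lambda>_. J)"
      unfolding one_way_local_fst_def J_def using cptp_kernel_map[OF cp_kernel_id tp_kernel_id]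
      by (intro exI[of _ "\<lambda>_. kernel_map a a id_kernel"] exI[of _ "\<lambda>_. kernel_map b b id_kernel"]) auto
    then have "one_way_local a b a b {0} (\<lambda>_. J)" by (simp add: one_way_local_def)
    moreover have "coarse_graining D D (SIGMA P:{0::nat}. {0::nat}) (\<lambda>(P, Q). J \<circ> H) {0} (\<lambda>_. H)"
      unfolding coarse_graining_def
    proof (intro exI[of _ "\<lambda>_. 0"] conjI ballI)
      fix k :: nat assume "k \<in> {0}"
      have JH: "(J \<circ> H) X = kernel_map D D h X" for X
      proof -
        have "(J \<circ> H) X = kernel_map D D (comp_kernel D h (tensor_kernel b b id_kernel id_kernel)) X"
          by (simp add: J_def H_def tensor_superop_kernel_map kernel_map_comp flip: D_def)
        moreover have "tensor_kernel b b id_kernel id_kernel = id_kernel"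
        proof (intro ext)
          fix i j r c
          show "tensor_kernel b b id_kernel id_kernel i j r c = id_kernel i j r c"
            unfolding tensor_kernel_def id_kernel_def
            using eq_iff_div_mod[of r i b] eq_iff_div_mod[of c j b] by auto
        qed
        ultimately show ?thesis
          by (simp add: comp_id_kernel_right kernel_eq_def kernel_map_cong[of D D "comp_kernel D h id_kernel" h])
      qed
      have "superop_sum D D (SIGMA P:{0::nat}. {0::nat}) (\<lambda>(P, Q). J \<circ> H) H"
        unfolding H_def using JH
        by (intro superop_sum_kernel_map[where e = "\<lambda>_. h"]) (auto simp: kernel_eq_def H_def)
      then show "superop_sum D D {i \<in> (SIGMA P:{0::nat}. {0::nat}). 0 = k} (\<lambda>(P, Q). J \<circ> H) H"
        using \<open>k \<in> {0}\<close> by simp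
    qed auto
    ultimately show ?thesis unfolding locc_linked_def using H_instr
      by (intro conjI exI[of _ "\<lambda>_. {0}"] exI[of _ "\<lambda>_ _. J"]) (auto simp: D_def)
  qed
  \<comment> \<open>Index 0 stands for the measurement of Alice. From index 1 on the only outcome is
    \<open>H\<close>, so the approximants are eventually equal to the limit.\<close>
  define K' where "K' n = (if n = 0 then A else {0})" for n :: nat
  define G' where "G' n = (if n = 0 then G else (\<lambda>_. H))" for n :: nat
  have link: "locc_linked a b a b a b (K' (Suc n)) (G' (Suc n)) (K' n) (G' n)" for n
    using link1 link2 by (simp add: K'_def G'_def)
  have rounds: "locc_rounds a b a b (Suc n) (K' n) (G' n)" for n
  proof (induction n)
    case 0
    then show ?case using round1 by (simp add: K'_def G'_def)
  next
    case (Suc n)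
    then show ?case using link by (rule locc_rounds.link)
  qed
  have instr: "instrument D D (K' n) (G' n)" for n
    using G_instr H_instr by (simp add: K'_def G'_def)
  have cg: "coarse_graining D D (K' n) (G' n) (K' n) (G' n)" for n
    using coarse_graining_self[where K = A and d = D and d' = D and E = G and e = e']
      coarse_graining_self[where K = "{0}" and d = D and d' = D and E = "\<lambda>_. H" and e = "\<lambda>_. h"]
    by (auto simp: K'_def G'_def G_def[abs_def] H_def)
  have "family_dist_less D D (K' n) (G' n) {0} (\<lambda>_. H) \<epsilon>" if "0 < n" "0 < \<epsilon>" for n \<epsilon>
  proof -
    have "superop_norm D D (\<lambda>X. zero_ext D {0} (\<lambda>_. H) k X - zero_ext D {0} (\<lambda>_. H) k X) = 0" for k
      by (auto simp: superop_norm_def zero_ext_def H_def)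
    then show ?thesis unfolding family_dist_less_def using that
      by (intro exI[of _ 0]) (simp add: K'_def G'_def)
  qed
  then have lim: "\<forall>\<epsilon>>0. \<forall>\<^sub>F n in sequentially. family_dist_less D D (K' n) (G' n) {0} (\<lambda>_. H) \<epsilon>"
    by (auto intro: eventually_sequentiallyI[of 1])
  have "locc_instrument a b {0} (\<lambda>_. H)"
    unfolding locc_instrument_def
    using H_instr rounds link instr cg lim
    by (intro conjI exI[of _ "\<lambda>_. a"] exI[of _ "\<lambda>_. b"] exI[of _ K'] exI[of _ G'] exI[of _ K'] exI[of _ G'])
      (auto simp: D_def)
  moreover have "superop_sum (a * b) (a * b) {0::nat} (\<lambda>_. H) H"
    unfolding H_def D_def by (intro superop_sum_kernel_map[where e = "\<lambda>_. h"]) (auto simp: kernel_eq_def)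
  ultimately have "H \<in> LOCC a b" unfolding LOCC_def by blast
  then show ?thesis by (simp add: H_def h_def[abs_def] g_def D_def)
qed


section \<open>Pauli operators and Bell measurements\<close>

lemma pauli_mat_carrier: "pauli_mat p \<in> carrier_mat 2 2"
  by (cases p) (auto simp: mat_of_rows_list_def)

lemma pauli_string_carrier: "pauli_string ps \<in> carrier_mat (2 ^ length ps) (2 ^ length ps)"
  unfolding pauli_string_def
  by (induction ps) (auto simp: kron_def carrier_matD[OF pauli_mat_carrier])

definition pauli_op :: "pauli list \<Rightarrow> nat \<Rightarrow> nat \<Rightarrow> complex" where
  "pauli_op ps r i = pauli_string ps $$ (r, i)"

lemma pauli_op_Nil: "pauli_op [] 0 0 = 1"
  by (simp add: pauli_op_def pauli_string_def)

lemma pauli_op_Cons: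
  assumes "r < 2 * 2 ^ length ps" "i < 2 * 2 ^ length ps"
  shows "pauli_op (p # ps) r i =
    pauli_mat p $$ (r div 2 ^ length ps, i div 2 ^ length ps) * pauli_op ps (r mod 2 ^ length ps) (i mod 2 ^ length ps)"
proof -
  have "pauli_string (p # ps) = pauli_mat p \<otimes>\<^sub>k pauli_string ps" by (simp add: pauli_string_def)
  then show ?thesis
    using assms carrier_matD[OF pauli_mat_carrier[of p]] carrier_matD[OF pauli_string_carrier[of ps]]
    by (simp add: pauli_op_def kron_def)
qed

lemma pauli_op_append:
  assumes "r < 2 ^ (length ps + length qs)" "i < 2 ^ (length ps + length qs)"
  shows "pauli_op (ps @ qs) r i = prod_op (2 ^ length qs) (2 ^ length qs) (pauli_op ps) (pauli_op qs) r i"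
  using assms
proof (induction ps arbitrary: r i)
  case Nil
  then show ?case by (simp add: prod_op_def pauli_op_Nil)
next
  case (Cons p ps)
  let ?n = "2 ^ length ps :: nat" and ?m = "2 ^ length qs :: nat"
  have lt: "r < 2 * ?n * ?m" "i < 2 * ?n * ?m" using Cons.prems by (simp_all add: power_add)
  have mod_div: "x mod (?n * ?m) div ?m = x div ?m mod ?n" "x mod (?n * ?m) mod ?m = x mod ?m" for x
    using mod_mult2_eq[of x ?m ?n] by (simp_all add: mult.commute)
  have "pauli_op ((p # ps) @ qs) r i = pauli_mat p $$ (r div (?n * ?m), i div (?n * ?m)) *
      pauli_op (ps @ qs) (r mod (?n * ?m)) (i mod (?n * ?m))"
    using lt by (simp add: pauli_op_Cons power_add mult_ac)
  also have "\<dots> = pauli_mat p $$ (r div (?n * ?m), i div (?n * ?m)) *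
      (pauli_op ps (r div ?m mod ?n) (i div ?m mod ?n) * pauli_op qs (r mod ?m) (i mod ?m))"
    by (subst Cons.IH) (simp_all add: power_add prod_op_def mod_div)
  also have "\<dots> = prod_op ?m ?m (pauli_op (p # ps)) (pauli_op qs) r i"
    using lt by (simp add: prod_op_def pauli_op_Cons less_mult_imp_div_less div_mult2_eq mult.commute[of ?n ?m])
  finally show ?case by simp
qed

lemma UNIV_pauli: "UNIV = {PI, PX, PY, PZ}"
  by (auto intro: pauli.exhaust)

lemma pauli_mat_twirl:
  assumes "r < 2" "i < 2" "c < 2" "j < 2"
  shows "(\<Sum>p\<in>UNIV. pauli_mat p $$ (r, i) * cnj (pauli_mat p $$ (c, j))) = (if r = c \<and> i = j then 2 else 0)"
  using less_2_cases[OF assms(1)] less_2_cases[OF assms(2)] less_2_cases[OF assms(3)] less_2_cases[OF assms(4)]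
  unfolding UNIV_pauli by (elim disjE) (simp_all add: mat_of_rows_list_def)

lemma pauli_mat_unitary:
  assumes "i < 2" "j < 2"
  shows "(\<Sum>r<2. pauli_mat p $$ (r, i) * cnj (pauli_mat p $$ (r, j))) = (if i = j then 1 else 0)"
    "(\<Sum>r<2. pauli_mat p $$ (i, r) * cnj (pauli_mat p $$ (j, r))) = (if i = j then 1 else 0)"
  using less_2_cases[OF assms(1)] less_2_cases[OF assms(2)]
  by (cases p; auto simp: mat_of_rows_list_def numeral_2_eq_2)+

lemma sum_pauli_lists_Suc:
  "(\<Sum>ps | length ps = Suc n. f ps) = (\<Sum>p\<in>(UNIV::pauli set). \<Sum>ps | length ps = n. f (p # ps))"
proof -
  have "(\<Sum>p\<in>(UNIV::pauli set). \<Sum>ps | length ps = n. f (p # ps)) =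
      (\<Sum>x\<in>UNIV \<times> {ps. length ps = n}. f (fst x # snd x))"
    by (simp add: sum.cartesian_product case_prod_beta)
  also have "\<dots> = (\<Sum>ps | length ps = Suc n. f ps)"
    by (rule sum.reindex_bij_witness[of _ "\<lambda>ps. (hd ps, tl ps)" "\<lambda>(p, ps). p # ps"])
       (auto simp: length_Suc_conv)
  finally show ?thesis by simp
qed

text \<open>Completeness of the Pauli strings: the sum of all their conjugations maps
  \<open>X\<close> to \<open>2^n\<close> times its trace times the identity. This is what makes the
  Bell outcomes add up to a trace-preserving map. The relation factorises over the qubits.\<close>

lemma pauli_op_twirl:
  assumes "r < 2 ^ n" "i < 2 ^ n" "c < 2 ^ n" "j < 2 ^ n"
  shows "(\<Sum>ps | length ps = n. pauli_op ps r i * cnj (pauli_op ps c j)) = (if r = c \<and> i = j then 2 ^ n else 0)"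
  using assms
proof (induction n arbitrary: r i c j)
  case 0
  have "{ps::pauli list. length ps = 0} = {[]}" by auto
  then show ?case using 0 by (simp add: pauli_op_Nil)
next
  case (Suc n)
  let ?n = "2 ^ n :: nat"
  have lt: "r < 2 * ?n" "i < 2 * ?n" "c < 2 * ?n" "j < 2 * ?n" using Suc.prems by simp_all
  have "(\<Sum>ps | length ps = Suc n. pauli_op ps r i * cnj (pauli_op ps c j)) =
     (\<Sum>p\<in>UNIV. \<Sum>ps | length ps = n.
       (pauli_mat p $$ (r div ?n, i div ?n) * cnj (pauli_mat p $$ (c div ?n, j div ?n))) *
       (pauli_op ps (r mod ?n) (i mod ?n) * cnj (pauli_op ps (c mod ?n) (j mod ?n))))"
    unfolding sum_pauli_lists_Suc using lt by (intro sum.cong refl) (simp add: pauli_op_Cons mult_ac)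
  also have "\<dots> = (\<Sum>p\<in>UNIV. pauli_mat p $$ (r div ?n, i div ?n) * cnj (pauli_mat p $$ (c div ?n, j div ?n))) *
       (\<Sum>ps | length ps = n. pauli_op ps (r mod ?n) (i mod ?n) * cnj (pauli_op ps (c mod ?n) (j mod ?n)))"
    by (simp only: sum_product)
  also have "\<dots> = (if r div ?n = c div ?n \<and> i div ?n = j div ?n then 2 else 0) *
       (if r mod ?n = c mod ?n \<and> i mod ?n = j mod ?n then 2 ^ n else 0)"
    using lt by (simp add: Suc.IH pauli_mat_twirl less_mult_imp_div_less)
  also have "\<dots> = (if r = c \<and> i = j then 2 ^ Suc n else 0)"
    by (simp add: eq_iff_div_mod[of r c ?n] eq_iff_div_mod[of i j ?n])
  finally show ?case .
qed

lemma pauli_op_unitary: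
  assumes "length ps = n" "i < 2 ^ n" "j < 2 ^ n"
  shows "(\<Sum>r<2^n. pauli_op ps r i * cnj (pauli_op ps r j)) = (if i = j then 1 else 0) \<and>
    (\<Sum>r<2^n. pauli_op ps i r * cnj (pauli_op ps j r)) = (if i = j then 1 else 0)"
  using assms
proof (induction n arbitrary: ps i j)
  case 0
  then show ?case by (simp add: pauli_op_Nil)
next
  case (Suc n)
  then obtain p qs where ps: "ps = p # qs" "length qs = n" by (auto simp: length_Suc_conv)
  let ?n = "2 ^ n :: nat"
  have lt: "i < 2 * ?n" "j < 2 * ?n" using Suc.prems by simp_all
  have lt': "i div ?n < 2" "j div ?n < 2" using lt by (simp_all add: less_mult_imp_div_less)
  have 1: "(\<Sum>r<2*?n. pauli_op ps r i * cnj (pauli_op ps r j)) =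
     (\<Sum>q<2. \<Sum>r<?n. (pauli_mat p $$ (q, i div ?n) * cnj (pauli_mat p $$ (q, j div ?n))) *
        (pauli_op qs r (i mod ?n) * cnj (pauli_op qs r (j mod ?n))))"
    unfolding sum_prod_index ps(1) using lt ps(2)
    by (intro sum.cong refl) (simp add: pauli_op_Cons prod_index_less mult_ac)
  have 2: "(\<Sum>r<2*?n. pauli_op ps i r * cnj (pauli_op ps j r)) =
     (\<Sum>q<2. \<Sum>r<?n. (pauli_mat p $$ (i div ?n, q) * cnj (pauli_mat p $$ (j div ?n, q))) *
        (pauli_op qs (i mod ?n) r * cnj (pauli_op qs (j mod ?n) r)))"
    unfolding sum_prod_index ps(1) using lt ps(2)
    by (intro sum.cong refl) (simp add: pauli_op_Cons prod_index_less mult_ac)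
  have IH: "(\<Sum>r<?n. pauli_op qs r (i mod ?n) * cnj (pauli_op qs r (j mod ?n))) = (if i mod ?n = j mod ?n then 1 else 0)"
    "(\<Sum>r<?n. pauli_op qs (i mod ?n) r * cnj (pauli_op qs (j mod ?n) r)) = (if i mod ?n = j mod ?n then 1 else 0)"
    using Suc.IH[OF ps(2), of "i mod ?n" "j mod ?n"] by simp_all
  show ?case
    unfolding power_Suc 1 2 sum_product[symmetric] IH pauli_mat_unitary[OF lt']
    by (simp add: eq_iff_div_mod[of i j ?n])
qed

section \<open>Bell measurements with an arbitrary resource state\<close>

definition adj_kernel :: "(nat \<Rightarrow> nat \<Rightarrow> complex) \<Rightarrow> kernel" where
  "adj_kernel S p q r c = cnj (S p r) * S q c"

definition conj_kernel :: "(nat \<Rightarrow> nat \<Rightarrow> complex) \<Rightarrow> kernel" where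
  "conj_kernel K i j r c = K r i * cnj (K c j)"

lemma cp_kernel_adj: "cp_kernel d d' (adj_kernel S)"
  using cp_kernel_conj[of d d' "\<lambda>r p. cnj (S p r)"] by (simp add: adj_kernel_def[abs_def])

text \<open>\<open>adj_kernel S\<close> conjugates by the adjoint of \<open>S\<close>. It preserves
  the trace because the rows of a Pauli string are orthonormal.\<close>

lemma tp_kernel_adj_pauli: "length ps = n \<Longrightarrow> tp_kernel (2^n) (2^n) (adj_kernel (pauli_op ps))"
  unfolding tp_kernel_def adj_kernel_def using pauli_op_unitary[of ps n] by (auto simp: mult.commute)

text \<open>The map whose Choi state is \<open>\<rho>\<close>, with the reference as high digit; the
  factor \<open>a\<close> undoes the normalisation. For a state the total trace is \<open>a\<close>,
  but the map itself need not preserve the trace.\<close>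

definition state_kernel :: "nat \<Rightarrow> complex mat \<Rightarrow> kernel" where
  "state_kernel a \<rho> i j r c = of_nat a * \<rho> $$ (i * a + r, j * a + c)"

text \<open>The Bell measurement on the input and the reference half of \<open>\<rho>\<close> yields the outcome \<open>P\<close>.\<close>

definition bell_kernel :: "nat \<Rightarrow> complex mat \<Rightarrow> (nat \<Rightarrow> nat \<Rightarrow> complex) \<Rightarrow> kernel" where
  "bell_kernel a \<rho> P i j r c = comp_kernel a (conj_kernel P) (state_kernel a \<rho>) i j r c / (of_nat a)\<^sup>2"

lemma cp_kernel_scale:
  assumes "cp_kernel d d' e"
  shows "cp_kernel d d' (\<lambda>i j r c. e i j r c / (of_nat a)\<^sup>2)"
proof -
  obtain n :: nat and K where "kernel_eq d d' e (\<lambda>i j r c. \<Sum>k<n. K k r i * cnj (K k c j))"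
    using assms by (auto simp: cp_kernel_def)
  then show ?thesis unfolding cp_kernel_def
    by (intro exI[of _ n] exI[of _ "\<lambda>k r i. K k r i / of_nat a"])
      (simp add: kernel_eq_def sum_divide_distrib power2_eq_square)
qed

lemma cp_kernel_state:
  assumes "psd (a * a) \<rho>"
  shows "cp_kernel a a (state_kernel a \<rho>)"
proof -
  obtain n :: nat and v where v: "\<And>r c. r < a * a \<Longrightarrow> c < a * a \<Longrightarrow> \<rho> $$ (r, c) = (\<Sum>k<n. v k r * cnj (v k c))"
    using assms by (auto simp: psd_Gram_iff)
  have "complex_of_nat a = of_real (sqrt (real a)) * of_real (sqrt (real a))"
    by (simp flip: of_real_mult)
  then have "kernel_eq a a (state_kernel a \<rho>)
      (\<lambda>i j r c. \<Sum>k<n. (of_real (sqrt (real a)) * v k (i * a + r)) * cnj (of_real (sqrt (real a)) * v k (j * a + c)))"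
    unfolding kernel_eq_def state_kernel_def by (simp add: v prod_index_less sum_distrib_left mult_ac)
  then show ?thesis unfolding cp_kernel_def
    by (intro exI[of _ n] exI[of _ "\<lambda>k r i. of_real (sqrt (real a)) * v k (i * a + r)"])
qed

lemma cp_kernel_bell: "psd (a * a) \<rho> \<Longrightarrow> cp_kernel a a (bell_kernel a \<rho> P)"
  unfolding bell_kernel_def
  using cp_kernel_conj[of a a P] by (intro cp_kernel_scale cp_kernel_comp cp_kernel_state)
    (simp_all add: conj_kernel_def[abs_def])

lemma state_kernel_trace:
  assumes "\<rho> \<in> states (a * a)"
  shows "(\<Sum>s<a. \<Sum>r<a. state_kernel a \<rho> s s r r) = of_nat a"
proof -
  have "dim_row \<rho> = a * a" using assms by (auto simp: states_def psd_def)
  then have "(\<Sum>s<a. \<Sum>r<a. \<rho> $$ (s * a + r, s * a + r)) = 1"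
    using assms by (simp add: states_def mtrace_def sum_prod_index)
  then show ?thesis by (simp add: state_kernel_def flip: sum_distrib_left)
qed

lemma sum_diagonal:
  fixes R :: "'x \<Rightarrow> nat \<Rightarrow> nat \<Rightarrow> 'a::comm_ring_1"
  assumes "\<And>s t. s < a \<Longrightarrow> t < a \<Longrightarrow> (\<Sum>x\<in>A. R x s t) = (if s = t then w else 0)"
  shows "(\<Sum>x\<in>A. \<Sum>s<a. \<Sum>t<a. R x s t * S s t) = w * (\<Sum>s<a. S s s)"
proof -
  have "(\<Sum>x\<in>A. \<Sum>s<a. \<Sum>t<a. R x s t * S s t) = (\<Sum>s<a. \<Sum>t<a. (\<Sum>x\<in>A. R x s t) * S s t)"
    unfolding sum_distrib_right by (rule sum_swap3[symmetric])
  also have "\<dots> = (\<Sum>s<a. \<Sum>t<a. if s = t then w * S s t else 0)"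
    using assms by (intro sum.cong refl) simp
  finally show ?thesis by (simp add: sum_distrib_left)
qed

text \<open>Summing over the outcomes gives one factor \<open>2^n\<close> from the completeness
  relation and another from the trace of the state kernel. They account for the square in the
  denominator of \<open>bell_kernel\<close>.\<close>

lemma bell_kernel_sum_tp:
  assumes \<rho>: "\<rho> \<in> states (2 ^ n * 2 ^ n)"
  shows "tp_kernel (2^n) (2^n) (\<lambda>i j r c. \<Sum>ps | length ps = n. bell_kernel (2^n) \<rho> (pauli_op ps) i j r c)"
  unfolding tp_kernel_def
proof (intro allI impI)
  let ?a = "2 ^ n :: nat"
  fix i j assume ij: "i < ?a" "j < ?a"
  let ?s = "state_kernel ?a \<rho>"
  have "(\<Sum>ps | length ps = n. bell_kernel ?a \<rho> (pauli_op ps) i j r r) =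
     (if i = j then (\<Sum>s<?a. ?s s s r r) / of_nat ?a else 0)" for r
  proof -
    have "(\<Sum>ps | length ps = n. bell_kernel ?a \<rho> (pauli_op ps) i j r r) =
      (\<Sum>ps | length ps = n. \<Sum>s<?a. \<Sum>t<?a. (pauli_op ps s i * cnj (pauli_op ps t j)) * ?s s t r r) / (of_nat ?a)\<^sup>2"
      by (simp only: bell_kernel_def comp_kernel_def conj_kernel_def sum_divide_distrib)
    also have "(\<Sum>ps | length ps = n. \<Sum>s<?a. \<Sum>t<?a. (pauli_op ps s i * cnj (pauli_op ps t j)) * ?s s t r r) =
      (if i = j then of_nat ?a else 0) * (\<Sum>s<?a. ?s s s r r)"
      using ij by (intro sum_diagonal) (simp add: pauli_op_twirl)
    finally show ?thesis by (simp add: power2_eq_square)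
  qed
  then have "(\<Sum>r<?a. \<Sum>ps | length ps = n. bell_kernel ?a \<rho> (pauli_op ps) i j r r) =
     (if i = j then (\<Sum>r<?a. \<Sum>s<?a. ?s s s r r) / of_nat ?a else 0)"
    by (simp add: sum_divide_distrib)
  also have "(\<Sum>r<?a. \<Sum>s<?a. ?s s s r r) = of_nat ?a"
    using state_kernel_trace[OF \<rho>] by (subst sum.swap)
  finally show "(\<Sum>r<?a. \<Sum>ps | length ps = n. bell_kernel ?a \<rho> (pauli_op ps) i j r r) = (if i = j then 1 else 0)"
    by simp
qed

text \<open>Needed to see that no outcome vanishes, whatever the resource. Orthonormality of the
  rows reduces the sum over inputs to the trace \<open>2^n\<close> of the state kernel, and the
  denominator is its square.\<close>

lemma bell_kernel_trace:
  assumes \<rho>: "\<rho> \<in> states (2 ^ n * 2 ^ n)" and ps: "length ps = n"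
  shows "kernel_trace (2^n) (2^n) (bell_kernel (2^n) \<rho> (pauli_op ps)) = 1 / 2 ^ n"
proof -
  let ?a = "2 ^ n :: nat"
  let ?s = "state_kernel ?a \<rho>"
  have "(\<Sum>i<?a. bell_kernel ?a \<rho> (pauli_op ps) i i r r) = (\<Sum>s<?a. ?s s s r r) / (of_nat ?a)\<^sup>2" for r
  proof -
    have "(\<Sum>i<?a. bell_kernel ?a \<rho> (pauli_op ps) i i r r) =
      (\<Sum>i<?a. \<Sum>s<?a. \<Sum>t<?a. (pauli_op ps s i * cnj (pauli_op ps t i)) * ?s s t r r) / (of_nat ?a)\<^sup>2"
      by (simp only: bell_kernel_def comp_kernel_def conj_kernel_def sum_divide_distrib)
    also have "(\<Sum>i<?a. \<Sum>s<?a. \<Sum>t<?a. (pauli_op ps s i * cnj (pauli_op ps t i)) * ?s s t r r) =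
      1 * (\<Sum>s<?a. ?s s s r r)"
      using pauli_op_unitary[OF ps] by (intro sum_diagonal) simp
    finally show ?thesis by simp
  qed
  then have "(\<Sum>r<?a. \<Sum>i<?a. bell_kernel ?a \<rho> (pauli_op ps) i i r r) = (\<Sum>r<?a. \<Sum>s<?a. ?s s s r r) / (of_nat ?a)\<^sup>2"
    by (simp add: sum_divide_distrib)
  also have "(\<Sum>r<?a. \<Sum>s<?a. ?s s s r r) = of_nat ?a"
    using state_kernel_trace[OF \<rho>] by (subst sum.swap)
  finally have "(\<Sum>i<?a. \<Sum>r<?a. bell_kernel ?a \<rho> (pauli_op ps) i i r r) = of_real (1 / 2 ^ n)"
    by (subst sum.swap) (simp add: power2_eq_square)
  then show ?thesis unfolding kernel_trace_def by (simp only: Re_complex_of_real)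
qed


section \<open>Gate teleportation of Clifford unitaries\<close>

lemma comp_conj_kernel:
  "comp_kernel m (conj_kernel K) (conj_kernel M) i j r c = conj_kernel (\<lambda>r i. \<Sum>p<m. M r p * K p i) i j r c"
  by (simp add: comp_kernel_def conj_kernel_def sum_product mult_ac)

lemma adj_kernel_eq_conj: "adj_kernel S = conj_kernel (\<lambda>r p. cnj (S p r))"
  by (intro ext) (simp add: adj_kernel_def conj_kernel_def)

lemma tensor_conj_kernel: "tensor_kernel b b' (conj_kernel K) (conj_kernel L) = conj_kernel (prod_op b b' K L)"
  by (intro ext) (simp add: tensor_kernel_def conj_kernel_def prod_op_def)

lemma tensor_adj_kernel: "tensor_kernel b b (adj_kernel S) (adj_kernel T) = adj_kernel (prod_op b b S T)"
  by (intro ext) (simp add: tensor_kernel_def adj_kernel_def prod_op_def)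

definition mat_kernel :: "complex mat \<Rightarrow> kernel" where
  "mat_kernel U = conj_kernel (\<lambda>r i. U $$ (r, i))"

lemma unitary_channel_eq_kernel_map:
  assumes U: "U \<in> carrier_mat d d" and X: "X \<in> carrier_mat d d"
  shows "unitary_channel U X = kernel_map d d (mat_kernel U) X"
proof (rule eq_matI)
  fix r c assume "r < dim_row (kernel_map d d (mat_kernel U) X)"
    "c < dim_col (kernel_map d d (mat_kernel U) X)"
  then show "unitary_channel U X $$ (r, c) = kernel_map d d (mat_kernel U) X $$ (r, c)"
    using conj_mat_index[OF U X, of r c] by (simp add: unitary_channel_def mat_kernel_def conj_kernel_def)
qed (use U in \<open>auto simp: unitary_channel_def\<close>)

lemma linear_superop_unitary_channel:
  assumes "U \<in> carrier_mat d d"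
  shows "linear_superop d d (unitary_channel U)"
  using linear_superop_kernel_map[of d d "mat_kernel U"]
  unfolding linear_superop_def by (simp add: unitary_channel_eq_kernel_map[OF assms])

lemma ent_unitary_channel:
  assumes "U \<in> carrier_mat d d"
  shows "kernel_eq d d (ent d (unitary_channel U)) (mat_kernel U)"
proof -
  have "ent d (unitary_channel U) i j r c = ent d (kernel_map d d (mat_kernel U)) i j r c" for i j r c
    by (simp only: ent_def unitary_channel_eq_kernel_map[OF assms mat_unit_carrier])
  then show ?thesis by (simp add: kernel_eq_def)
qed

lemma hermitian_unitary_channel:
  assumes "U \<in> carrier_mat d d"
  shows "hermitian_kernel d d (ent d (unitary_channel U))"
  using ent_unitary_channel[OF assms] by (simp add: hermitian_kernel_def kernel_eq_def mat_kernel_def conj_kernel_def)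

definition pauli_pair :: "nat \<Rightarrow> pauli list \<Rightarrow> pauli list \<Rightarrow> nat \<Rightarrow> nat \<Rightarrow> complex" where
  "pauli_pair m ps qs = prod_op (2^m) (2^m) (pauli_op ps) (pauli_op qs)"

text \<open>The channel \<open>e\<close>, preceded by conjugation with \<open>R\<close> and followed
  by conjugation with the adjoint of \<open>V\<close>: the Bell outcome disturbs the input by
  \<open>R\<close>, and undoing \<open>V\<close> is meant to repair this after
  \<open>e\<close>.\<close>

definition correction :: "nat \<Rightarrow> (nat \<Rightarrow> nat \<Rightarrow> complex) \<Rightarrow> (nat \<Rightarrow> nat \<Rightarrow> complex) \<Rightarrow> kernel \<Rightarrow> kernel" where
  "correction d R V e = comp_kernel d (comp_kernel d (conj_kernel R) e) (adj_kernel V)"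

lemma pauli_string_append_index:
  assumes "length ps = n" "length qs = m" "r < 2^n * 2^m" "i < 2^n * 2^m"
  shows "pauli_string (ps @ qs) $$ (r, i) = pauli_pair m ps qs r i"
  using pauli_op_append[of r ps qs i] assms by (simp add: pauli_op_def pauli_pair_def power_add)

text \<open>Conjugation by \<open>U\<close> turns the string \<open>P\<close> into a string
  \<open>S\<close> up to a power of \<open>\<i>\<close>, so \<open>U * P\<close> is this phase times
  \<open>S * U\<close>. Undoing \<open>S\<close> leaves the phase times \<open>U\<close>, and the
  phase cancels in the channel. A Pauli string splits across any cut, which makes the correction
  local.\<close>

lemma clifford_correction:
  assumes U: "clifford (n + m) U" and ps: "length ps = n" and qs: "length qs = m"
  shows "\<exists>ss ts. length ss = n \<and> length ts = m \<and>
    kernel_eq (2^n * 2^m) (2^n * 2^m)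
      (correction (2^n * 2^m) (pauli_pair m ps qs)
        (pauli_pair m ss ts) (mat_kernel U))
      (mat_kernel U)"
proof -
  define D where "D = (2::nat) ^ n * 2 ^ m"
  have D: "D = 2 ^ (n + m)" by (simp add: D_def power_add)
  have Uc: "U \<in> carrier_mat D D" and UU: "mat_adjoint U * U = 1\<^sub>m D"
    using U by (auto simp: clifford_def unitary_mat_def D)
  define P where "P = pauli_string (ps @ qs)"
  have Pc: "P \<in> carrier_mat D D" using pauli_string_carrier[of "ps @ qs"] ps qs by (simp add: P_def D)
  have "P = \<i> ^ 0 \<cdot>\<^sub>m pauli_string (ps @ qs)" using Pc by (auto simp: P_def)
  then have "P \<in> pauli_group (n + m)" unfolding pauli_group_def using ps qs
    by (intro CollectI exI[of _ 0] exI[of _ "ps @ qs"]) simp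
  then obtain c s where s: "length s = n + m" and UP: "U * P * mat_adjoint U = \<i> ^ c \<cdot>\<^sub>m pauli_string s"
    using U unfolding clifford_def pauli_group_def by blast
  define ss where "ss = take n s"
  define ts where "ts = drop n s"
  have st: "s = ss @ ts" "length ss = n" "length ts = m" using s by (auto simp: ss_def ts_def)
  define S where "S = pauli_string s"
  have Sc: "S \<in> carrier_mat D D" using pauli_string_carrier[of s] s by (simp add: S_def D)
  have Uadj: "mat_adjoint U \<in> carrier_mat D D" using Uc by (intro carrier_matI) auto
  \<comment> \<open>Inserting \<open>mat_adjoint U * U\<close> turns the Clifford property into a
    commutation rule between \<open>U\<close> and Pauli strings.\<close>
  have "U * P = (U * P) * (mat_adjoint U * U)" unfolding UU using Uc Pc by simp
  also have "\<dots> = (U * P * mat_adjoint U) * U"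
    using Uc Pc Uadj by (metis assoc_mult_mat mult_carrier_mat)
  also have "\<dots> = \<i> ^ c \<cdot>\<^sub>m (S * U)"
    unfolding UP S_def[symmetric] using Sc Uc by (rule mult_smult_assoc_mat)
  finally have eq: "U * P = \<i> ^ c \<cdot>\<^sub>m (S * U)" .
  let ?R = "pauli_pair m ps qs" and ?V = "pauli_pair m ss ts"
  have P_idx: "P $$ (r, i) = ?R r i" if "r < D" "i < D" for r i
    unfolding P_def using pauli_string_append_index[OF ps qs] that by (simp add: D_def)
  have S_idx: "S $$ (r, i) = ?V r i" if "r < D" "i < D" for r i
    unfolding S_def st(1) using pauli_string_append_index[OF st(2,3)] that by (simp add: D_def)
  have S_unitary: "(\<Sum>p<D. S $$ (p, q) * cnj (S $$ (p, r))) = (if q = r then 1 else 0)" if "q < D" "r < D" for q r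
    using pauli_op_unitary[OF s, of q r] that by (simp add: S_def pauli_op_def D)
  have UP_idx: "(\<Sum>q<D. U $$ (p, q) * ?R q i) = \<i> ^ c * (\<Sum>q<D. S $$ (p, q) * U $$ (q, i))" if "p < D" "i < D" for p i
  proof -
    have "(U * P) $$ (p, i) = (\<Sum>q<D. U $$ (p, q) * ?R q i)"
      using Uc Pc that by (auto simp: scalar_prod_def lessThan_atLeast0 P_idx intro!: sum.cong)
    moreover have "(\<i> ^ c \<cdot>\<^sub>m (S * U)) $$ (p, i) = \<i> ^ c * (\<Sum>q<D. S $$ (p, q) * U $$ (q, i))"
      using Uc Sc that by (auto simp: scalar_prod_def lessThan_atLeast0 intro!: sum.cong)
    ultimately show ?thesis using eq by simp
  qed
  have key: "(\<Sum>p<D. cnj (?V p r) * (\<Sum>q<D. U $$ (p, q) * ?R q i)) = \<i> ^ c * U $$ (r, i)" if "r < D" "i < D" for r i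
  proof -
    have "(\<Sum>p<D. cnj (?V p r) * (\<Sum>q<D. U $$ (p, q) * ?R q i)) =
      (\<Sum>p<D. \<Sum>q<D. \<i> ^ c * U $$ (q, i) * (S $$ (p, q) * cnj (S $$ (p, r))))"
      using that by (intro sum.cong refl) (simp add: UP_idx S_idx sum_distrib_left mult_ac)
    also have "\<dots> = (\<Sum>q<D. \<Sum>p<D. \<i> ^ c * U $$ (q, i) * (S $$ (p, q) * cnj (S $$ (p, r))))"
      by (rule sum.swap)
    also have "\<dots> = (\<Sum>q<D. if q = r then \<i> ^ c * U $$ (q, i) else 0)"
      using that by (intro sum.cong refl) (simp add: S_unitary flip: sum_distrib_left)
    finally show ?thesis using that by simp
  qed
  have "kernel_eq D D (correction D ?R ?V (mat_kernel U)) (mat_kernel U)"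
    unfolding kernel_eq_def
  proof (intro allI impI)
    fix i j r k assume lt: "i < D" "j < D" "r < D" "k < D"
    have "comp_kernel D (conj_kernel ?R) (mat_kernel U) =
        conj_kernel (\<lambda>r i. \<Sum>p<D. U $$ (r, p) * ?R p i)"
      unfolding mat_kernel_def by (intro ext) (rule comp_conj_kernel)
    then have "correction D ?R ?V (mat_kernel U) i j r k =
        (\<i> ^ c * U $$ (r, i)) * cnj (\<i> ^ c * U $$ (k, j))"
      unfolding correction_def adj_kernel_eq_conj mat_kernel_def
      by (simp only: comp_conj_kernel) (simp only: conj_kernel_def key lt)
    also have "\<dots> = (\<i> ^ c * cnj (\<i> ^ c)) * (U $$ (r, i) * cnj (U $$ (k, j)))" by simp
    also have "\<i> ^ c * cnj (\<i> ^ c) = 1"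
      unfolding complex_norm_square[symmetric] by (simp add: norm_power)
    finally have "correction D ?R ?V (mat_kernel U) i j r k = U $$ (r, i) * cnj (U $$ (k, j))"
      by (simp only: mult_1_left)
    also have "\<dots> = mat_kernel U i j r k" by (simp add: mat_kernel_def conj_kernel_def)
    finally show "correction D ?R ?V (mat_kernel U) i j r k = mat_kernel U i j r k" .
  qed
  then show ?thesis unfolding D_def using st by blast
qed

lemma finite_UNIV_pauli: "finite (UNIV :: pauli set)"
  by (simp add: UNIV_pauli)

lemma finite_pauli_lists: "finite {ps :: pauli list. length ps = n}"
  using finite_lists_length_eq[OF finite_UNIV_pauli, of n] by simp

lemma card_pauli_lists: "card {ps :: pauli list. length ps = n} = 4 ^ n"
proof -
  have "card (UNIV :: pauli set) = 4" by (simp add: UNIV_pauli)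
  then show ?thesis using card_lists_length_eq[OF finite_UNIV_pauli, of n] by simp
qed

lemma comp_kernel_scale_left:
  "comp_kernel m (\<lambda>i j r c. e i j r c / x) f i j r c = comp_kernel m e f i j r c / x"
  by (simp add: comp_kernel_def sum_divide_distrib)

text \<open>The denominator equals \<open>4^n * 4^m\<close>, the number of pairs of outcomes, so
  this is the average of the corrected maps.\<close>

definition teleport_kernel ::
  "nat \<Rightarrow> nat \<Rightarrow> (pauli list \<Rightarrow> pauli list \<Rightarrow> pauli list) \<Rightarrow> (pauli list \<Rightarrow> pauli list \<Rightarrow> pauli list) \<Rightarrow> kernel \<Rightarrow> kernel" where
  "teleport_kernel n m ss ts e i j r c = (\<Sum>ps | length ps = n. \<Sum>qs | length qs = m.
     correction (2^n * 2^m) (pauli_pair m ps qs)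
       (pauli_pair m (ss ps qs) (ts ps qs)) e i j r c) / (of_nat (2^n * 2^m))\<^sup>2"

text \<open>Alice measures first; Bob's measurement includes his correction, and Alice corrects last.\<close>

lemma teleport_LOCC:
  assumes \<rho>: "\<rho> \<in> states (2^n * 2^n)" and \<tau>: "\<tau> \<in> states (2^m * 2^m)"
    and len: "\<And>ps qs. length ps = n \<Longrightarrow> length qs = m \<Longrightarrow> length (ss ps qs) = n \<and> length (ts ps qs) = m"
  shows "kernel_map (2^n * 2^m) (2^n * 2^m)
      (teleport_kernel n m ss ts (tensor_kernel (2^m) (2^m) (state_kernel (2^n) \<rho>) (state_kernel (2^m) \<tau>))) \<in> LOCC (2^n) (2^m)"
proof -
  let ?a = "2 ^ n :: nat" and ?b = "2 ^ m :: nat"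
  let ?P = "{ps :: pauli list. length ps = n}" and ?Q = "{qs :: pauli list. length qs = m}"
  let ?N = "tensor_kernel ?b ?b (state_kernel ?a \<rho>) (state_kernel ?b \<tau>)"
  let ?I = "{0..<card ?P}" and ?J = "{0..<card ?Q}"
  \<comment> \<open>Outcomes of instruments are natural numbers, so the Pauli strings are
    enumerated.\<close>
  obtain g where g: "bij_betw g ?I ?P"
    using ex_bij_betw_nat_finite[OF finite_pauli_lists] by blast
  obtain h where h: "bij_betw h ?J ?Q"
    using ex_bij_betw_nat_finite[OF finite_pauli_lists] by blast
  have gl: "length (g x) = n" if "x \<in> ?I" for x using bij_betwE[OF g] that by blast
  have hl: "length (h x) = m" if "x \<in> ?J" for x using bij_betwE[OF h] that by blast
  define e where "e ps = bell_kernel ?a \<rho> (pauli_op ps)" for ps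
  define u where "u ps qs = adj_kernel (pauli_op (ss ps qs))" for ps qs
  define f where "f ps qs = comp_kernel ?b (bell_kernel ?b \<tau> (pauli_op qs)) (adj_kernel (pauli_op (ts ps qs)))" for ps qs
  have psd: "psd (?a * ?a) \<rho>" "psd (?b * ?b) \<tau>" using \<rho> \<tau> by (auto simp: states_def)
  have "kernel_map (?a * ?b) (?a * ?b) (\<lambda>i j r c. \<Sum>P\<in>?I. \<Sum>Q\<in>?J.
      tensor_kernel ?b ?b (comp_kernel ?a (e (g P)) (u (g P) (h Q))) (f (g P) (h Q)) i j r c) \<in> LOCC ?a ?b"
  proof (rule two_round_LOCC)
    show "cp_kernel ?a ?a (e (g P))" for P unfolding e_def by (rule cp_kernel_bell[OF psd(1)])
    show "kernel_trace ?a ?a (e (g P)) \<noteq> 0" if "P \<in> ?I" for P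
      unfolding e_def bell_kernel_trace[OF \<rho> gl[OF that]] by simp
    show "tp_kernel ?a ?a (\<lambda>i j r c. \<Sum>P\<in>?I. e (g P) i j r c)"
    proof -
      have "(\<lambda>i j r c. \<Sum>P\<in>?I. e (g P) i j r c) =
          (\<lambda>i j r c. \<Sum>ps | length ps = n. bell_kernel ?a \<rho> (pauli_op ps) i j r c)"
        unfolding e_def by (intro ext sum.reindex_bij_betw[OF g])
      then show ?thesis using bell_kernel_sum_tp[OF \<rho>] by simp
    qed
    show "cp_kernel ?b ?b (f (g P) (h Q))" for P Q
      unfolding f_def by (intro cp_kernel_comp cp_kernel_bell psd(2) cp_kernel_adj)
    show "kernel_trace ?b ?b (f (g P) (h Q)) \<noteq> 0" if "P \<in> ?I" "Q \<in> ?J" for P Q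
    proof -
      have "length (ts (g P) (h Q)) = m" using len gl hl that by blast
      then have "kernel_trace ?b ?b (f (g P) (h Q)) = kernel_trace ?b ?b (bell_kernel ?b \<tau> (pauli_op (h Q)))"
        unfolding kernel_trace_def f_def by (simp only: trace_comp_kernel[OF tp_kernel_adj_pauli])
      then show ?thesis using bell_kernel_trace[OF \<tau> hl[OF that(2)]] by simp
    qed
    show "tp_kernel ?b ?b (\<lambda>i j r c. \<Sum>Q\<in>?J. f (g P) (h Q) i j r c)" if "P \<in> ?I" for P
      unfolding f_def
    proof (rule tp_kernel_comp_sum)
      have "(\<lambda>i j r c. \<Sum>Q\<in>?J. bell_kernel ?b \<tau> (pauli_op (h Q)) i j r c) =
          (\<lambda>i j r c. \<Sum>qs | length qs = m. bell_kernel ?b \<tau> (pauli_op qs) i j r c)"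
        by (intro ext sum.reindex_bij_betw[OF h])
      then show "tp_kernel ?b ?b (\<lambda>i j r c. \<Sum>Q\<in>?J. bell_kernel ?b \<tau> (pauli_op (h Q)) i j r c)"
        using bell_kernel_sum_tp[OF \<tau>] by simp
      show "tp_kernel ?b ?b (adj_kernel (pauli_op (ts (g P) (h Q))))" if "Q \<in> ?J" for Q
        using len gl hl that \<open>P \<in> ?I\<close> by (intro tp_kernel_adj_pauli) blast
    qed
    show "cp_kernel ?a ?a (u (g P) (h Q))" for P Q unfolding u_def by (rule cp_kernel_adj)
    show "tp_kernel ?a ?a (u (g P) (h Q))" if "P \<in> ?I" "Q \<in> ?J" for P Q
      unfolding u_def using len gl hl that by (intro tp_kernel_adj_pauli) blast
  qed auto
  moreover have "(\<Sum>P\<in>?I. \<Sum>Q\<in>?J.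
      tensor_kernel ?b ?b (comp_kernel ?a (e (g P)) (u (g P) (h Q))) (f (g P) (h Q)) i j r c) =
      teleport_kernel n m ss ts ?N i j r c" for i j r c
  proof -
    have "(\<Sum>P\<in>?I. \<Sum>Q\<in>?J.
      tensor_kernel ?b ?b (comp_kernel ?a (e (g P)) (u (g P) (h Q))) (f (g P) (h Q)) i j r c) =
      (\<Sum>ps\<in>?P. \<Sum>qs\<in>?Q. tensor_kernel ?b ?b (comp_kernel ?a (e ps) (u ps qs)) (f ps qs) i j r c)"
    proof -
      have "(\<Sum>Q\<in>?J. tensor_kernel ?b ?b (comp_kernel ?a (e (g P)) (u (g P) (h Q))) (f (g P) (h Q)) i j r c)
        = (\<Sum>qs\<in>?Q. tensor_kernel ?b ?b (comp_kernel ?a (e (g P)) (u (g P) qs)) (f (g P) qs) i j r c)" for P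
        by (rule sum.reindex_bij_betw[OF h])
      then show ?thesis
        using sum.reindex_bij_betw[OF g, of "\<lambda>ps. \<Sum>qs\<in>?Q. tensor_kernel ?b ?b (comp_kernel ?a (e ps) (u ps qs)) (f ps qs) i j r c"]
        by simp
    qed
    also have "\<dots> = (\<Sum>ps\<in>?P. \<Sum>qs\<in>?Q. correction (?a * ?b) (pauli_pair m ps qs)
        (pauli_pair m (ss ps qs) (ts ps qs))
        ?N i j r c / (of_nat (?a * ?b))\<^sup>2)"
    proof (intro sum.cong refl)
      fix ps qs
      have comp_tensor: "comp_kernel (?a * ?b) (tensor_kernel ?b ?b e1 f1) (tensor_kernel ?b ?b e2 f2) =
          tensor_kernel ?b ?b (comp_kernel ?a e1 e2) (comp_kernel ?b f1 f2)" for e1 f1 e2 f2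
        by (intro ext) (rule comp_tensor_kernel)
      have "correction (?a * ?b) (pauli_pair m ps qs)
        (pauli_pair m (ss ps qs) (ts ps qs))
        ?N =
        tensor_kernel ?b ?b
          (comp_kernel ?a (comp_kernel ?a (conj_kernel (pauli_op ps)) (state_kernel ?a \<rho>)) (u ps qs))
          (comp_kernel ?b (comp_kernel ?b (conj_kernel (pauli_op qs)) (state_kernel ?b \<tau>)) (adj_kernel (pauli_op (ts ps qs))))"
        unfolding correction_def pauli_pair_def tensor_conj_kernel[symmetric] tensor_adj_kernel[symmetric] comp_tensor u_def ..
      then show "tensor_kernel ?b ?b (comp_kernel ?a (e ps) (u ps qs)) (f ps qs) i j r c =
        correction (?a * ?b) (pauli_pair m ps qs)
        (pauli_pair m (ss ps qs) (ts ps qs))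
        ?N i j r c / (of_nat (?a * ?b))\<^sup>2"
        \<comment> \<open>The denominators of the two Bell measurements multiply to the squared
          joint dimension.\<close>
        unfolding e_def f_def bell_kernel_def[abs_def]
        by (simp add: tensor_kernel_def comp_kernel_scale_left power_mult_distrib)
    qed
    also have "\<dots> = teleport_kernel n m ss ts ?N i j r c"
      by (simp only: teleport_kernel_def sum_divide_distrib)
    finally show ?thesis .
  qed
  ultimately show ?thesis by (simp add: fun_eq_iff cong: kernel_map_cong)
qed

lemma comp_kernel_cong:
  assumes "kernel_eq d m e e'" "kernel_eq m d' f f'"
  shows "kernel_eq d d' (comp_kernel m e f) (comp_kernel m e' f')"
  using assms by (simp add: kernel_eq_def comp_kernel_def)

lemma correction_cong:
  "kernel_eq d d e f \<Longrightarrow> kernel_eq d d (correction d R V e) (correction d R V f)"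
  unfolding correction_def by (intro comp_kernel_cong) (auto simp: kernel_eq_def)

lemma comp_kernel_sum_left:
  "comp_kernel m (\<lambda>i j r c. \<Sum>y\<in>Y. x y * e y i j r c) f i j r c = (\<Sum>y\<in>Y. x y * comp_kernel m (e y) f i j r c)"
proof -
  have "comp_kernel m (\<lambda>i j r c. \<Sum>y\<in>Y. x y * e y i j r c) f i j r c =
      (\<Sum>p<m. \<Sum>q<m. \<Sum>y\<in>Y. x y * (e y i j p q * f p q r c))"
    by (simp add: comp_kernel_def sum_distrib_right mult.assoc)
  also have "\<dots> = (\<Sum>y\<in>Y. \<Sum>p<m. \<Sum>q<m. x y * (e y i j p q * f p q r c))"
    by (rule sum_swap3)
  finally show ?thesis by (simp add: comp_kernel_def sum_distrib_left)
qed

lemma correction_sum: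
  "correction d R V (\<lambda>i j r c. \<Sum>y\<in>Y. x y * e y i j r c) i j r c = (\<Sum>y\<in>Y. x y * correction d R V (e y) i j r c)"
proof -
  have "comp_kernel d (conj_kernel R) (\<lambda>i j r c. \<Sum>y\<in>Y. x y * e y i j r c) =
      (\<lambda>i j r c. \<Sum>y\<in>Y. x y * comp_kernel d (conj_kernel R) (e y) i j r c)"
    by (intro ext) (rule comp_kernel_sum_right)
  then show ?thesis unfolding correction_def by (simp only: comp_kernel_sum_left)
qed

lemma teleport_kernel_sum:
  "teleport_kernel n m ss ts (\<lambda>i j r c. \<Sum>y\<in>Y. x y * e y i j r c) i j r c =
     (\<Sum>y\<in>Y. x y * teleport_kernel n m ss ts (e y) i j r c)"
proof -
  let ?c = "\<lambda>ps qs. correction (2^n * 2^m) (pauli_pair m ps qs)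
       (pauli_pair m (ss ps qs) (ts ps qs))"
  have "(\<Sum>ps | length ps = n. \<Sum>qs | length qs = m. \<Sum>y\<in>Y. x y * ?c ps qs (e y) i j r c) =
      (\<Sum>y\<in>Y. \<Sum>ps | length ps = n. \<Sum>qs | length qs = m. x y * ?c ps qs (e y) i j r c)"
    by (rule sum_swap3)
  then show ?thesis
    unfolding teleport_kernel_def correction_sum by (simp add: sum_distrib_left sum_divide_distrib)
qed

text \<open>The answers to the outcomes are chosen once, from \<open>U\<close>. The second property
  is stated for every \<open>e\<close> that agrees with the kernel of \<open>U\<close> on the index
  range, since the resource in use is a signed sum of product kernels. All summands of the average
  then coincide.\<close>

lemma clifford_teleport:
  assumes "clifford (n + m) U"
  obtains ss ts where
    "\<And>ps qs. length ps = n \<Longrightarrow> length qs = m \<Longrightarrow> length (ss ps qs) = n \<and> length (ts ps qs) = m"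
    "\<And>e. kernel_eq (2^n * 2^m) (2^n * 2^m) e (mat_kernel U) \<Longrightarrow>
       kernel_eq (2^n * 2^m) (2^n * 2^m) (teleport_kernel n m ss ts e) e"
proof -
  let ?D = "2^n * 2^m :: nat" and ?U = "mat_kernel U"
  let ?c = "\<lambda>ps qs ss ts. correction ?D (pauli_pair m ps qs)
        (pauli_pair m ss ts)"
  have "\<forall>ps qs. \<exists>st. length ps = n \<and> length qs = m \<longrightarrow> length (fst st) = n \<and> length (snd st) = m \<and>
     kernel_eq ?D ?D (?c ps qs (fst st) (snd st) ?U) ?U"
    using clifford_correction[OF assms] by (metis fst_conv snd_conv)
  then obtain st where st: "\<And>ps qs. length ps = n \<Longrightarrow> length qs = m \<Longrightarrow>
     length (fst (st ps qs)) = n \<and> length (snd (st ps qs)) = m \<and>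
     kernel_eq ?D ?D (?c ps qs (fst (st ps qs)) (snd (st ps qs)) ?U) ?U"
    by metis
  have "kernel_eq ?D ?D (teleport_kernel n m (\<lambda>ps qs. fst (st ps qs)) (\<lambda>ps qs. snd (st ps qs)) e) e"
    if e: "kernel_eq ?D ?D e ?U" for e
    unfolding kernel_eq_def
  proof (intro allI impI)
    fix i j r c assume lt: "i < ?D" "j < ?D" "r < ?D" "c < ?D"
    have "(\<Sum>ps | length ps = n. \<Sum>qs | length qs = m. ?c ps qs (fst (st ps qs)) (snd (st ps qs)) e i j r c) =
        (\<Sum>ps :: pauli list | length ps = n. \<Sum>qs :: pauli list | length qs = m. e i j r c)"
    proof (intro sum.cong refl)
      fix ps qs :: "pauli list" assume "ps \<in> {ps. length ps = n}" "qs \<in> {qs. length qs = m}"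
      then have "kernel_eq ?D ?D (?c ps qs (fst (st ps qs)) (snd (st ps qs)) ?U) ?U" using st by blast
      then show "?c ps qs (fst (st ps qs)) (snd (st ps qs)) e i j r c = e i j r c"
        using correction_cong[OF e] e lt by (simp add: kernel_eq_def)
    qed
    also have "\<dots> = (of_nat ?D)\<^sup>2 * e i j r c"
    proof -
      have "(4::complex) ^ n * 4 ^ m = (2 ^ n * 2 ^ m)\<^sup>2"
        by (simp add: power_mult_distrib flip: power_mult) (simp add: power_mult mult.commute[of _ 2])
      then show ?thesis by (simp add: card_pauli_lists mult.assoc[symmetric])
    qed
    finally show "teleport_kernel n m (\<lambda>ps qs. fst (st ps qs)) (\<lambda>ps qs. snd (st ps qs)) e i j r c = e i j r c"
      by (simp add: teleport_kernel_def)
  qed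
  then show ?thesis
    by (intro that[of "\<lambda>ps qs. fst (st ps qs)" "\<lambda>ps qs. snd (st ps qs)"] conjI) (use st in blast)+
qed

section \<open>Teleportation through separable resources\<close>

lemma SEP_ref_carrier:
  "\<sigma> \<in> SEP_ref a b \<Longrightarrow> \<sigma> \<in> carrier_mat ((a * b) * (a * b)) ((a * b) * (a * b))"
  using reorder_carrier by (auto simp: SEP_ref_eq)

text \<open>The properties of a mixture are bundled so that its ingredients can be chosen for all
  states of a decomposition at once.\<close>

definition product_mixture ::
  "nat \<Rightarrow> nat \<Rightarrow> complex mat \<Rightarrow> nat \<Rightarrow> (nat \<Rightarrow> real) \<Rightarrow> (nat \<Rightarrow> complex mat) \<Rightarrow> (nat \<Rightarrow> complex mat) \<Rightarrow> bool" where
  "product_mixture a b \<sigma> l p \<rho> \<tau> \<longleftrightarrow>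
    (\<forall>y<l. 0 \<le> p y \<and> \<rho> y \<in> states (a * a) \<and> \<tau> y \<in> states (b * b)) \<and> (\<Sum>y<l. p y) = 1 \<and>
    (\<forall>i<a*b. \<forall>j<a*b. \<forall>r<a*b. \<forall>c<a*b. of_nat (a * b) * \<sigma> $$ (i * (a * b) + r, j * (a * b) + c) =
      (\<Sum>y<l. of_real (p y) * tensor_kernel b b (state_kernel a (\<rho> y)) (state_kernel b (\<tau> y)) i j r c))"

text \<open>The exchange of the middle factors sends the entry to the positions
  \<open>interleave a b i r\<close> and \<open>interleave a b j c\<close>, where the product of
  states is read off. The factor \<open>a * b\<close> splits into the factors \<open>a\<close> and
  \<open>b\<close> of the two state kernels.\<close>

lemma SEP_ref_product_mixture:
  assumes "\<sigma> \<in> SEP_ref a b"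
  shows "\<exists>l p \<rho> \<tau>. product_mixture a b \<sigma> l p \<rho> \<tau>"
proof -
  let ?N = "(a * a) * (b * b)"
  obtain l :: nat and p \<rho> \<tau> where st: "\<And>y. y < l \<Longrightarrow> 0 \<le> p y \<and> \<rho> y \<in> states (a * a) \<and> \<tau> y \<in> states (b * b)"
    and p: "(\<Sum>y<l. p y) = (1::real)"
    and \<sigma>: "\<sigma> = reorder a b (mat ?N ?N (\<lambda>rc. \<Sum>y<l. of_real (p y) * (\<rho> y \<otimes>\<^sub>k \<tau> y) $$ rc))"
    using assms unfolding SEP_ref_eq SEP_def by blast
  have eq: "of_nat (a * b) * \<sigma> $$ (i * (a * b) + r, j * (a * b) + c) =
      (\<Sum>y<l. of_real (p y) * tensor_kernel b b (state_kernel a (\<rho> y)) (state_kernel b (\<tau> y)) i j r c)"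
    if lt: "i < a * b" "j < a * b" "r < a * b" "c < a * b" for i j r c
  proof -
    let ?x = "interleave a b i r" and ?y = "interleave a b j c"
    have xy: "?x < ?N" "?y < ?N" using lt by (auto intro: interleave_less)
    have kr: "(\<rho> y \<otimes>\<^sub>k \<tau> y) $$ (?x, ?y) = \<rho> y $$ (?x div (b * b), ?y div (b * b)) * \<tau> y $$ (?x mod (b * b), ?y mod (b * b))"
      if "y < l" for y
      using st[OF that] xy by (auto simp: kron_def states_def psd_def)
    have "\<sigma> $$ (i * (a * b) + r, j * (a * b) + c) =
        mat ?N ?N (\<lambda>rc. \<Sum>y<l. of_real (p y) * (\<rho> y \<otimes>\<^sub>k \<tau> y) $$ rc) $$ (?x, ?y)"
      unfolding \<sigma> using lt by (subst reorder_index) (simp_all add: prod_index_less)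
    also have "\<dots> = (\<Sum>y<l. of_real (p y) * (\<rho> y \<otimes>\<^sub>k \<tau> y) $$ (?x, ?y))"
      using xy by simp
    finally have idx: "\<sigma> $$ (i * (a * b) + r, j * (a * b) + c) = (\<Sum>y<l. of_real (p y) * (\<rho> y \<otimes>\<^sub>k \<tau> y) $$ (?x, ?y))" .
    show ?thesis
      unfolding idx sum_distrib_left
      by (intro sum.cong refl) (simp add: kr interleave_div_mod lt tensor_kernel_def state_kernel_def mult_ac)
  qed
  have "product_mixture a b \<sigma> l p \<rho> \<tau>"
    unfolding product_mixture_def using st p eq by blast
  then show ?thesis by blast
qed

lemma smult_kernel_map:
  "z \<cdot>\<^sub>m kernel_map d d' e X = kernel_map d d' (\<lambda>i j r c. z * e i j r c) X"
  by (auto simp: kernel_map_def sum_distrib_left mult_ac intro!: eq_matI sum.cong)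

lemma qp_extent_le_sum:
  assumes Y: "finite Y" "Y \<noteq> {}" and S: "\<And>y. y \<in> Y \<Longrightarrow> kernel_map d d' (f y) \<in> S"
    and V: "\<And>X. X \<in> carrier_mat d d \<Longrightarrow> V X = kernel_map d d' e X"
    and e: "kernel_eq d d' e (\<lambda>i j r c. \<Sum>y\<in>Y. complex_of_real (\<beta> y) * f y i j r c)"
  shows "qp_extent d d' S V \<le> ereal (\<Sum>y\<in>Y. \<bar>\<beta> y\<bar>)"
proof -
  obtain h where h: "bij_betw h {0..<card Y} Y" using ex_bij_betw_nat_finite[OF Y(1)] by blast
  then have h: "bij_betw h {..<card Y} Y" by (simp add: lessThan_atLeast0)
  have hY: "h x \<in> Y" if "x < card Y" for x using bij_betwE[OF h] that by blast
  have "superop_sum d d' {..<card Y} (\<lambda>x X. complex_of_real (\<beta> (h x)) \<cdot>\<^sub>m kernel_map d d' (f (h x)) X) (kernel_map d d' e)"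
  proof (rule superop_sum_kernel_map[where e = "\<lambda>x i j r c. complex_of_real (\<beta> (h x)) * f (h x) i j r c"])
    have "(\<Sum>x<card Y. complex_of_real (\<beta> (h x)) * f (h x) i j r c) = (\<Sum>y\<in>Y. complex_of_real (\<beta> y) * f y i j r c)" for i j r c
      by (rule sum.reindex_bij_betw[OF h])
    then show "kernel_eq d d' e (\<lambda>i j r c. \<Sum>x<card Y. complex_of_real (\<beta> (h x)) * f (h x) i j r c)"
      using e by (simp add: kernel_eq_def)
  qed (simp_all add: smult_kernel_map)
  then have "superop_sum d d' {..<card Y} (\<lambda>x X. complex_of_real (\<beta> (h x)) \<cdot>\<^sub>m kernel_map d d' (f (h x)) X) V"
    by (simp add: superop_sum_def V)
  moreover have "1 \<le> card Y" using Y by (simp add: Suc_le_eq card_gt_0_iff)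
  moreover have "(\<Sum>x<card Y. \<bar>\<beta> (h x)\<bar>) = (\<Sum>y\<in>Y. \<bar>\<beta> y\<bar>)" by (rule sum.reindex_bij_betw[OF h])
  ultimately show ?thesis unfolding qp_extent_def using S hY
    by (intro Inf_lower CollectI exI[of _ "card Y"] exI[of _ "\<lambda>x. \<beta> (h x)"] exI[of _ "\<lambda>x. kernel_map d d' (f (h x))"]) auto
qed

text \<open>Each separable state is broken up into its product states, which are teleported one by
  one. The weights of a mixture are nonnegative and sum to 1, so the total absolute weight remains
  that of \<open>\<alpha>\<close>.\<close>

lemma SEP_decomposition_bound:
  fixes k :: nat
  assumes U: "clifford (n + m) U" and k: "1 \<le> k" and \<sigma>: "\<And>x. x < k \<Longrightarrow> \<sigma> x \<in> SEP_ref (2^n) (2^m)"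
    and choi: "\<And>x y. x < (2^n * 2^m) * (2^n * 2^m) \<Longrightarrow> y < (2^n * 2^m) * (2^n * 2^m) \<Longrightarrow>
      choi_state (2^n * 2^m) (2^n * 2^m) (unitary_channel U) $$ (x, y) = (\<Sum>h<k. of_real (\<alpha> h) * \<sigma> h $$ (x, y))"
  shows "qp_extent (2^n * 2^m) (2^n * 2^m) (LOCC (2^n) (2^m)) (unitary_channel U) \<le> ereal (\<Sum>h<k. \<bar>\<alpha> h\<bar>)"
proof -
  define a b D where "a = (2::nat) ^ n" and "b = (2::nat) ^ m" and "D = a * b"
  have D: "0 < D" by (simp add: D_def a_def b_def)
  have Uc: "U \<in> carrier_mat D D"
    using U by (simp add: clifford_def unitary_mat_def D_def a_def b_def power_add)
  obtain ss ts where len: "\<And>ps qs. length ps = n \<Longrightarrow> length qs = m \<Longrightarrow> length (ss ps qs) = n \<and> length (ts ps qs) = m"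
    and tele: "\<And>e. kernel_eq D D e (mat_kernel U) \<Longrightarrow> kernel_eq D D (teleport_kernel n m ss ts e) e"
    using clifford_teleport[OF U] unfolding D_def a_def b_def by blast
  have "\<forall>x\<in>{..<k}. \<exists>l p \<rho> \<tau>. product_mixture a b (\<sigma> x) l p \<rho> \<tau>"
    using \<sigma> by (intro ballI SEP_ref_product_mixture) (simp add: a_def b_def)
  from bchoice[OF this] obtain l where "\<forall>x\<in>{..<k}. \<exists>p \<rho> \<tau>. product_mixture a b (\<sigma> x) (l x) p \<rho> \<tau>" by blast
  from bchoice[OF this] obtain p where "\<forall>x\<in>{..<k}. \<exists>\<rho> \<tau>. product_mixture a b (\<sigma> x) (l x) (p x) \<rho> \<tau>" by blast
  from bchoice[OF this] obtain \<rho> where "\<forall>x\<in>{..<k}. \<exists>\<tau>. product_mixture a b (\<sigma> x) (l x) (p x) (\<rho> x) \<tau>" by blast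
  from bchoice[OF this] obtain \<tau> where dec: "\<forall>x\<in>{..<k}. product_mixture a b (\<sigma> x) (l x) (p x) (\<rho> x) (\<tau> x)" by blast
  have st: "0 \<le> p x y \<and> \<rho> x y \<in> states (a * a) \<and> \<tau> x y \<in> states (b * b)" if "x < k" "y < l x" for x y
    using dec that unfolding product_mixture_def D_def by blast
  have p: "(\<Sum>y<l x. p x y) = (1::real)" if "x < k" for x
    using dec that unfolding product_mixture_def D_def by blast
  have eq: "of_nat D * \<sigma> x $$ (i * D + r, j * D + c) =
      (\<Sum>y<l x. of_real (p x y) * tensor_kernel b b (state_kernel a (\<rho> x y)) (state_kernel b (\<tau> x y)) i j r c)"
    if "x < k" "i < D" "j < D" "r < D" "c < D" for x i j r c
    using dec that unfolding product_mixture_def D_def by blast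
  define Y where "Y = (SIGMA x:{..<k}. {..<l x})"
  define \<beta> where "\<beta> = (\<lambda>(x, y). \<alpha> x * p x y)"
  define N where "N = (\<lambda>(x, y). tensor_kernel b b (state_kernel a (\<rho> x y)) (state_kernel b (\<tau> x y)))"
  define E where "E = (\<lambda>i j r c. \<Sum>y\<in>Y. complex_of_real (\<beta> y) * N y i j r c)"
  have E: "kernel_eq D D E (mat_kernel U)"
    unfolding kernel_eq_def
  proof (intro allI impI)
    fix i j r c assume lt: "i < D" "j < D" "r < D" "c < D"
    have "mat_kernel U i j r c = ent D (unitary_channel U) i j r c"
      using ent_unitary_channel[OF Uc] lt by (simp add: kernel_eq_def)
    also have "\<dots> = of_nat D * choi_state D D (unitary_channel U) $$ (i * D + r, j * D + c)"
      using choi_state_index[OF linear_superop_unitary_channel[OF Uc], of "i * D + r" "j * D + c"] lt D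
      by (simp add: prod_index_less)
    also have "\<dots> = of_nat D * (\<Sum>x<k. of_real (\<alpha> x) * \<sigma> x $$ (i * D + r, j * D + c))"
      using choi[of "i * D + r" "j * D + c"] lt by (simp add: D_def a_def b_def prod_index_less)
    also have "\<dots> = (\<Sum>x<k. of_real (\<alpha> x) * (of_nat D * \<sigma> x $$ (i * D + r, j * D + c)))"
      by (simp add: sum_distrib_left mult_ac)
    also have "\<dots> = (\<Sum>x<k. \<Sum>y<l x. complex_of_real (\<beta> (x, y)) * N (x, y) i j r c)"
      using lt by (intro sum.cong refl) (simp add: eq \<beta>_def N_def sum_distrib_left mult.assoc)
    also have "\<dots> = E i j r c"
      unfolding E_def Y_def by (subst sum.Sigma) (auto simp: case_prod_beta)
    finally show "E i j r c = mat_kernel U i j r c" by simp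
  qed
  have "qp_extent D D (LOCC a b) (unitary_channel U) \<le> ereal (\<Sum>y\<in>Y. \<bar>\<beta> y\<bar>)"
  proof (rule qp_extent_le_sum[where e = "mat_kernel U" and f = "\<lambda>y. teleport_kernel n m ss ts (N y)"])
    show "finite Y" by (simp add: Y_def)
    \<comment> \<open>The weights of a mixture sum to 1, so none is empty, and there is at least one
      product state.\<close>
    have "l 0 \<noteq> 0" using p[of 0] k by (auto intro!: Nat.gr0I)
    then have "(0, 0) \<in> Y" using k by (simp add: Y_def)
    then show "Y \<noteq> {}" by blast
    show "unitary_channel U X = kernel_map D D (mat_kernel U) X" if "X \<in> carrier_mat D D" for X
      using unitary_channel_eq_kernel_map[OF Uc that] .
    show "kernel_map D D (teleport_kernel n m ss ts (N y)) \<in> LOCC a b" if "y \<in> Y" for y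
      using that st len unfolding Y_def N_def D_def a_def b_def by (auto intro!: teleport_LOCC)
    \<comment> \<open>Teleporting through \<open>E\<close> reproduces \<open>E\<close>, hence
      \<open>U\<close>. Linearity then distributes the teleportation over the product
      pieces.\<close>
    have "kernel_eq D D (mat_kernel U) (teleport_kernel n m ss ts E)"
      using tele[OF E] E by (simp add: kernel_eq_def)
    then show "kernel_eq D D (mat_kernel U)
        (\<lambda>i j r c. \<Sum>y\<in>Y. complex_of_real (\<beta> y) * teleport_kernel n m ss ts (N y) i j r c)"
      unfolding E_def teleport_kernel_sum[abs_def] .
  qed
  also have "(\<Sum>y\<in>Y. \<bar>\<beta> y\<bar>) = (\<Sum>x<k. \<Sum>y<l x. \<bar>\<alpha> x\<bar> * p x y)"
    unfolding Y_def \<beta>_def by (subst sum.Sigma) (auto simp: abs_mult st intro!: sum.cong)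
  also have "\<dots> = (\<Sum>x<k. \<bar>\<alpha> x\<bar>)"
    by (simp add: p flip: sum_distrib_left)
  finally show ?thesis by (simp add: D_def a_def b_def)
qed

section \<open>The three inequalities\<close>

lemma qp_extent_antimono: "S \<subseteq> T \<Longrightarrow> qp_extent d d' T E \<le> qp_extent d d' S E"
  unfolding qp_extent_def by (intro Inf_superset_mono) blast

lemma one_smult_mat: "(1::complex) \<cdot>\<^sub>m A = A"
  by (intro eq_matI) auto

lemma LOCC_subset_LOCC_star: "LOCC a b \<subseteq> LOCC_star a b"
proof
  fix F assume "F \<in> LOCC a b"
  then obtain I E where "locc_instrument a b I E" "superop_sum (a * b) (a * b) I E F"
    by (auto simp: LOCC_def)
  then show "F \<in> LOCC_star a b" unfolding LOCC_star_def
    by (intro CollectI exI[of _ I] exI[of _ E] exI[of _ "\<lambda>_. 1"])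
      (simp add: one_smult_mat)
qed

theorem corollary5p41:
  fixes n m :: nat and U :: "complex mat"
  assumes "clifford (n + m) U"
  shows "qp_extent (2^n * 2^m) (2^n * 2^m) (LOCC_star (2^n) (2^m)) (unitary_channel U) =
           qp_extent (2^n * 2^m) (2^n * 2^m) (LOCC (2^n) (2^m)) (unitary_channel U) \<and>
         qp_extent (2^n * 2^m) (2^n * 2^m) (LOCC (2^n) (2^m)) (unitary_channel U) =
           qp_extent_op ((2^n * 2^m) * (2^n * 2^m)) (SEP_ref (2^n) (2^m))
             (choi_state (2^n * 2^m) (2^n * 2^m) (unitary_channel U))"
proof -
  let ?D = "2^n * 2^m :: nat" and ?V = "unitary_channel U"
  let ?J = "choi_state ?D ?D ?V"
  have Uc: "U \<in> carrier_mat ?D ?D"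
    using assms by (simp add: clifford_def unitary_mat_def power_add)
  \<comment> \<open>The inequalities form a cycle: the extent for LOCC-star is at most that for
    LOCC, which is at most that of the Choi state, which is at most that for LOCC-star.\<close>
  have le1: "qp_extent ?D ?D (LOCC_star (2^n) (2^m)) ?V \<le> qp_extent ?D ?D (LOCC (2^n) (2^m)) ?V"
    by (intro qp_extent_antimono LOCC_subset_LOCC_star)
  have le2: "qp_extent ?D ?D (LOCC (2^n) (2^m)) ?V \<le> qp_extent_op (?D * ?D) (SEP_ref (2^n) (2^m)) ?J"
    \<comment> \<open>Fixing the input dimension 1 unfolds the extent of the operator only.\<close>
    unfolding qp_extent_op_def qp_extent_def[of 1]
  proof (rule Inf_greatest, clarify)
    fix k :: nat and \<alpha> :: "nat \<Rightarrow> real" and F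
    assume k: "1 \<le> k" and F: "\<forall>i<k. F i \<in> op_superop ` SEP_ref (2^n) (2^m)"
      and sum: "superop_sum 1 (?D * ?D) {..<k} (\<lambda>i X. complex_of_real (\<alpha> i) \<cdot>\<^sub>m F i X) (op_superop ?J)"
    from F have "\<forall>i. \<exists>\<sigma>. i < k \<longrightarrow> \<sigma> \<in> SEP_ref (2^n) (2^m) \<and> F i = op_superop \<sigma>" by blast
    then obtain \<sigma> where \<sigma>: "\<And>i. i < k \<Longrightarrow> \<sigma> i \<in> SEP_ref (2^n) (2^m)" "\<And>i. i < k \<Longrightarrow> F i = op_superop (\<sigma> i)"
      by metis
    show "qp_extent ?D ?D (LOCC (2^n) (2^m)) ?V \<le> ereal (\<Sum>i<k. \<bar>\<alpha> i\<bar>)"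
    proof (rule SEP_decomposition_bound[OF assms k \<sigma>(1)])
      fix x y assume xy: "x < ?D * ?D" "y < ?D * ?D"
      \<comment> \<open>Evaluation at the one-dimensional identity turns the decomposition of maps
        back into one of operators.\<close>
      have "((\<lambda>i. (complex_of_real (\<alpha> i) \<cdot>\<^sub>m F i (1\<^sub>m 1)) $$ (x, y)) has_sum op_superop ?J (1\<^sub>m 1) $$ (x, y)) {..<k}"
        using sum[unfolded superop_sum_def, THEN bspec, OF one_carrier_mat, THEN conjunct2, rule_format, OF xy] .
      then have "op_superop ?J (1\<^sub>m 1) $$ (x, y) = (\<Sum>i<k. (complex_of_real (\<alpha> i) \<cdot>\<^sub>m F i (1\<^sub>m 1)) $$ (x, y))"
        by (rule has_sum_unique) simp
      also have "\<dots> = (\<Sum>i<k. of_real (\<alpha> i) * \<sigma> i $$ (x, y))"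
      proof (intro sum.cong refl)
        fix i assume "i \<in> {..<k}"
        then have "F i = op_superop (\<sigma> i)" "\<sigma> i \<in> carrier_mat (?D * ?D) (?D * ?D)"
          using \<sigma>(2) SEP_ref_carrier[OF \<sigma>(1)] by auto
        then show "(complex_of_real (\<alpha> i) \<cdot>\<^sub>m F i (1\<^sub>m 1)) $$ (x, y) = of_real (\<alpha> i) * \<sigma> i $$ (x, y)"
          using xy by (simp add: op_superop_def)
      qed
      also have "op_superop ?J (1\<^sub>m 1) $$ (x, y) = ?J $$ (x, y)"
        using xy carrier_matD[OF choi_state_carrier[of ?D ?D ?V]] by (simp add: op_superop_def)
      finally show "?J $$ (x, y) = (\<Sum>i<k. of_real (\<alpha> i) * \<sigma> i $$ (x, y))" .
    qed
  qed
  have le3: "qp_extent_op (?D * ?D) (SEP_ref (2^n) (2^m)) ?J \<le> qp_extent ?D ?D (LOCC_star (2^n) (2^m)) ?V"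
    unfolding qp_extent_def[of ?D]
  proof (rule Inf_greatest, clarify)
    fix k :: nat and \<alpha> :: "nat \<Rightarrow> real" and F
    assume "\<forall>i<k. F i \<in> LOCC_star (2^n) (2^m)"
      and "superop_sum ?D ?D {..<k} (\<lambda>i X. complex_of_real (\<alpha> i) \<cdot>\<^sub>m F i X) ?V"
    then show "qp_extent_op (?D * ?D) (SEP_ref (2^n) (2^m)) ?J \<le> ereal (\<Sum>i<k. \<bar>\<alpha> i\<bar>)"
      using linear_superop_unitary_channel[OF Uc] hermitian_unitary_channel[OF Uc]
      by (intro LOCC_star_decomposition_bound) auto
  qed
  show ?thesis
    using le1 le2 order_trans[OF le2 le3] order_trans[OF le3 le1] by (intro conjI order_antisym)
qed

end
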